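(* Let $(\alpha,\beta)\in\mathcal A$, suppose $X\in\mathcal D(\alpha,\beta)$ and suppose that $X$ is $(h,a)$-lattice. Let $(\delta_n)$ be a sequence of positive numbers with $\delta_n\to0$ as $n\to\infty$. Then $$c_n\,\mathbf P\big(S_n=an+x\,\big|\,\tau^->n\big)\sim h\,g_{\alpha,\beta}(0)\,\frac{H(an+x)}{n\,\mathbf P(\tau^->n)}\quad\text{as }n\to\infty,$$ uniformly in $x\in(-an,-an+\delta_nc_n]\cap h\mathbb Z$ (that is, the supremum over such $x$ of the absolute value of the ratio of the two sides minus $1$ tends to $0$).
   Context: $X,X_1,X_2,\dots$ are i.i.d. real random variables, $S_0=0$, $S_n=X_1+\dots+X_n$, $\tau^-=\min\{n\ge1:S_n\le0\}$, $\tau^+=\min\{n\ge1:S_n>0\}$, $\chi^+=S_{\tau^+}$, and $\chi_1^+,\chi_2^+,\dots$ are independent copies of $\chi^+$. The renewal function is $$H(u)=\mathrm I\{u>0\}+\sum_{k=1}^\infty\mathbf P(\chi_1^++\dots+\chi_k^+<u).$$ $\mathcal A=\{0<\alpha<1,|\beta|<1\}\cup\{1<\alpha<2,|\beta|\le1\}\cup\{(1,0)\}\cup\{(2,0)\}$. Let $\mu(u)=u^{-2}\int_{[-u,u]}x^2\,\mathbf P(X\in dx)$, $u>0$, and let $(c_n)_{n\ge1}$ be a non-decreasing sequence of positive real numbers with $c_n=\sup\{u>0:\mu(u)>1/n\}$ for all sufficiently large $n$. For $(\alpha,\beta)\in\mathcal A$, $X\in\mathcal D(\alpha,\beta)$ means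 that $\mathbf EX=0$ if this moment exists and that $X$ lies in the domain of attraction of the stable law with characteristic function $$G_{\alpha,\beta}(t)=\exp\Big\{-c|t|^{\alpha}\Big(1-i\beta\frac{t}{|t|}\tan\frac{\pi\alpha}{2}\Big)\Big\}$$ (the $\beta\tan$ term being $0$ when $\beta=0$), with the convention that $c>0$ is the constant for which $S_n/c_n$ converges in distribution to this law (no centering needed). $g_{\alpha,\beta}$ is the (continuous) density of this stable law. $X$ is $(h,a)$-lattice, with span $h>0$ and shift $a\in[0,h)$, if $h$ is the maximal number such that the support of the distribution of $X$ is contained in $\{a+kh:k\in\mathbb Z\}$. *)

theory Defs
  imports "HOL-Probability.Probability" "HOL-Library.Extended_Nat"
begin

(* The steps X_1, X_2, ... are X 0, X 1, ...; the generic variable X is represented by X 0. *)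

definition iid :: "'a measure \<Rightarrow> (nat \<Rightarrow> 'a \<Rightarrow> real) \<Rightarrow> bool" where
  "iid M X \<longleftrightarrow> prob_space.indep_vars M (\<lambda>_. borel) X UNIV
     \<and> (\<forall>i. distr M borel (X i) = distr M borel (X 0))"

definition walk :: "(nat \<Rightarrow> 'a \<Rightarrow> real) \<Rightarrow> nat \<Rightarrow> 'a \<Rightarrow> real" where
  "walk X n \<omega> = (\<Sum>i<n. X i \<omega>)"

(* The infimum of the empty set of extended naturals is \<infinity>, the value when the time never occurs. *)

definition tau_minus :: "(nat \<Rightarrow> 'a \<Rightarrow> real) \<Rightarrow> 'a \<Rightarrow> enat" where
  "tau_minus X \<omega> = (INF n\<in>{n. 1 \<le> n \<and> walk X n \<omega> \<le> 0}. enat n)"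

definition tau_plus :: "(nat \<Rightarrow> 'a \<Rightarrow> real) \<Rightarrow> 'a \<Rightarrow> enat" where
  "tau_plus X \<omega> = (INF n\<in>{n. 1 \<le> n \<and> walk X n \<omega> > 0}. enat n)"

(* The value on the event tau_plus = \<infinity> is unspecified; that event is null
   for every walk considered here. *)
definition chi_plus :: "(nat \<Rightarrow> 'a \<Rightarrow> real) \<Rightarrow> 'a \<Rightarrow> real" where
  "chi_plus X \<omega> = walk X (the_enat (tau_plus X \<omega>)) \<omega>"

(* Independent copies of chi_plus are the coordinates of an infinite product space;
   the sum over k \<ge> 1 is written with k = Suc j. *)

definition chi_copies :: "'a measure \<Rightarrow> (nat \<Rightarrow> 'a \<Rightarrow> real) \<Rightarrow> (nat \<Rightarrow> real) measure" where
  "chi_copies M X = PiM UNIV (\<lambda>_. distr M borel (chi_plus X))"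

definition renewal :: "'a measure \<Rightarrow> (nat \<Rightarrow> 'a \<Rightarrow> real) \<Rightarrow> real \<Rightarrow> real" where
  "renewal M X u = indicator {0<..} u
     + (\<Sum>j. \<P>(y in chi_copies M X. (\<Sum>i<Suc j. y i) < u))"

definition stable_params :: "(real \<times> real) set" where
  "stable_params = {(\<alpha>, \<beta>). 0 < \<alpha> \<and> \<alpha> < 1 \<and> \<bar>\<beta>\<bar> < 1}
     \<union> {(\<alpha>, \<beta>). 1 < \<alpha> \<and> \<alpha> < 2 \<and> \<bar>\<beta>\<bar> \<le> 1} \<union> {(1, 0)} \<union> {(2, 0)}"

(* At t = 0 the value is 1, since 0 powr \<alpha> = 0. *)
definition stable_char :: "real \<Rightarrow> real \<Rightarrow> real \<Rightarrow> real \<Rightarrow> complex" where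
  "stable_char \<alpha> \<beta> \<kappa> t =
     exp (- (complex_of_real (\<kappa> * \<bar>t\<bar> powr \<alpha>)
            * (1 - \<i> * complex_of_real (\<beta> * sgn t * tan (pi * \<alpha> / 2)))))"

definition stable_law :: "real \<Rightarrow> real \<Rightarrow> real \<Rightarrow> real measure \<Rightarrow> bool" where
  "stable_law \<alpha> \<beta> \<kappa> L \<longleftrightarrow> real_distribution L \<and> char L = stable_char \<alpha> \<beta> \<kappa>"

definition stable_density :: "real \<Rightarrow> real \<Rightarrow> real \<Rightarrow> (real \<Rightarrow> real) \<Rightarrow> bool" where
  "stable_density \<alpha> \<beta> \<kappa> g \<longleftrightarrow> continuous_on UNIV g \<and> (\<forall>x. 0 \<le> g x)
     \<and> stable_law \<alpha> \<beta> \<kappa> (density lborel (\<lambda>x. ennreal (g x)))"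

definition trunc_second_moment :: "real measure \<Rightarrow> real \<Rightarrow> real" where
  "trunc_second_moment P u = (1 / u\<^sup>2) * (LINT x:{-u..u}|P. x\<^sup>2)"

definition norming_seq :: "real measure \<Rightarrow> (nat \<Rightarrow> real) \<Rightarrow> bool" where
  "norming_seq P c \<longleftrightarrow> (\<forall>n\<ge>1. 0 < c n) \<and> mono_on {1..} c
     \<and> (\<forall>\<^sub>F n in sequentially. c n = Sup {u. 0 < u \<and> trunc_second_moment P u > 1 / real n})"

(* Attraction of X to the (\<alpha>, \<beta>)-stable law, with the scale \<kappa> of the limit
   fixed by the norming c and without centering. *)
definition attracted :: "'a measure \<Rightarrow> (nat \<Rightarrow> 'a \<Rightarrow> real) \<Rightarrow> (nat \<Rightarrow> real)
    \<Rightarrow> real \<Rightarrow> real \<Rightarrow> real \<Rightarrow> bool" where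
  "attracted M X c \<alpha> \<beta> \<kappa> \<longleftrightarrow>
     (integrable M (X 0) \<longrightarrow> (LINT \<omega>|M. X 0 \<omega>) = 0) \<and> 0 < \<kappa>
     \<and> (\<exists>L. stable_law \<alpha> \<beta> \<kappa> L
           \<and> weak_conv_m (\<lambda>n. distr M borel (\<lambda>\<omega>. walk X n \<omega> / c n)) L)"

definition lattice_points :: "real \<Rightarrow> real \<Rightarrow> real set" where
  "lattice_points h a = range (\<lambda>k::int. a + of_int k * h)"

definition law_support :: "real measure \<Rightarrow> real set" where
  "law_support P = {x. \<forall>U. open U \<and> x \<in> U \<longrightarrow> 0 < emeasure P U}"

(* The span is maximal over all shifts, not only over lattices with the given shift:
   a variable with values 1 and 3 is (2,1)-lattice and not (1,0)-lattice. *)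
definition lattice_law :: "real measure \<Rightarrow> real \<Rightarrow> real \<Rightarrow> bool" where
  "lattice_law P h a \<longleftrightarrow> 0 < h \<and> 0 \<le> a \<and> a < h \<and> law_support P \<subseteq> lattice_points h a
     \<and> (\<forall>h' a'. 0 < h' \<and> law_support P \<subseteq> lattice_points h' a' \<longrightarrow> h' \<le> h)"

end

theory Submission
  imports Defs "HOL-Complex_Analysis.Complex_Analysis" "HOL-Real_Asymp.Real_Asymp"
begin

text \<open>
Write b(n, x) for the probability that the walk is at x at time n and has been positive at the
times 1, ..., n. Dividing by the probability of positivity cancels on both sides of the claim, which
therefore says that n c(n) b(n, x) is asymptotic to h g(0) H(x), uniformly for
0 < x \<le> \<delta>(n) c(n) in the lattice of S(n).

\<^bold>\<open>The identity behind the constant.\<close> Spitzer's identity, differentiated in the generating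
variable, reads
  n b(n, x) = sum over k from 1 to n and over y < x of P(S(k) = x - y) b(n - k, y)
(\<open>spitzer\<close>, \<open>stay_prob_sum\<close>). By duality, the sum of b(j, y) over all j and all y < x is H(x)
(\<open>suminf_pos_walk\<close>, \<open>renewal_eq_potential\<close>). If j = n - k is small compared with n, then by the local
limit theorem P(S(k) = x - y) is close to h g(0) / c(n), and these terms add up to
h g(0) H(x) / c(n). All other terms have to be shown to be negligible.

\<^bold>\<open>The a priori bound.\<close> What makes them negligible is b(n, x) \<le> C H(x) / (n c(n)) for n \<ge> 1
and x > 0 (\<open>stay_prob_bound\<close>). Cut a path of length n into three parts of comparable length m. The first part
stays positive, the second one contributes sup P(S(m) = z) \<le> C / c(m), and the last one, read
backwards, is a walk that stays below x. Let v(l, x) be the mass of the paths of length l that stay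
below x in this sense. Decomposing at the maximum gives
  v(0, x) + ... + v(m, x) \<le> H(x) (w(0) + ... + w(m)), where w(j) = P(tau^+ > j).
The Wiener--Hopf factorisation gives that the sum over j \<le> m of w(j) P(tau^- > m - j) is 1, so that
P(tau^- > m) (w(0) + ... + w(m)) \<le> 1. As v decreases in l, it follows that
(m + 1) P(tau^- > m) v(m, x) \<le> H(x) (\<open>pos_walk_le_potential\<close>).

\<^bold>\<open>The algebra.\<close> Spitzer's identity, the Wiener--Hopf factorisation and duality are identities between
sequences of discrete measures on the line under convolution in space and time. They are derived
from the one-step recursions of the killed walks; multiplication by time, which is a derivation,
takes the place of the derivative of a generating function.

\<^bold>\<open>The local limit theorem.\<close> Convergence of S(n) / c(n) enters through characteristic functions. As
convergence holds along arguments t(n) \<longlonglongrightarrow> t as well, it forces c(m) / c(n) \<longlonglongrightarrow> \<theta> powr (1 / \<alpha>) whenever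
m / n \<longlonglongrightarrow> \<theta> (\<open>c_ratio\<close>), and from this the domination that the inversion formula needs
(\<open>lam_power_dominated\<close>, \<open>local_limit\<close>). The same regularity of c makes the tails of the potential
small (\<open>below_prob_tail\<close>). Finally g(0) is positive because it is a positive multiple of the real part
of z powr (- 1 / \<alpha>), where z is the coefficient of - t powr \<alpha>, t > 0, in the logarithm of the stable
characteristic function, and the argument of z is smaller than \<pi>\<alpha>/2 for the admissible parameters
(\<open>integral_stable_char_pos\<close>).
\<close>

section \<open>Convolution of discrete measures\<close>

text \<open>
A function to the extended nonnegative reals stands for a measure by its point masses. The sum over
all points is an integral against the counting measure, and Tonelli's theorem holds for it on
uncountable types as well, so that the real line can be the group.
\<close>
definition conv :: "('g::ab_group_add \<Rightarrow> ennreal) \<Rightarrow> ('g \<Rightarrow> ennreal) \<Rightarrow> 'g \<Rightarrow> ennreal" where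
  "conv f g x = (\<integral>\<^sup>+y. f y * g (x - y) \<partial>count_space UNIV)"

definition mass :: "('g \<Rightarrow> ennreal) \<Rightarrow> ennreal" where
  "mass f = (\<integral>\<^sup>+x. f x \<partial>count_space UNIV)"

definition point_mass :: "'g::zero \<Rightarrow> ennreal" where
  "point_mass = indicator {0}"

lemma nn_integral_count_space_swap:
  fixes f :: "'a \<Rightarrow> 'b \<Rightarrow> ennreal"
  shows "(\<integral>\<^sup>+x. \<integral>\<^sup>+y. f x y \<partial>count_space UNIV \<partial>count_space UNIV)
    = (\<integral>\<^sup>+y. \<integral>\<^sup>+x. f x y \<partial>count_space UNIV \<partial>count_space UNIV)"
  using nn_integral_fst_count_space[of "\<lambda>(x, y). f x y"]
    nn_integral_snd_count_space[of "\<lambda>(x, y). f x y"] by simp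

lemma nn_integral_count_space_bij:
  assumes "bij r"
  shows "(\<integral>\<^sup>+y. f (r y) \<partial>count_space UNIV) = (\<integral>\<^sup>+y. f y \<partial>count_space UNIV)"
  using assms by (intro nn_integral_bij_count_space) simp

lemma bij_minus_left: "bij (\<lambda>y. x - y :: 'g::ab_group_add)"
  by (rule involuntory_imp_bij) simp

lemma bij_minus_right: "bij (\<lambda>y. y - z :: 'g::ab_group_add)"
  by (rule bij_betw_byWitness[where f' = "\<lambda>y. y + z"]) auto

lemma conv_commute: "conv f g = conv g f"
proof
  fix x
  show "conv f g x = conv g f x"
    unfolding conv_def
    by (subst nn_integral_count_space_bij[OF bij_minus_left[of x], symmetric])
       (simp add: mult.commute)
qed

lemma conv_add_left: "conv (\<lambda>x. f x + f' x) g x = conv f g x + conv f' g x"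
  unfolding conv_def by (simp add: distrib_right nn_integral_add)

lemma conv_add_right: "conv f (\<lambda>x. g x + g' x) x = conv f g x + conv f g' x"
  unfolding conv_def by (simp add: distrib_left nn_integral_add)

lemma conv_mult_left: "conv (\<lambda>x. k * f x) g x = k * conv f g x"
  unfolding conv_def by (simp add: nn_integral_cmult mult.assoc)

lemma conv_mult_right: "conv f (\<lambda>x. g x * k) x = conv f g x * k"
  unfolding conv_def by (simp add: nn_integral_multc mult.assoc[symmetric])

lemma conv_sum_right: "finite I \<Longrightarrow> conv f (\<lambda>x. \<Sum>i\<in>I. g i x) x = (\<Sum>i\<in>I. conv f (g i) x)"
  unfolding conv_def by (simp add: sum_distrib_left nn_integral_sum)

lemma conv_sum_left: "finite I \<Longrightarrow> conv (\<lambda>x. \<Sum>i\<in>I. f i x) g x = (\<Sum>i\<in>I. conv (f i) g x)"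
  by (simp add: conv_commute[of _ g] conv_sum_right)

lemma conv_suminf_right: "conv f (\<lambda>x. \<Sum>i. g i x) x = (\<Sum>i. conv f (g i) x)"
  unfolding conv_def by (simp flip: ennreal_suminf_cmult add: nn_integral_suminf)

lemma conv_mono: "(\<And>y. f y \<le> f' y) \<Longrightarrow> (\<And>y. g y \<le> g' y) \<Longrightarrow> conv f g x \<le> conv f' g' x"
  unfolding conv_def by (intro nn_integral_mono mult_mono) auto

lemma conv_assoc: "conv (conv f g) h = conv f (conv g h)"
proof
  fix x
  have "conv (conv f g) h x
      = (\<integral>\<^sup>+y. \<integral>\<^sup>+z. f z * (g (y - z) * h (x - y)) \<partial>count_space UNIV \<partial>count_space UNIV)"
    unfolding conv_def by (simp add: nn_integral_multc[symmetric] mult.assoc)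
  also have "\<dots> = (\<integral>\<^sup>+z. \<integral>\<^sup>+y. f z * (g (y - z) * h (x - y)) \<partial>count_space UNIV \<partial>count_space UNIV)"
    by (rule nn_integral_count_space_swap)
  also have "\<dots> = (\<integral>\<^sup>+z. f z * (\<integral>\<^sup>+y. g (y - z) * h (x - z - (y - z)) \<partial>count_space UNIV) \<partial>count_space UNIV)"
    by (simp add: nn_integral_cmult)
  also have "\<dots> = conv f (conv g h) x"
    unfolding conv_def
    unfolding nn_integral_count_space_bij[OF bij_minus_right, where f = "\<lambda>y. g y * h (x - z - y)" for z]
    by (simp add: conv_def)
  finally show "conv (conv f g) h x = conv f (conv g h) x" .
qed

lemma nn_integral_count_space_single:
  assumes "\<And>y. y \<noteq> z \<Longrightarrow> f y = 0"
  shows "(\<integral>\<^sup>+y. f y \<partial>count_space UNIV) = f z"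
proof -
  have "(\<integral>\<^sup>+y. f y \<partial>count_space UNIV) = (\<integral>\<^sup>+y. f z * indicator {z} y \<partial>count_space UNIV)"
    using assms by (intro nn_integral_cong) (auto simp: indicator_def)
  then show ?thesis by (simp add: nn_integral_cmult)
qed

lemma conv_point_mass_left [simp]: "conv point_mass f = f"
proof
  show "conv point_mass f x = f x" for x
    unfolding conv_def by (subst nn_integral_count_space_single[of 0]) (auto simp: point_mass_def)
qed

lemma conv_point_mass_right [simp]: "conv f point_mass = f"
  by (simp add: conv_commute[of f])

lemma mass_conv: "mass (conv f g) = mass f * mass g"
proof -
  have "mass (conv f g) = (\<integral>\<^sup>+y. \<integral>\<^sup>+x. f y * g (x - y) \<partial>count_space UNIV \<partial>count_space UNIV)"
    unfolding mass_def conv_def by (rule nn_integral_count_space_swap)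
  also have "\<dots> = (\<integral>\<^sup>+y. f y * mass g \<partial>count_space UNIV)"
    by (simp add: nn_integral_cmult nn_integral_count_space_bij[OF bij_minus_right] mass_def)
  finally show ?thesis by (simp add: nn_integral_multc mass_def)
qed

lemma mass_point_mass [simp]: "mass point_mass = 1"
  unfolding mass_def by (subst nn_integral_count_space_single[of 0]) (auto simp: point_mass_def)

lemma mass_add: "mass (\<lambda>x. f x + g x) = mass f + mass g"
  unfolding mass_def by (simp add: nn_integral_add)

lemma mass_sum: "finite I \<Longrightarrow> mass (\<lambda>x. \<Sum>i\<in>I. f i x) = (\<Sum>i\<in>I. mass (f i))"
  unfolding mass_def by (simp add: nn_integral_sum)

lemma mass_mono: "(\<And>x. f x \<le> g x) \<Longrightarrow> mass f \<le> mass g"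
  unfolding mass_def by (intro nn_integral_mono) auto

lemma le_mass: "f x \<le> mass f"
proof -
  have "f x = (\<integral>\<^sup>+y. f x * indicator {x} y \<partial>count_space UNIV)"
    by (simp add: nn_integral_cmult)
  also have "\<dots> \<le> mass f"
    unfolding mass_def by (intro nn_integral_mono) (auto simp: indicator_def)
  finally show ?thesis .
qed

lemma conv_le_mass:
  assumes "\<And>z. g z \<le> s"
  shows "conv f g x \<le> mass f * s"
proof -
  have "conv f g x \<le> (\<integral>\<^sup>+y. f y * s \<partial>count_space UNIV)"
    unfolding conv_def by (intro nn_integral_mono mult_left_mono assms) auto
  then show ?thesis by (simp add: nn_integral_multc mass_def)
qed

lemma conv_eq_0:
  assumes "\<And>y. f y = 0 \<or> g (x - y) = 0"
  shows "conv f g x = 0"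
proof -
  have *: "f y * g (x - y) = 0" for y
    using assms[of y] by auto
  show ?thesis unfolding conv_def * by simp
qed

section \<open>Convolution in space and time\<close>

text \<open>
A sequence of measures, indexed by time, is one measure on time \<times> space. The Cauchy product of
two such sequences is the convolution on this product group, from which it inherits associativity
and commutativity.
\<close>
definition spacetime :: "(nat \<Rightarrow> 'g \<Rightarrow> ennreal) \<Rightarrow> int \<times> 'g \<Rightarrow> ennreal" where
  "spacetime f z = (if 0 \<le> fst z then f (nat (fst z)) (snd z) else 0)"

lemma conv_spacetime:
  "conv (spacetime f) (spacetime g) (int n, x) = (\<Sum>i\<le>n. conv (f i) (g (n - i)) x)"
proof -
  have "conv (spacetime f) (spacetime g) (int n, x)
      = (\<integral>\<^sup>+m. \<integral>\<^sup>+y. spacetime f (m, y) * spacetime g (int n - m, x - y) \<partial>count_space UNIV \<partial>count_space UNIV)"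
    unfolding conv_def by (subst nn_integral_fst_count_space[symmetric]) simp
  also have "\<dots> = (\<integral>\<^sup>+m. \<integral>\<^sup>+y. spacetime f (m, y) * spacetime g (int n - m, x - y) \<partial>count_space UNIV
        \<partial>count_space (int ` {..n}))"
  proof (rule nn_integral_count_space_eq)
    fix m assume "m \<in> UNIV - int ` {..n}"
    then have "m < 0 \<or> int n - m < 0"
      by (auto simp: image_iff) (metis atMost_iff int_nat_eq linorder_not_le nat_le_iff)
    then have *: "spacetime f (m, y) * spacetime g (int n - m, x - y) = 0" for y
      by (auto simp: spacetime_def)
    show "(\<integral>\<^sup>+y. spacetime f (m, y) * spacetime g (int n - m, x - y) \<partial>count_space UNIV) = 0"
      unfolding * by simp
  qed auto
  also have "\<dots> = (\<Sum>m\<in>int ` {..n}. \<integral>\<^sup>+y. spacetime f (m, y) * spacetime g (int n - m, x - y) \<partial>count_space UNIV)"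
    by (simp add: nn_integral_count_space_finite)
  also have "\<dots> = (\<Sum>i\<le>n. \<integral>\<^sup>+y. spacetime f (int i, y) * spacetime g (int n - int i, x - y) \<partial>count_space UNIV)"
    by (subst sum.reindex) auto
  also have "\<dots> = (\<Sum>i\<le>n. conv (f i) (g (n - i)) x)"
    unfolding conv_def spacetime_def by (intro sum.cong nn_integral_cong refl) (auto simp: nat_diff_distrib)
  finally show ?thesis .
qed

lemma conv_spacetime_neg: "n < 0 \<Longrightarrow> conv (spacetime f) (spacetime g) (n, x) = 0"
  by (rule conv_eq_0) (auto simp: spacetime_def)

definition gconv :: "(nat \<Rightarrow> 'g::ab_group_add \<Rightarrow> ennreal) \<Rightarrow> (nat \<Rightarrow> 'g \<Rightarrow> ennreal) \<Rightarrow> nat \<Rightarrow> 'g \<Rightarrow> ennreal" where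
  "gconv f g n x = (\<Sum>i\<le>n. conv (f i) (g (n - i)) x)"

lemma spacetime_gconv: "spacetime (gconv f g) = conv (spacetime f) (spacetime g)"
proof
  fix z :: "int \<times> 'a"
  obtain m x where z: "z = (m, x)" by force
  show "spacetime (gconv f g) z = conv (spacetime f) (spacetime g) z"
  proof (cases "0 \<le> m")
    case True
    then obtain n where "m = int n" by (metis nonneg_int_cases)
    then show ?thesis using z conv_spacetime[of f g n x] by (simp add: spacetime_def gconv_def)
  next
    case False
    then show ?thesis using z conv_spacetime_neg[of m f g x] by (simp add: spacetime_def)
  qed
qed

lemma spacetime_inject: "spacetime f = spacetime g \<longleftrightarrow> f = g"
proof
  assume *: "spacetime f = spacetime g"
  show "f = g"
  proof (intro ext)
    fix n x show "f n x = g n x"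
      using fun_cong[OF *, of "(int n, x)"] by (simp add: spacetime_def)
  qed
qed simp

lemma gconv_commute: "gconv f g = gconv g f"
  by (subst spacetime_inject[symmetric]) (simp only: spacetime_gconv conv_commute)

lemma gconv_assoc: "gconv (gconv f g) h = gconv f (gconv g h)"
  by (subst spacetime_inject[symmetric]) (simp only: spacetime_gconv conv_assoc)

lemma gconv_left_commute: "gconv f (gconv g h) = gconv g (gconv f h)"
  by (simp only: gconv_assoc[symmetric] gconv_commute[of f g])

lemma gconv_add_left: "gconv (\<lambda>n x. f n x + f' n x) g n x = gconv f g n x + gconv f' g n x"
  by (simp add: gconv_def conv_add_left sum.distrib)

lemma gconv_add_right: "gconv f (\<lambda>n x. g n x + g' n x) n x = gconv f g n x + gconv f g' n x"
  by (simp add: gconv_def conv_add_right sum.distrib)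

text \<open>
The analogue of s d/ds for generating functions in s: multiplication by the time coordinate is
additive on time \<times> space and therefore a derivation of the convolution.
\<close>
definition by_time :: "(nat \<Rightarrow> 'g \<Rightarrow> ennreal) \<Rightarrow> nat \<Rightarrow> 'g \<Rightarrow> ennreal" where
  "by_time f n x = of_nat n * f n x"

lemma by_time_gconv:
  "by_time (gconv f g) n x = gconv (by_time f) g n x + gconv f (by_time g) n x"
proof -
  have "of_nat n * conv (f i) (g (n - i)) x
      = conv (by_time f i) (g (n - i)) x + conv (f i) (by_time g (n - i)) x" if "i \<le> n" for i
  proof -
    have n: "(of_nat n :: ennreal) = of_nat i + of_nat (n - i)"
      using that by (metis le_add_diff_inverse of_nat_add)
    show ?thesis
      unfolding by_time_def conv_mult_left n distrib_right
      by (simp add: conv_commute[of "f i"] conv_mult_left)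
  qed
  then show ?thesis
    unfolding by_time_def[of "gconv f g"] gconv_def sum_distrib_left
    by (simp add: sum.distrib)
qed

definition unit_seq :: "nat \<Rightarrow> 'g::zero \<Rightarrow> ennreal" where
  "unit_seq n = (if n = 0 then point_mass else (\<lambda>_. 0))"

lemma conv_0 [simp]: "conv (\<lambda>_. 0) g = (\<lambda>_. 0)" "conv f (\<lambda>_. 0) = (\<lambda>_. 0)"
  by (auto simp: conv_def fun_eq_iff)

lemma gconv_unit_left [simp]: "gconv unit_seq g = g"
proof (intro ext)
  fix n x
  have "gconv unit_seq g n x = (\<Sum>i\<le>n. if i = 0 then g n x else 0)"
    unfolding gconv_def by (intro sum.cong) (auto simp: unit_seq_def)
  then show "gconv unit_seq g n x = g n x" by simp
qed

lemma gconv_unit_right [simp]: "gconv g unit_seq = g"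
  by (simp add: gconv_commute[of g])

definition one_step :: "('g \<Rightarrow> ennreal) \<Rightarrow> nat \<Rightarrow> 'g \<Rightarrow> ennreal" where
  "one_step p n = (if n = 1 then p else (\<lambda>_. 0))"

lemma gconv_one_step_0 [simp]: "gconv (one_step p) g 0 x = 0"
  by (simp add: gconv_def one_step_def)

lemma gconv_one_step_Suc [simp]: "gconv (one_step p) g (Suc n) x = conv p (g n) x"
proof -
  have "gconv (one_step p) g (Suc n) x = (\<Sum>i\<le>Suc n. if i = 1 then conv p (g n) x else 0)"
    unfolding gconv_def by (intro sum.cong) (auto simp: one_step_def)
  then show ?thesis by simp
qed

section \<open>Killed walks: Spitzer's identity and the Wiener--Hopf factorisation\<close>

text \<open>
The condition on the set of allowed positions under which the factorisation works: convolving
measures that live on one side never produces mass on the other side. Here it is used for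
\<open>{0<..}\<close>, \<open>{..0}\<close> and \<open>UNIV\<close>.
\<close>
definition splits_additively :: "real set \<Rightarrow> bool" where
  "splits_additively A \<longleftrightarrow> (\<forall>x\<in>A. \<forall>y\<in>A. x + y \<in> A) \<and> (\<forall>x\<in>-A. \<forall>y\<in>-A. x + y \<in> -A)"

lemma splits_additively_compl: "splits_additively A \<Longrightarrow> splits_additively (-A)"
  by (auto simp: splits_additively_def)

text \<open>
The walk is represented by the point masses p of its step law only. In it, \<open>stay A n\<close> is the
law of the position at time n on the event that the positions at the times 1, ..., n lie in A,
\<open>exits A n\<close> is the law of the position at time n on the event that n is the first positive time at
which the position is outside A, and \<open>hits A\<close> is the free walk at positive times, cut down to A. All
identities below follow from \<open>stay_plus_exits\<close>.
\<close>
locale step_law =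
  fixes p :: "real \<Rightarrow> ennreal"
  assumes mass_p: "mass p = 1"
begin

fun stay :: "real set \<Rightarrow> nat \<Rightarrow> real \<Rightarrow> ennreal" where
  "stay A 0 = point_mass"
| "stay A (Suc n) = (\<lambda>x. indicator A x * conv p (stay A n) x)"

fun exits :: "real set \<Rightarrow> nat \<Rightarrow> real \<Rightarrow> ennreal" where
  "exits A 0 = (\<lambda>_. 0)"
| "exits A (Suc n) = (\<lambda>x. indicator (-A) x * conv p (stay A n) x)"

abbreviation free :: "nat \<Rightarrow> real \<Rightarrow> ennreal" where
  "free \<equiv> stay UNIV"

definition hits :: "real set \<Rightarrow> nat \<Rightarrow> real \<Rightarrow> ennreal" where
  "hits A n x = (if n = 0 then 0 else indicator A x * free n x)"

lemma stay_plus_exits: "stay A n x + exits A n x = unit_seq n x + gconv (one_step p) (stay A) n x"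
proof (cases n)
  case (Suc m)
  then show ?thesis by (cases "x \<in> A") (simp_all add: unit_seq_def)
qed (simp add: unit_seq_def)

lemma free_step: "free n x = unit_seq n x + gconv (one_step p) free n x"
  by (cases n) (simp_all add: unit_seq_def)

lemma mass_free: "mass (free n) = 1"
  by (induction n) (simp_all add: mass_conv mass_p)

lemma stay_le_free: "stay A n x \<le> free n x"
proof (induction n arbitrary: x)
  case (Suc n)
  have "stay A (Suc n) x \<le> conv p (stay A n) x"
    by (cases "x \<in> A") auto
  also have "\<dots> \<le> free (Suc n) x"
    by (simp add: conv_mono Suc)
  finally show ?case .
qed simp

lemma free_le_1: "free n x \<le> 1"
  using le_mass[of "free n" x] by (simp add: mass_free)

lemma mass_stay_le_1: "mass (stay A n) \<le> 1"
  using mass_mono[of "stay A n" "free n"] by (simp add: mass_free stay_le_free)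

lemma stay_finite: "stay A n x \<noteq> \<infinity>"
proof -
  have "stay A n x \<le> 1" using stay_le_free[of A n x] free_le_1[of n x] by (rule order.trans)
  then show ?thesis by (auto simp: top_unique)
qed

text \<open>
The one-step map raises time by one, so a sequence that solves a one-step recursion is determined by
its source term. This replaces the inversion of 1 - s p for generating functions.
\<close>
lemma eq_if_same_step:
  assumes "\<And>n x. U n x = r n x + gconv (one_step p) U n x"
    and "\<And>n x. V n x = r n x + gconv (one_step p) V n x"
  shows "U n x = V n x"
proof (induction n arbitrary: x)
  case 0
  show ?case using assms[of 0 x] by simp
next
  case (Suc n)
  then have "U n = V n" by blast
  then show ?case using assms[of "Suc n" x] by simp
qed

text \<open>
A free path either stays in A, or it restarts at its first exit; both sides solve the one-step
recursion of the free walk.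
\<close>
lemma free_eq_stay_plus_exits:
  "free n x = stay A n x + gconv free (exits A) n x"
proof (rule eq_if_same_step[symmetric, where r = unit_seq])
  let ?P = "one_step p"
  fix n x
  have *: "gconv free (exits A) n x = exits A n x + gconv ?P (gconv free (exits A)) n x" for n x
  proof -
    have "gconv free (exits A) n x = gconv (\<lambda>n x. unit_seq n x + gconv ?P free n x) (exits A) n x"
      by (rule arg_cong[of free _ "\<lambda>F. gconv F _ _ _"]) (intro ext free_step)
    then show ?thesis by (simp add: gconv_add_left gconv_assoc)
  qed
  show "stay A n x + gconv free (exits A) n x
      = unit_seq n x + gconv ?P (\<lambda>n x. stay A n x + gconv free (exits A) n x) n x"
    unfolding gconv_add_right using stay_plus_exits[of A n x] *[of n x] by (simp add: ac_simps)
next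
  show "free n x = unit_seq n x + gconv (one_step p) free n x" for n x
    by (rule free_step)
qed

lemma hits_cover: "free n x = unit_seq n x + hits A n x + hits (-A) n x"
  by (cases "x \<in> A") (auto simp: unit_seq_def hits_def)

lemma hits_finite: "hits A n x \<noteq> \<infinity>"
  using stay_finite[of UNIV n x] by (auto simp: hits_def indicator_def)

lemma gconv_hits_stay_outside:
  assumes "splits_additively A" "x \<notin> A"
  shows "gconv (hits A) (stay A) n x = 0"
  unfolding gconv_def
proof (intro sum.neutral ballI conv_eq_0)
  fix i y assume "i \<in> {..n}"
  show "hits A i y = 0 \<or> stay A (n - i) (x - y) = 0"
  proof (cases "i = 0 \<or> y \<notin> A")
    case False
    with assms have "x - y \<notin> A" "x - y \<noteq> 0"
      by (auto simp: splits_additively_def) (metis add_diff_cancel_left' diff_add_cancel)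
    then show ?thesis by (cases "n - i") (auto simp: point_mass_def)
  qed (auto simp: hits_def)
qed

lemma gconv_hits_exits_inside:
  assumes "splits_additively A" "x \<in> A"
  shows "gconv (hits (-A)) (exits A) n x = 0"
  unfolding gconv_def
proof (intro sum.neutral ballI conv_eq_0)
  fix i y assume "i \<in> {..n}"
  show "hits (-A) i y = 0 \<or> exits A (n - i) (x - y) = 0"
  proof (cases "i = 0 \<or> y \<in> A")
    case False
    with assms have "x - y \<in> A"
      by (auto simp: splits_additively_def) (metis ComplI Compl_iff add.commute diff_add_cancel)
    then show ?thesis by (cases "n - i") auto
  qed (auto simp: hits_def)
qed

text \<open>
Spitzer's identity after logarithmic differentiation. In the induction on n, the derivation rule and
the hypothesis for n - 1 turn n (p * stay) into p * stay + \<open>hits A\<close> * (p * stay) at time n. Adding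
\<open>hits A\<close> and replacing unit + p * stay by stay + exits leaves \<open>hits A * stay\<close> as the main term, and
the first-exit decomposition of the free walk shows that, up to terms on the complement of A, the
other terms on both sides are \<open>hits A\<close>. As A and its complement are closed under addition, those
terms vanish on A, where n (p * stay) is n times stay.
\<close>
theorem spitzer:
  assumes A: "splits_additively A"
  shows "by_time (stay A) n x = gconv (hits A) (stay A) n x"
proof (induction n arbitrary: x rule: less_induct)
  case (less n)
  let ?P = "one_step p" and ?b = "stay A" and ?f = "exits A" and ?a = "hits A" and ?a' = "hits (-A)"
  show ?case
  proof (cases "n = 0 \<or> x \<notin> A")
    case True
    then show ?thesis
    proof
      assume "x \<notin> A"
      then have "by_time ?b n x = 0"
        by (cases n) (auto simp: by_time_def)
      with gconv_hits_stay_outside[OF A \<open>x \<notin> A\<close>] show ?thesis by simp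
    qed (simp add: by_time_def gconv_def hits_def[abs_def])
  next
    case False
    then obtain m where n: "n = Suc m" and x: "x \<in> A" by (cases n) auto
    have unit: "unit_seq n x = (0::ennreal)" by (simp add: n unit_seq_def)
    have NP: "by_time ?P = ?P" by (auto simp: by_time_def one_step_def fun_eq_iff)
    have IH: "by_time ?b m = gconv ?a ?b m"
      using less[of m] n by blast
    have "by_time (gconv ?P ?b) n x = gconv ?P ?b n x + conv p (by_time ?b m) x"
      by (simp add: by_time_gconv NP n)
    also have "conv p (by_time ?b m) x = gconv ?P (gconv ?a ?b) n x"
      by (simp add: IH n)
    also have "gconv ?P (gconv ?a ?b) = gconv ?a (gconv ?P ?b)"
      by (rule gconv_left_commute)
    finally have "by_time (gconv ?P ?b) n x + ?a n x
        = gconv ?P ?b n x + gconv ?a (\<lambda>n x. unit_seq n x + gconv ?P ?b n x) n x"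
      by (simp add: gconv_add_right ac_simps)
    also have "(\<lambda>n x. unit_seq n x + gconv ?P ?b n x) = (\<lambda>n x. ?b n x + ?f n x)"
      by (intro ext stay_plus_exits[symmetric])
    finally have 1: "by_time (gconv ?P ?b) n x + ?a n x
        = gconv ?P ?b n x + gconv ?a ?f n x + gconv ?a ?b n x"
      by (simp add: gconv_add_right ac_simps)
    have "free = (\<lambda>n x. (unit_seq n x + ?a n x) + ?a' n x)"
      by (intro ext) (simp add: hits_cover[of _ _ A] ac_simps)
    then have "gconv free ?f n x = ?f n x + gconv ?a ?f n x + gconv ?a' ?f n x"
      by (simp add: gconv_add_left)
    moreover have "?a n x = free n x"
      using x n by (simp add: hits_def)
    ultimately have 2: "gconv ?P ?b n x + gconv ?a ?f n x = ?a n x"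
      using free_eq_stay_plus_exits[of n x A] stay_plus_exits[of A n x]
        gconv_hits_exits_inside[OF A x, of n] unit by (simp add: ac_simps)
    have "?b n x = gconv ?P ?b n x"
      using x n by simp
    then have "by_time ?b n x = by_time (gconv ?P ?b) n x" by (simp add: by_time_def)
    also have "\<dots> = gconv ?a ?b n x"
      using 1 unfolding 2 using hits_finite[of A n x]
      by (simp add: add.commute[of _ "hits A n x"])
    finally show ?thesis .
  qed
qed

text \<open>
The recursion n U(n) = sum over i of a(i) * U(n - i) determines U from U(0) because a(0) = 0.
\<close>
lemma eq_if_same_log_derivative:
  assumes "\<And>n x. by_time U n x = gconv a U n x" "\<And>n x. by_time V n x = gconv a V n x"
    and "a 0 = (\<lambda>_. 0)" and "U 0 = V 0"
  shows "U n x = (V n x :: ennreal)"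
proof (induction n arbitrary: x rule: less_induct)
  case (less n)
  show ?case
  proof (cases n)
    case 0
    then show ?thesis using assms(4) by simp
  next
    case (Suc m)
    have "gconv a U n x = gconv a V n x"
      unfolding gconv_def
    proof (intro sum.cong refl)
      fix i assume "i \<in> {..n}"
      show "conv (a i) (U (n - i)) x = conv (a i) (V (n - i)) x"
      proof (cases "i = 0")
        case False
        then have "U (n - i) = V (n - i)" using less[of "n - i"] Suc by auto
        then show ?thesis by simp
      qed (simp add: assms(3))
    qed
    then have "of_nat n * U n x = of_nat n * V n x"
      using assms(1,2)[of n x] by (simp add: by_time_def)
    then show ?thesis using Suc by (subst (asm) ennreal_mult_cancel_left) auto
  qed
qed

text \<open>
For A = \<open>{0<..}\<close> this is the decomposition of a path at the last time of its minimum. By Spitzer's identity the logarithmic derivatives of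
the two factors are \<open>hits A\<close> and \<open>hits (-A)\<close>, and their sum is the logarithmic derivative of the
free walk.
\<close>
theorem stay_stay_compl:
  assumes A: "splits_additively A"
  shows "gconv (stay (-A)) (stay A) = free"
proof (intro ext, rule eq_if_same_log_derivative[where a = "\<lambda>n x. hits A n x + hits (-A) n x"])
  let ?w = "stay (-A)" and ?b = "stay A"
  have S: "by_time ?b = gconv (hits A) ?b" "by_time ?w = gconv (hits (-A)) ?w"
    using spitzer[OF A] spitzer[OF splits_additively_compl[OF A]] by (auto simp: fun_eq_iff)
  fix n x
  have "gconv ?w (gconv (hits A) ?b) = gconv (hits A) (gconv ?w ?b)"
    by (rule gconv_left_commute)
  then show "by_time (gconv ?w ?b) n x = gconv (\<lambda>n x. hits A n x + hits (-A) n x) (gconv ?w ?b) n x"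
    by (simp add: by_time_gconv S gconv_add_left gconv_assoc add.commute)
next
  fix n x
  have "hits UNIV = (\<lambda>n x. hits A n x + hits (-A) n x)"
    by (auto simp: hits_def fun_eq_iff indicator_def)
  then show "by_time free n x = gconv (\<lambda>n x. hits A n x + hits (-A) n x) free n x"
    using spitzer[of UNIV n x] by (simp add: splits_additively_def)
qed (auto simp: hits_def gconv_def)

text \<open>
Duality: the walk killed outside A is the renewal measure of the ladder steps, which are the
exits from the complement. One more step of the factor on the complement in \<open>stay_stay_compl\<close>
either continues it or exits, and the free walk cancels.
\<close>
theorem stay_renewal:
  assumes A: "splits_additively A"
  shows "stay A n x = unit_seq n x + gconv (exits (-A)) (stay A) n x"
proof -
  let ?w = "stay (-A)" and ?b = "stay A" and ?q = "exits (-A)" and ?P = "one_step p"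
  have K: "gconv ?w ?b = free" by (rule stay_stay_compl[OF A])
  have "free n x + gconv ?q ?b n x = gconv (\<lambda>n x. ?w n x + ?q n x) ?b n x"
    by (simp add: gconv_add_left K)
  also have "(\<lambda>n x. ?w n x + ?q n x) = (\<lambda>n x. unit_seq n x + gconv ?P ?w n x)"
    by (intro ext stay_plus_exits)
  also have "gconv \<dots> ?b n x = ?b n x + gconv ?P free n x"
    by (simp add: gconv_add_left gconv_assoc K)
  finally have "gconv ?P free n x + (unit_seq n x + gconv ?q ?b n x) = gconv ?P free n x + ?b n x"
    by (subst (asm) free_step) (simp add: ac_simps)
  moreover have "gconv ?P free n x \<noteq> \<infinity>"
    using free_step[of n x] stay_finite[of UNIV n x] by (metis ennreal_add_eq_top infinity_ennreal_def)
  ultimately show ?thesis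
    by simp
qed

end

section \<open>The a priori bound for positive walks\<close>

lemma splits_additively_pos: "splits_additively {0<..}"
  by (auto simp: splits_additively_def)

context step_law
begin

abbreviation "pos_walk \<equiv> stay {0<..}"
abbreviation "neg_walk \<equiv> stay {..0}"

lemma gconv_neg_pos: "gconv neg_walk pos_walk = free"
  using stay_stay_compl[OF splits_additively_pos] by simp

text \<open>
Total masses in the factorisation. With w(j) = P(tau^+ > j) this is the identity that
bounds P(tau^- > m) (w(0) + ... + w(m)) by 1.
\<close>
lemma mass_neg_pos: "(\<Sum>j\<le>n. mass (neg_walk j) * mass (pos_walk (n - j))) = 1"
proof -
  have "(\<Sum>j\<le>n. mass (neg_walk j) * mass (pos_walk (n - j))) = mass (gconv neg_walk pos_walk n)"
    unfolding gconv_def by (simp add: mass_sum mass_conv)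
  then show ?thesis by (simp add: gconv_neg_pos mass_free)
qed

lemma mass_stay_Suc_le: "mass (stay A (Suc n)) \<le> mass (stay A n)"
proof -
  have "mass (stay A (Suc n)) \<le> mass (conv p (stay A n))"
    by (rule mass_mono) (auto simp: indicator_def)
  then show ?thesis by (simp add: mass_conv mass_p)
qed

lemma mass_stay_antimono: "m \<le> n \<Longrightarrow> mass (stay A n) \<le> mass (stay A m)"
  by (rule lift_Suc_antimono_le[of "\<lambda>n. mass (stay A n)"]) (rule mass_stay_Suc_le)

text \<open>
The renewal equation of the complementary factor, in total masses.
\<close>
lemma mass_neg_walk_Suc:
  "mass (neg_walk (Suc l)) = (\<Sum>i\<le>l. mass (exits {0<..} (Suc i)) * mass (neg_walk (l - i)))"
proof -
  have "neg_walk (Suc l) = gconv (exits {0<..}) neg_walk (Suc l)"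
    using stay_renewal[OF splits_additively_compl[OF splits_additively_pos], of "Suc l"]
    by (auto simp: unit_seq_def fun_eq_iff simp del: stay.simps)
  then have "mass (neg_walk (Suc l)) = (\<Sum>i\<le>Suc l. mass (exits {0<..} i) * mass (neg_walk (Suc l - i)))"
    by (simp add: gconv_def[abs_def] mass_sum mass_conv del: stay.simps sum.atMost_Suc)
  also have "\<dots> = (\<Sum>i\<le>l. mass (exits {0<..} (Suc i)) * mass (neg_walk (l - i)))"
    by (subst sum.atMost_Suc_shift) (simp add: mass_def)
  finally show ?thesis .
qed

text \<open>
The masses \<open>conv \<mu> (indicator {0<..}) x\<close> and \<open>\<mu> {..<x}\<close> agree; the first form lets the
associativity of the convolution act on it. The sum over all times, \<open>pos_potential\<close>, is the renewal
function.
\<close>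
definition pos_walk_below :: "nat \<Rightarrow> real \<Rightarrow> ennreal" where
  "pos_walk_below n x = conv (pos_walk n) (indicator {0<..}) x"

definition pos_potential :: "real \<Rightarrow> ennreal" where
  "pos_potential x = (\<Sum>n. pos_walk_below n x)"

lemma pos_walk_support: "y < 0 \<Longrightarrow> pos_walk n y = 0"
  by (cases n) (auto simp: point_mass_def)

lemma pos_walk_below_nonpos:
  assumes "x \<le> 0" shows "pos_walk_below n x = 0"
  unfolding pos_walk_below_def
proof (rule conv_eq_0)
  fix y show "pos_walk n y = 0 \<or> indicator {0<..} (x - y) = (0::ennreal)"
    using assms pos_walk_support[of y n] by (cases "y < 0") auto
qed

text \<open>
The mass of the paths of length l, started at an arbitrary positive point with unit weight, that
stay positive and end at x. Read backwards, it is the probability that the free walk is below x at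
the times 0, ..., l.
\<close>
fun reach :: "nat \<Rightarrow> real \<Rightarrow> ennreal" where
  "reach 0 = indicator {0<..}"
| "reach (Suc l) = (\<lambda>x. indicator {0<..} x * conv p (reach l) x)"

text \<open>
A positive path that ends at x is cut at the last time of its minimum. Relative to the minimum, the
rest of the path is a positive walk that ends below x. The part before the minimum, read backwards
and summed over all starting points, is a walk that stays nonpositive. In the induction, the mass that leaves
\<open>{0<..}\<close> in one step is exactly replaced by the new term with minimum at the end, by
\<open>mass_neg_walk_Suc\<close>.
\<close>
lemma reach_eq: "reach l x = (\<Sum>i\<le>l. pos_walk_below i x * mass (neg_walk (l - i)))"
proof (induction l arbitrary: x)
  case 0
  show ?case by (simp add: pos_walk_below_def)
next
  case (Suc l)
  show ?case
  proof (cases "0 < x")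
    case True
    have exits: "conv (exits {0<..} i) (indicator {0<..}) x = mass (exits {0<..} i)" for i
      unfolding conv_def mass_def using True
      by (cases i) (auto intro!: nn_integral_cong simp: indicator_def)
    have step: "conv p (\<lambda>x. pos_walk_below i x) x = pos_walk_below (Suc i) x + mass (exits {0<..} (Suc i))" for i
    proof -
      have "conv p (\<lambda>x. pos_walk_below i x) x = conv (conv p (pos_walk i)) (indicator {0<..}) x"
        unfolding pos_walk_below_def by (simp add: conv_assoc)
      also have "conv p (pos_walk i) = (\<lambda>x. pos_walk (Suc i) x + exits {0<..} (Suc i) x)"
        using stay_plus_exits[of "{0<..}" "Suc i"]
        by (auto simp: unit_seq_def simp del: stay.simps exits.simps)
      also have "conv \<dots> (indicator {0<..}) x = pos_walk_below (Suc i) x + mass (exits {0<..} (Suc i))"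
        unfolding conv_add_left by (simp add: exits pos_walk_below_def del: stay.simps exits.simps)
      finally show ?thesis .
    qed
    have "reach (Suc l) x = conv p (\<lambda>x. \<Sum>i\<le>l. pos_walk_below i x * mass (neg_walk (l - i))) x"
      using True by (simp add: Suc[abs_def])
    also have "\<dots> = (\<Sum>i\<le>l. (pos_walk_below (Suc i) x + mass (exits {0<..} (Suc i))) * mass (neg_walk (l - i)))"
      by (simp only: conv_sum_right finite_atMost conv_mult_right step)
    also have "\<dots> = (\<Sum>i\<le>l. pos_walk_below (Suc i) x * mass (neg_walk (l - i))) + mass (neg_walk (Suc l))"
      by (simp add: distrib_right sum.distrib mass_neg_walk_Suc del: stay.simps exits.simps)
    also have "mass (neg_walk (Suc l)) = pos_walk_below 0 x * mass (neg_walk (Suc l - 0))"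
      using True by (simp add: pos_walk_below_def del: stay.simps(2))
    finally show ?thesis
      by (subst sum.atMost_Suc_shift) (simp add: add.commute del: stay.simps)
  next
    case False
    then show ?thesis by (simp add: pos_walk_below_nonpos)
  qed
qed

lemma sum_reach_le: "(\<Sum>l\<le>m. reach l x) \<le> pos_potential x * (\<Sum>j\<le>m. mass (neg_walk j))"
proof -
  have "(\<Sum>l\<le>m. reach l x) = (\<Sum>l\<le>m. \<Sum>i\<le>l. pos_walk_below i x * mass (neg_walk (l - i)))"
    by (simp only: reach_eq)
  also have "\<dots> = (\<Sum>i\<le>m. \<Sum>l\<in>{i..m}. pos_walk_below i x * mass (neg_walk (l - i)))"
    by (simp add: sum.Sigma)
       (rule sum.reindex_bij_witness[of _ "\<lambda>(a, b). (b, a)" "\<lambda>(a, b). (b, a)"], auto)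
  also have "\<dots> \<le> (\<Sum>i\<le>m. pos_walk_below i x * (\<Sum>j\<le>m. mass (neg_walk j)))"
  proof (intro sum_mono)
    fix i assume "i \<in> {..m}"
    have "(\<Sum>l\<in>{i..m}. mass (neg_walk (l - i))) = (\<Sum>j\<le>m - i. mass (neg_walk j))"
      using \<open>i \<in> {..m}\<close> by (intro sum.reindex_bij_witness[of _ "\<lambda>j. j + i" "\<lambda>l. l - i"]) auto
    also have "\<dots> \<le> (\<Sum>j\<le>m. mass (neg_walk j))"
      by (intro sum_mono2) auto
    finally show "(\<Sum>l\<in>{i..m}. pos_walk_below i x * mass (neg_walk (l - i)))
        \<le> pos_walk_below i x * (\<Sum>j\<le>m. mass (neg_walk j))"
      by (simp add: sum_distrib_left[symmetric] mult_left_mono)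
  qed
  also have "\<dots> = (\<Sum>i\<le>m. pos_walk_below i x) * (\<Sum>j\<le>m. mass (neg_walk j))"
    by (simp add: sum_distrib_right)
  also have "\<dots> \<le> pos_potential x * (\<Sum>j\<le>m. mass (neg_walk j))"
    unfolding pos_potential_def by (intro mult_right_mono sum_le_suminf) auto
  finally show ?thesis .
qed

lemma reach_Suc_le: "reach (Suc l) x \<le> reach l x"
proof (induction l arbitrary: x)
  case 0
  have "conv p (indicator {0<..}) x \<le> 1"
    using conv_le_mass[of "indicator {0<..}" 1 p x] by (simp add: mass_p indicator_def)
  then show ?case by (auto simp: indicator_def)
next
  case (Suc l)
  then have "conv p (reach (Suc l)) x \<le> conv p (reach l) x"
    by (intro conv_mono) auto
  then show ?case unfolding reach.simps(2)[of "Suc l"] reach.simps(2)[of l]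
    by (intro mult_left_mono) auto
qed

lemma reach_antimono: "m \<le> n \<Longrightarrow> reach n x \<le> reach m x"
  by (rule lift_Suc_antimono_le[of "\<lambda>n. reach n x"]) (rule reach_Suc_le)

lemma pos_walk_add_le: "pos_walk (m + k) x \<le> conv (pos_walk m) (free k) x"
proof (induction k arbitrary: x)
  case (Suc k)
  have "pos_walk (m + Suc k) x \<le> conv p (pos_walk (m + k)) x"
    by (auto simp: indicator_def)
  also have "\<dots> \<le> conv p (conv (pos_walk m) (free k)) x"
    by (intro conv_mono Suc) auto
  also have "\<dots> = conv (pos_walk m) (free (Suc k)) x"
    by (simp add: conv_assoc[symmetric] conv_commute[of p "pos_walk m"])
  finally show ?case .
qed simp

text \<open>
If the law at time m has point masses at most s, then in the remaining l steps it is dominated by s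
times the paths that start anywhere.
\<close>
lemma pos_walk_le_reach:
  assumes "0 < m" "\<And>z. pos_walk m z \<le> s"
  shows "pos_walk (m + l) x \<le> s * reach l x"
proof (induction l arbitrary: x)
  case 0
  show ?case
  proof (cases "0 < x")
    case True
    then show ?thesis using assms(2)[of x] by simp
  next
    case False
    then show ?thesis using assms(1) by (cases m) auto
  qed
next
  case (Suc l)
  have "conv p (pos_walk (m + l)) x \<le> conv p (\<lambda>x. s * reach l x) x"
    by (intro conv_mono Suc) auto
  also have "\<dots> = s * conv p (reach l) x"
    by (simp add: conv_commute[of p] conv_mult_left)
  finally show ?case by (auto simp: indicator_def)
qed

text \<open>
The a priori bound. The first m steps contribute P(tau^- > m), the next m steps the bound s, and the
last l steps \<open>reach\<close>, which decreases in time and is therefore at most its average over the times up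
to m; \<open>sum_reach_le\<close> and \<open>mass_neg_pos\<close> bound the product of the average and P(tau^- > m).
\<close>
theorem pos_walk_le_potential:
  assumes m: "0 < m" "m \<le> l" and s: "\<And>z. free m z \<le> s"
  shows "of_nat (m + 1) * pos_walk (2 * m + l) x \<le> s * pos_potential x"
proof -
  define \<beta> where "\<beta> = mass (pos_walk m)"
  have le: "pos_walk (m + m) z \<le> \<beta> * s" for z
    unfolding \<beta>_def by (rule order.trans[OF pos_walk_add_le conv_le_mass[OF s]])
  have "of_nat (m + 1) * pos_walk (2 * m + l) x \<le> of_nat (m + 1) * (\<beta> * s * reach m x)"
    using pos_walk_le_reach[of "m + m" "\<beta> * s" l x] le m reach_antimono[OF m(2), of x]
    by (intro mult_left_mono order.trans[OF _ mult_left_mono[of "reach l x" "reach m x" "\<beta> * s"]])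
       (simp_all add: mult_2)
  also have "\<dots> = \<beta> * s * (\<Sum>l\<le>m. reach m x)"
    by (simp add: ac_simps)
  also have "\<dots> \<le> \<beta> * s * (\<Sum>l\<le>m. reach l x)"
    by (intro mult_left_mono sum_mono reach_antimono) auto
  also have "\<dots> \<le> \<beta> * s * (pos_potential x * (\<Sum>j\<le>m. mass (neg_walk j)))"
    by (intro mult_left_mono sum_reach_le) auto
  also have "\<dots> = s * pos_potential x * (\<Sum>j\<le>m. mass (neg_walk j) * \<beta>)"
    unfolding sum_distrib_right[symmetric] by (simp add: ac_simps)
  also have "(\<Sum>j\<le>m. mass (neg_walk j) * \<beta>) \<le> (\<Sum>j\<le>m. mass (neg_walk j) * mass (pos_walk (m - j)))"
    unfolding \<beta>_def by (intro sum_mono mult_left_mono mass_stay_antimono) auto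
  also have "\<dots> = 1" by (rule mass_neg_pos)
  finally show ?thesis by (simp add: mult_left_mono)
qed

end

section \<open>Ladder heights and duality\<close>

lemma suminf_cauchy_ennreal:
  fixes g :: "nat \<Rightarrow> nat \<Rightarrow> ennreal"
  shows "(\<Sum>n. \<Sum>i\<le>n. g i (n - i)) = (\<Sum>i. \<Sum>j. g i j)"
proof -
  have "(\<Sum>n. \<Sum>i\<le>n. g i (n - i)) = (\<Sum>n. \<Sum>i. if i \<le> n then g i (n - i) else 0)"
  proof (rule suminf_cong)
    fix n
    have "(\<Sum>i. if i \<le> n then g i (n - i) else 0) = (\<Sum>i\<le>n. if i \<le> n then g i (n - i) else 0)"
      by (rule suminf_finite) auto
    then show "(\<Sum>i\<le>n. g i (n - i)) = (\<Sum>i. if i \<le> n then g i (n - i) else 0)" by simp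
  qed
  also have "\<dots> = (\<Sum>i. \<Sum>n. if i \<le> n then g i (n - i) else 0)"
    using nn_integral_count_space_swap[of "\<lambda>n i. if i \<le> n then g i (n - i) else 0"]
    by (simp add: nn_integral_count_space_nat)
  also have "\<dots> = (\<Sum>i. \<Sum>j. g i j)"
  proof (rule suminf_cong)
    fix i
    have "(\<Sum>n. if i \<le> n then g i (n - i) else 0) = (\<Sum>n. if i \<le> n + i then g i (n + i - i) else 0)
        + (\<Sum>n<i. if i \<le> n then g i (n - i) else 0)"
      by (rule suminf_offset) simp
    then show "(\<Sum>n. if i \<le> n then g i (n - i) else 0) = (\<Sum>j. g i j)" by simp
  qed
  finally show ?thesis .
qed

lemma suminf_ennreal_le_if_atMost:
  fixes f :: "nat \<Rightarrow> ennreal"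
  assumes "\<And>K. (\<Sum>k\<le>K. f k) \<le> c"
  shows "(\<Sum>k. f k) \<le> c"
proof (rule suminf_le_const)
  fix n
  have "sum f {..<n} \<le> sum f {..n}" by (intro sum_mono2) auto
  also have "\<dots> \<le> c" by (rule assms)
  finally show "sum f {..<n} \<le> c" .
qed simp

lemma conv_suminf_left: "conv (\<lambda>x. \<Sum>i. f i x) g x = (\<Sum>i. conv (f i) g x)"
  by (simp add: conv_commute[of _ g] conv_suminf_right)

lemma suminf_gconv: "(\<Sum>n. gconv f g n x) = conv (\<lambda>x. \<Sum>i. f i x) (\<lambda>x. \<Sum>j. g j x) x"
  unfolding gconv_def
  unfolding suminf_cauchy_ennreal[of "\<lambda>i j. conv (f i) (g j) x"]
  by (simp only: conv_suminf_left) (simp only: conv_suminf_right)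

text \<open>
The exponential tilt is multiplicative under convolution. It turns the summability of the k-fold
convolution powers of a law on the positive half-line, below a given level, into a geometric series.
\<close>
definition tilt :: "(real \<Rightarrow> ennreal) \<Rightarrow> real \<Rightarrow> ennreal" where
  "tilt f y = f y * ennreal (exp (- y))"

lemma tilt_conv: "tilt (conv f g) = conv (tilt f) (tilt g)"
proof
  fix x
  have "ennreal (exp (- x)) = ennreal (exp (- y)) * ennreal (exp (- (x - y)))" for y
    by (simp add: ennreal_mult[symmetric] exp_add[symmetric])
  then have "f y * g (x - y) * ennreal (exp (- x))
      = f y * ennreal (exp (- y)) * (g (x - y) * ennreal (exp (- (x - y))))" for y
    by (metis (no_types, opaque_lifting) mult.assoc mult.left_commute)
  then show "tilt (conv f g) x = conv (tilt f) (tilt g) x"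
    unfolding tilt_def conv_def by (simp add: nn_integral_multc[symmetric])
qed

lemma tilt_point_mass: "tilt point_mass = point_mass"
  by (auto simp: tilt_def point_mass_def indicator_def fun_eq_iff)

context step_law
begin

lemma free_pos_finite:
  assumes supp: "\<And>y. y \<le> 0 \<Longrightarrow> p y = 0"
  shows "(\<Sum>k. conv (free k) (indicator {0<..}) u) < \<infinity>"
proof -
  define \<theta> where "\<theta> = mass (tilt p)"
  have le: "tilt p y \<le> p y" for y
  proof (cases "y \<le> 0")
    case False
    then have "p y * ennreal (exp (- y)) \<le> p y * 1"
      by (intro mult_left_mono) auto
    then show ?thesis by (simp add: tilt_def)
  qed (simp add: supp tilt_def)
  have "\<theta> \<le> 1"
    unfolding \<theta>_def using mass_mono[of "tilt p" p] le by (simp add: mass_p)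
  moreover have "\<theta> \<noteq> 1"
  proof
    assume 1: "\<theta> = 1"
    have split: "p y = tilt p y + p y * ennreal (1 - exp (- y))" for y
    proof (cases "y \<le> 0")
      case False
      have "p y = p y * (ennreal (exp (- y)) + ennreal (1 - exp (- y)))"
        using False by (subst ennreal_plus[symmetric]) auto
      then show ?thesis by (simp add: tilt_def distrib_left)
    qed (simp add: supp tilt_def)
    have "mass p = \<theta> + mass (\<lambda>y. p y * ennreal (1 - exp (- y)))"
      unfolding \<theta>_def mass_add[symmetric] by (rule arg_cong[of _ _ mass]) (intro ext split)
    then have "mass (\<lambda>y. p y * ennreal (1 - exp (- y))) = 0"
      using 1 mass_p ennreal_add_left_cancel[of 1 "mass (\<lambda>y. p y * ennreal (1 - exp (- y)))" 0] by simp
    then have "p y * ennreal (1 - exp (- y)) = 0" for y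
      using le_mass[of "\<lambda>y. p y * ennreal (1 - exp (- y))" y] by simp
    then have "p y = 0" for y
      using supp[of y] by (cases "y \<le> 0") (auto simp: ennreal_eq_0_iff)
    then have "mass p = 0" by (simp add: mass_def)
    then show False by (simp add: mass_p)
  qed
  ultimately have \<theta>: "\<theta> < 1" by simp
  have mt: "mass (tilt (free k)) = \<theta> ^ k" for k
    by (induction k) (simp_all add: tilt_point_mass tilt_conv mass_conv \<theta>_def)
  have "conv (free k) (indicator {0<..}) u \<le> ennreal (exp u) * \<theta> ^ k" for k
  proof -
    have "conv (free k) (indicator {0<..}) u \<le> (\<integral>\<^sup>+y. tilt (free k) y * ennreal (exp u) \<partial>count_space UNIV)"
      unfolding conv_def
    proof (intro nn_integral_mono)
      fix y
      show "free k y * indicator {0<..} (u - y) \<le> tilt (free k) y * ennreal (exp u)"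
      proof (cases "y < u")
        case True
        have "free k y * 1 \<le> free k y * (ennreal (exp (- y)) * ennreal (exp u))"
          using True by (intro mult_left_mono) (auto simp: ennreal_mult[symmetric] exp_add[symmetric])
        then show ?thesis using True by (simp add: tilt_def mult.assoc)
      qed simp
    qed
    also have "\<dots> = ennreal (exp u) * \<theta> ^ k"
      using mt[of k] by (simp add: nn_integral_multc nn_integral_cmult mass_def mult.commute)
    finally show ?thesis .
  qed
  then have "(\<Sum>k. conv (free k) (indicator {0<..}) u) \<le> (\<Sum>k. ennreal (exp u) * \<theta> ^ k)"
    by (intro suminf_le) auto
  also have "\<dots> = ennreal (exp u) * (\<Sum>k. \<theta> ^ k)" by simp
  also have "\<dots> < \<infinity>"
  proof -
    obtain t where t: "\<theta> = ennreal t" "0 \<le> t" using \<theta> by (cases \<theta>) auto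
    with \<theta> have "t < 1" by (simp add: ennreal_less_one_iff)
    then have "(\<Sum>k. \<theta> ^ k) = ennreal (\<Sum>k. t ^ k)"
      using t by (simp add: ennreal_power suminf_ennreal2 summable_geometric)
    then show ?thesis by (simp add: ennreal_mult_less_top)
  qed
  finally show ?thesis .
qed

definition ladder_law :: "real \<Rightarrow> ennreal" where
  "ladder_law y = (\<Sum>n. exits {..0} n y)"

lemma ladder_law_nonpos: "y \<le> 0 \<Longrightarrow> ladder_law y = 0"
proof -
  assume "y \<le> 0"
  then have "exits {..0} n y = 0" for n by (cases n) auto
  then show ?thesis by (simp add: ladder_law_def)
qed

lemma sum_mass_exits: "(\<Sum>i\<le>n. mass (exits A i)) + mass (stay A n) = 1"
proof (induction n)
  case 0
  show ?case by (simp add: mass_def[of "\<lambda>_. 0"])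
next
  case (Suc n)
  have "mass (stay A (Suc n)) + mass (exits A (Suc n)) = mass (stay A n)"
    using stay_plus_exits[of A "Suc n"]
    by (simp add: mass_add[symmetric] unit_seq_def mass_conv mass_p del: stay.simps exits.simps)
  then have "(\<Sum>i\<le>n. mass (exits A i)) + (mass (stay A (Suc n)) + mass (exits A (Suc n))) = 1"
    using Suc by simp
  then show ?case by (simp add: ac_simps del: stay.simps exits.simps)
qed

text \<open>
The mass that the first strict ascending ladder height lacks is the limit of P(tau^+ > n).
\<close>
lemma mass_ladder_law:
  assumes "\<And>q. 0 < q \<Longrightarrow> \<exists>n. mass (neg_walk n) < q"
  shows "mass ladder_law = 1"
proof (rule antisym)
  have eq: "mass ladder_law = (\<Sum>n. mass (exits {..0} n))"
    unfolding ladder_law_def[abs_def] mass_def by (simp add: nn_integral_suminf)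
  show "mass ladder_law \<le> 1"
    unfolding eq
  proof (rule suminf_le_const)
    fix n
    have "(\<Sum>i<n. mass (exits {..0} i)) \<le> (\<Sum>i\<le>n. mass (exits {..0} i)) + mass (neg_walk n)"
      by (intro add_increasing2 sum_mono2) auto
    then show "(\<Sum>i<n. mass (exits {..0} i)) \<le> 1" by (simp only: sum_mass_exits)
  qed simp
  show "1 \<le> mass ladder_law"
  proof (rule ennreal_le_epsilon)
    fix e :: real assume "0 < e"
    then obtain n where n: "mass (neg_walk n) < ennreal e"
      using assms[of "ennreal e"] by auto
    have "1 = (\<Sum>i\<le>n. mass (exits {..0} i)) + mass (neg_walk n)" by (simp only: sum_mass_exits)
    also have "\<dots> \<le> mass ladder_law + ennreal e"
      unfolding eq using n by (intro add_mono sum_le_suminf) auto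
    finally show "1 \<le> mass ladder_law + ennreal e" .
  qed
qed

text \<open>
By Spitzer's identity n P(tau^- > n) \<ge> P(S(n) > 0), so the sum of P(tau^- > n) diverges if
P(S(n) > 0) is bounded below. By \<open>mass_neg_pos\<close>, P(tau^+ > n) cannot then stay above a positive
constant.
\<close>
lemma mass_neg_walk_small:
  assumes r: "0 < r" "\<And>n. n \<ge> k \<Longrightarrow> ennreal r \<le> mass (hits {0<..} n)" and q: "0 < q"
  shows "\<exists>n. mass (neg_walk n) < q"
proof (rule ccontr)
  assume "\<not> ?thesis"
  then have le: "q \<le> mass (neg_walk n)" for n by (simp add: not_less)
  have hits_le: "mass (hits {0<..} n) \<le> of_nat n * mass (pos_walk n)" for n
  proof -
    have "mass (hits {0<..} n) = mass (conv (hits {0<..} n) (pos_walk 0))" by simp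
    also have "\<dots> \<le> (\<Sum>i\<le>n. mass (conv (hits {0<..} i) (pos_walk (n - i))))"
      by (rule order.trans[OF _ member_le_sum[of n]]) auto
    also have "\<dots> = mass (gconv (hits {0<..}) pos_walk n)"
      unfolding gconv_def by (simp add: mass_sum)
    also have "gconv (hits {0<..}) pos_walk n = by_time pos_walk n"
      using spitzer[OF splits_additively_pos] by (auto simp: fun_eq_iff)
    also have "mass \<dots> = of_nat n * mass (pos_walk n)"
      unfolding by_time_def mass_def by (simp add: nn_integral_cmult)
    finally show ?thesis .
  qed
  define \<beta> where "\<beta> n = enn2real (mass (pos_walk n))" for n
  have \<beta>: "mass (pos_walk n) = ennreal (\<beta> n)" for n
    using mass_stay_le_1[of "{0<..}" n] unfolding \<beta>_def
    by (intro ennreal_enn2real[symmetric]) (auto simp: less_top[symmetric] top_unique)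
  have b0: "0 \<le> \<beta> n" for n by (simp add: \<beta>_def)
  have lower: "r / real n \<le> \<beta> n" if "n \<ge> k" "n > 0" for n
  proof -
    have "ennreal r \<le> ennreal (real n * \<beta> n)"
      using order.trans[OF r(2)[OF that(1)] hits_le[of n]] b0
      by (simp add: \<beta> ennreal_mult ennreal_of_nat_eq_real_of_nat)
    then have "r \<le> real n * \<beta> n" using b0[of n] by (simp add: ennreal_le_iff)
    then show ?thesis using that by (simp add: field_simps)
  qed
  obtain q' where q': "0 < q'" "ennreal q' \<le> q"
  proof (cases q)
    case (real t) with q that[of t] show ?thesis by (simp add: less_le)
  next
    case top with that[of 1] show ?thesis by simp
  qed
  have "summable \<beta>"
  proof (rule bounded_imp_summable[OF b0])
    fix n
    have "ennreal (q' * (\<Sum>j\<le>n. \<beta> j)) = (\<Sum>j\<le>n. ennreal q' * mass (pos_walk j))"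
      using q' b0 by (simp add: \<beta> ennreal_mult sum_nonneg sum_distrib_left sum_ennreal[symmetric])
    also have "\<dots> = (\<Sum>j\<le>n. ennreal q' * mass (pos_walk (n - j)))"
      by (rule sum.reindex_bij_witness[of _ "\<lambda>j. n - j" "\<lambda>j. n - j"]) auto
    also have "\<dots> \<le> (\<Sum>j\<le>n. mass (neg_walk j) * mass (pos_walk (n - j)))"
      using q' le by (intro sum_mono mult_right_mono) (auto intro: order.trans)
    also have "\<dots> = ennreal 1" by (simp add: mass_neg_pos)
    finally have "q' * (\<Sum>j\<le>n. \<beta> j) \<le> 1"
      by (subst (asm) ennreal_le_iff) auto
    then show "sum \<beta> {..n} \<le> 1 / q'" using q' by (simp add: field_simps)
  qed
  moreover have "eventually (\<lambda>n. norm (r * (1 / real n)) \<le> \<beta> n) sequentially"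
    using eventually_ge_at_top[of "max k 1"]
    by eventually_elim (use lower r in auto)
  ultimately have "summable (\<lambda>n. r * (1 / real n))"
    by (rule summable_comparison_test_ev[rotated])
  then show False
    using r(1) not_summable_harmonic[where 'a = real] by (simp only: summable_cmult_iff) (simp add: inverse_eq_divide)
qed

end

locale ladder_step_law = step_law +
  assumes mass_ladder: "mass ladder_law = 1"

sublocale ladder_step_law \<subseteq> ladder: step_law ladder_law
  by unfold_locales (rule mass_ladder)

context ladder_step_law
begin

lemma pos_walk_renewal: "pos_walk n x = unit_seq n x + gconv (exits {..0}) pos_walk n x"
  using stay_renewal[OF splits_additively_pos, of n x] by simp

text \<open>
Summing \<open>stay_renewal\<close> over time shows that the left-hand side U solves U = \<delta> + L * U with the
ladder law L. The right-hand side is the minimal solution, and the partial sums in time of U are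
bounded by it by induction on time, so the two agree.
\<close>
lemma suminf_pos_walk: "(\<Sum>n. pos_walk n x) = (\<Sum>k. ladder.free k x)"
proof (rule antisym)
  define U where "U x = (\<Sum>n. pos_walk n x)" for x
  define V where "V x = (\<Sum>k. ladder.free k x)" for x
  have unit: "(\<Sum>n. unit_seq n x) = (point_mass x :: ennreal)" for x :: real
    by (subst suminf_finite[of "{0}"]) (auto simp: unit_seq_def)
  have U: "U x = point_mass x + conv ladder_law U x" for x
  proof -
    have "U x = (\<Sum>n. unit_seq n x) + (\<Sum>n. gconv (exits {..0}) pos_walk n x)"
      unfolding U_def by (subst pos_walk_renewal) (simp add: suminf_add)
    then show ?thesis unfolding suminf_gconv unit by (simp add: U_def[abs_def] ladder_law_def[abs_def])
  qed
  have V: "V x = point_mass x + conv ladder_law V x" for x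
  proof -
    have "V x = (\<Sum>k. ladder.free (k + 1) x) + (\<Sum>k<1. ladder.free k x)"
      unfolding V_def by (rule suminf_offset) simp
    then show ?thesis unfolding V_def[abs_def] conv_suminf_right by (simp add: add.commute)
  qed
  have "(\<Sum>k\<le>K. ladder.free k x) \<le> U x" for K x
  proof (induction K arbitrary: x)
    case 0
    show ?case by (subst U) simp
  next
    case (Suc K)
    have "(\<Sum>k\<le>Suc K. ladder.free k x) = point_mass x + conv ladder_law (\<lambda>x. \<Sum>k\<le>K. ladder.free k x) x"
      by (subst sum.atMost_Suc_shift) (simp add: conv_sum_right)
    also have "\<dots> \<le> point_mass x + conv ladder_law U x"
      by (intro add_left_mono conv_mono Suc) auto
    finally show ?case by (subst U)
  qed
  then show "(\<Sum>k. ladder.free k x) \<le> (\<Sum>n. pos_walk n x)"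
    unfolding U_def[symmetric]
    by (rule suminf_ennreal_le_if_atMost)
  have "(\<Sum>n\<le>N. pos_walk n x) \<le> V x" for N x
  proof (induction N arbitrary: x)
    case 0
    show ?case by (subst V) simp
  next
    case (Suc N)
    have step: "pos_walk (Suc n) x = gconv (exits {..0}) pos_walk (Suc n) x" for n
      using pos_walk_renewal[of "Suc n" x] by (simp add: unit_seq_def del: stay.simps exits.simps)
    have "(\<Sum>n\<le>Suc N. pos_walk n x) = point_mass x + (\<Sum>n\<le>N. gconv (exits {..0}) pos_walk (Suc n) x)"
      by (simp only: sum.atMost_Suc_shift step stay.simps(1))
    also have "(\<Sum>n\<le>N. gconv (exits {..0}) pos_walk (Suc n) x)
        = (\<Sum>n\<le>N. \<Sum>i\<le>n. conv (exits {..0} (Suc i)) (pos_walk (n - i)) x)"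
      unfolding gconv_def by (subst sum.atMost_Suc_shift) simp
    also have "\<dots> = (\<Sum>i\<le>N. \<Sum>n\<in>{i..N}. conv (exits {..0} (Suc i)) (pos_walk (n - i)) x)"
      by (simp add: sum.Sigma)
       (rule sum.reindex_bij_witness[of _ "\<lambda>(a, b). (b, a)" "\<lambda>(a, b). (b, a)"], auto)
    also have "\<dots> \<le> (\<Sum>i\<le>N. conv (exits {..0} (Suc i)) V x)"
    proof (rule sum_mono)
      fix i assume "i \<in> {..N}"
      have "(\<Sum>n\<in>{i..N}. conv (exits {..0} (Suc i)) (pos_walk (n - i)) x)
          = conv (exits {..0} (Suc i)) (\<lambda>x. \<Sum>n\<in>{i..N}. pos_walk (n - i) x) x"
        by (simp add: conv_sum_right)
      also have "\<dots> \<le> conv (exits {..0} (Suc i)) V x"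
      proof (intro conv_mono)
        fix y
        have "(\<Sum>n\<in>{i..N}. pos_walk (n - i) y) = (\<Sum>n\<le>N - i. pos_walk n y)"
          using \<open>i \<in> {..N}\<close> by (intro sum.reindex_bij_witness[of _ "\<lambda>j. j + i" "\<lambda>l. l - i"]) auto
        also have "\<dots> \<le> (\<Sum>n\<le>N. pos_walk n y)" by (intro sum_mono2) auto
        finally show "(\<Sum>n\<in>{i..N}. pos_walk (n - i) y) \<le> V y" using Suc[of y] by (rule order.trans)
      qed simp
      finally show "(\<Sum>n\<in>{i..N}. conv (exits {..0} (Suc i)) (pos_walk (n - i)) x)
          \<le> conv (exits {..0} (Suc i)) V x" .
    qed
    also have "\<dots> = conv (\<lambda>x. \<Sum>i\<le>N. exits {..0} (Suc i) x) V x"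
      by (simp only: conv_sum_left finite_atMost)
    also have "\<dots> \<le> conv ladder_law V x"
    proof (intro conv_mono)
      fix y
      have "(\<Sum>i\<le>N. exits {..0} (Suc i) y) = (\<Sum>i\<in>Suc ` {..N}. exits {..0} i y)"
        by (subst sum.reindex) auto
      also have "\<dots> \<le> ladder_law y"
        unfolding ladder_law_def by (intro sum_le_suminf) auto
      finally show "(\<Sum>i\<le>N. exits {..0} (Suc i) y) \<le> ladder_law y" .
    qed simp
    finally show ?case by (subst V) (simp add: add_left_mono)
  qed
  then show "(\<Sum>n. pos_walk n x) \<le> (\<Sum>k. ladder.free k x)"
    unfolding V_def[symmetric]
    by (rule suminf_ennreal_le_if_atMost)
qed

theorem pos_potential_eq:
  "pos_potential x = (\<Sum>k. conv (ladder.free k) (indicator {0<..}) x)"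
  unfolding pos_potential_def pos_walk_below_def conv_suminf_left[symmetric]
  by (simp only: suminf_pos_walk)

lemma pos_potential_finite: "pos_potential x < \<infinity>"
  unfolding pos_potential_eq by (rule ladder.free_pos_finite) (rule ladder_law_nonpos)

end

section \<open>Random walks with discrete steps\<close>

text \<open>
A probability measure whose point masses add up to 1 is carried by the countable set of its atoms.
\<close>
lemma nn_integral_discrete_law:
  assumes "prob_space N" and sets: "sets N = sets borel"
    and mass: "mass (\<lambda>x. emeasure N {x}) = 1"
    and f: "f \<in> borel_measurable borel"
  shows "(\<integral>\<^sup>+x. f x \<partial>N) = (\<integral>\<^sup>+x. emeasure N {x} * f x \<partial>count_space (UNIV :: real set))"
proof -
  interpret N: prob_space N by fact
  define C where "C = {x. measure N {x} \<noteq> 0}"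
  have C: "countable C" unfolding C_def by (rule N.countable_support)
  have C_sets: "C \<in> sets N" by (subst sets, rule sets.countable) (auto simp: C)
  define N' where "N' = distr (density (count_space UNIV) (\<lambda>x. emeasure N {x})) borel (\<lambda>x. x)"
  have outside: "emeasure N {x} = 0" if "x \<notin> C" for x
    using that by (simp add: C_def N.emeasure_eq_measure)
  have restrict: "(\<integral>\<^sup>+x. emeasure N {x} * indicator A x \<partial>count_space UNIV) = emeasure N (A \<inter> C)" for A
  proof -
    have "emeasure N (A \<inter> C) = (\<integral>\<^sup>+x. emeasure N {x} \<partial>count_space (A \<inter> C))"
      by (rule emeasure_countable_singleton) (auto simp: sets C)
    also have "\<dots> = (\<integral>\<^sup>+x. emeasure N {x} * indicator A x \<partial>count_space UNIV)"
      by (subst nn_integral_count_space_indicator) (auto intro!: nn_integral_cong simp: indicator_def outside)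
    finally show ?thesis ..
  qed
  have "emeasure N C = 1"
    using restrict[of UNIV] mass by (simp add: mass_def)
  then have AE: "AE x in N. x \<in> C"
    using C_sets by (intro N.AE_prob_1) (simp add: N.emeasure_eq_measure)
  have "N = N'"
  proof (rule measure_eqI)
    show "sets N = sets N'" by (simp add: N'_def sets)
    fix A assume A: "A \<in> sets N"
    have "emeasure N A = emeasure N (A \<inter> C)"
      using AE A C_sets by (intro emeasure_eq_AE) auto
    also have "\<dots> = emeasure N' A"
      using A by (simp add: N'_def emeasure_distr sets emeasure_density restrict)
    finally show "emeasure N A = emeasure N' A" .
  qed
  then have "(\<integral>\<^sup>+x. f x \<partial>N) = (\<integral>\<^sup>+x. f x \<partial>N')" by simp
  also have "\<dots> = (\<integral>\<^sup>+x. emeasure N {x} * f x \<partial>count_space UNIV)"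
    using f unfolding N'_def by (simp add: nn_integral_distr nn_integral_density)
  finally show ?thesis .
qed

lemma mass_points_le_1:
  assumes "prob_space N" "sets N = sets (borel :: real measure)"
  shows "mass (\<lambda>x. emeasure N {x}) \<le> 1"
proof -
  interpret N: prob_space N by fact
  define C where "C = {x. measure N {x} \<noteq> 0}"
  have C: "countable C" unfolding C_def by (rule N.countable_support)
  have "emeasure N C = (\<integral>\<^sup>+x. emeasure N {x} \<partial>count_space C)"
    by (rule emeasure_countable_singleton) (auto simp: assms C)
  also have "\<dots> = mass (\<lambda>x. emeasure N {x})"
    unfolding mass_def
    by (subst nn_integral_count_space_indicator) (auto intro!: nn_integral_cong simp: indicator_def C_def N.emeasure_eq_measure)
  finally show ?thesis using N.emeasure_le_1[of C] by simp
qed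

text \<open>
A lower bound for the point masses that already has total mass 1 is sharp. This identifies the law of
the ladder height from a bound on the event that the ladder time is finite.
\<close>
lemma point_masses_eqI:
  assumes "prob_space N" "sets N = sets (borel :: real measure)"
    and "mass F = 1" and le: "\<And>x. F x \<le> emeasure N {x}"
  shows "emeasure N {x} = F x"
proof -
  let ?d = "\<lambda>x. emeasure N {x} - F x"
  have "emeasure N {x} = F x + ?d x" for x
    using le[of x] by (simp add: add_diff_inverse_ennreal)
  then have "mass F + mass ?d = mass (\<lambda>x. emeasure N {x})"
    by (simp add: mass_add[symmetric])
  also have "\<dots> \<le> 1" by (rule mass_points_le_1[OF assms(1,2)])
  finally have "1 + mass ?d \<le> 1 + 0" using assms(3) by simp
  then have "mass ?d = 0" by (subst (asm) ennreal_add_left_cancel_le) auto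
  then have "?d x = 0" using le_mass[of ?d x] by simp
  then show ?thesis using le[of x] by (simp add: diff_eq_0_iff_ennreal antisym)
qed

lemma walk_Suc: "walk X (Suc n) \<omega> = walk X n \<omega> + X n \<omega>"
  by (simp add: walk_def)

lemma walk_0: "walk X 0 \<omega> = 0"
  by (simp add: walk_def)

text \<open>
The bridge to random variables: the laws of the walk on the events of \<open>tau_minus\<close> and
\<open>tau_plus\<close> satisfy the recursions that define \<open>stay\<close> and \<open>exits\<close>.
\<close>
locale discrete_walk = prob_space M for M :: "'a measure" +
  fixes X :: "nat \<Rightarrow> 'a \<Rightarrow> real"
  assumes iid: "iid M X"
    and discrete: "mass (\<lambda>x. emeasure (distr M borel (X 0)) {x}) = 1"
begin

lemma indep: "indep_vars (\<lambda>_. borel) X UNIV"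
  using iid by (simp add: iid_def)

lemma X_measurable [measurable]: "X i \<in> borel_measurable M"
  using indep by (simp add: indep_vars_def)

lemma walk_measurable [measurable]: "walk X n \<in> borel_measurable M"
  unfolding walk_def[abs_def] by measurable

definition p :: "real \<Rightarrow> ennreal" where
  "p x = emeasure (distr M borel (X 0)) {x}"

sublocale step_law p
  by unfold_locales (simp add: p_def[abs_def] discrete)

text \<open>
The last step is independent of the path before it; the law of the path enters only through the
point masses of its endpoint because the last step is discrete.
\<close>
lemma prob_walk_step:
  assumes A: "A \<in> sets borel"
  shows "emeasure M {\<omega>\<in>space M. walk X (Suc n) \<omega> = x \<and> (\<forall>i\<in>{1..n}. walk X i \<omega> \<in> A)}
    = conv p (\<lambda>x. emeasure M {\<omega>\<in>space M. walk X n \<omega> = x \<and> (\<forall>i\<in>{1..n}. walk X i \<omega> \<in> A)}) x"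
proof -
  let ?S = "PiM {..<n} (\<lambda>_. borel :: real measure)"
  let ?T = "PiM {n} (\<lambda>_. borel :: real measure)"
  let ?Y = "\<lambda>\<omega>. restrict (\<lambda>i. X i \<omega>) {..<n}"
  let ?Z = "\<lambda>\<omega>. restrict (\<lambda>i. X i \<omega>) {n}"
  let ?s = "\<lambda>j (y :: nat \<Rightarrow> real). \<Sum>i<j. y i"
  define q where "q z = emeasure M {\<omega>\<in>space M. walk X n \<omega> = z \<and> (\<forall>i\<in>{1..n}. walk X i \<omega> \<in> A)}" for z
  have s: "?s j \<in> borel_measurable ?S" if "j \<le> n" for j
    using that by (intro borel_measurable_sum measurable_component_singleton) auto
  have walk: "walk X j \<omega> = ?s j (?Y \<omega>)" if "j \<le> n" for j \<omega>
    using that by (auto simp: walk_def intro!: sum.cong)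
  have Y [measurable]: "?Y \<in> measurable M ?S" and Z [measurable]: "?Z \<in> measurable M ?T"
    by (auto intro!: measurable_restrict)
  have "indep_var ?S ?Y ?T ?Z"
    using indep by (rule indep_var_restrict) auto
  then have prod: "distr M ?S ?Y \<Otimes>\<^sub>M distr M ?T ?Z = distr M (?S \<Otimes>\<^sub>M ?T) (\<lambda>\<omega>. (?Y \<omega>, ?Z \<omega>))"
    by (simp add: indep_var_distribution_eq)
  interpret Y: prob_space "distr M ?S ?Y" by (rule prob_space_distr) (rule Y)
  interpret Z: prob_space "distr M ?T ?Z" by (rule prob_space_distr) (rule Z)
  interpret P: pair_sigma_finite "distr M ?S ?Y" "distr M ?T ?Z" ..
  define E where "E = {yt \<in> space (?S \<Otimes>\<^sub>M ?T). ?s n (fst yt) + snd yt n = x \<and> (\<forall>i\<in>{1..n}. ?s i (fst yt) \<in> A)}"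
  define D where "D z = {y \<in> space ?S. ?s n y = z \<and> (\<forall>i\<in>{1..n}. ?s i y \<in> A)}" for z
  have Collect_mem: "{y\<in>space N. f y \<in> B} \<in> sets N"
    if "f \<in> measurable N borel" "B \<in> sets borel" for N :: "'c measure" and f :: "'c \<Rightarrow> real" and B
    using measurable_sets[OF that] by (simp add: vimage_def Int_def conj_commute)
  have D [measurable]: "D z \<in> sets ?S" for z
    unfolding D_def using A s Collect_mem[OF s, of n "{z}"]
    by (intro sets.sets_Collect_conj sets.sets_Collect_finite_All Collect_mem) auto
  have sf: "(\<lambda>yt. ?s j (fst yt)) \<in> borel_measurable (?S \<Otimes>\<^sub>M ?T)" if "j \<le> n" for j
    using measurable_compose[OF measurable_fst s[OF that]] .
  have sn: "(\<lambda>yt. ?s n (fst yt) + snd yt n) \<in> borel_measurable (?S \<Otimes>\<^sub>M ?T)"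
    by (intro borel_measurable_add sf measurable_compose[OF measurable_snd measurable_component_singleton]) auto
  have E [measurable]: "E \<in> sets (?S \<Otimes>\<^sub>M ?T)"
    unfolding E_def using A sf Collect_mem[OF sn, of "{x}"]
    by (intro sets.sets_Collect_conj sets.sets_Collect_finite_All Collect_mem) auto
  have q: "emeasure (distr M ?S ?Y) (D z) = q z" for z
  proof -
    have "?Y -` D z \<inter> space M = {\<omega>\<in>space M. walk X n \<omega> = z \<and> (\<forall>i\<in>{1..n}. walk X i \<omega> \<in> A)}"
      using walk by (auto simp: D_def space_PiM)
    then show ?thesis by (simp add: emeasure_distr q_def)
  qed
  have "countable {z. measure (distr M borel (walk X n)) {z} \<noteq> 0}"
    by (intro finite_measure.countable_support prob_space.finite_measure prob_space_distr) simp
  moreover have "q z = 0" if "measure (distr M borel (walk X n)) {z} = 0" for z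
  proof -
    have "emeasure M {\<omega>\<in>space M. walk X n \<omega> = z} = 0"
      using that by (simp add: measure_distr emeasure_eq_measure vimage_def Int_def conj_commute)
    moreover have "q z \<le> emeasure M {\<omega>\<in>space M. walk X n \<omega> = z}"
      unfolding q_def by (rule emeasure_mono) auto
    ultimately show ?thesis by simp
  qed
  ultimately have q_meas: "q \<in> borel_measurable borel"
    by - (rule measurable_discrete_difference[where f = "\<lambda>_. 0" and X = "{z. measure (distr M borel (walk X n)) {z} \<noteq> 0}"], auto)
  have "emeasure M {\<omega>\<in>space M. walk X (Suc n) \<omega> = x \<and> (\<forall>i\<in>{1..n}. walk X i \<omega> \<in> A)}
      = emeasure (distr M (?S \<Otimes>\<^sub>M ?T) (\<lambda>\<omega>. (?Y \<omega>, ?Z \<omega>))) E"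
  proof (subst emeasure_distr)
    show "emeasure M {\<omega>\<in>space M. walk X (Suc n) \<omega> = x \<and> (\<forall>i\<in>{1..n}. walk X i \<omega> \<in> A)}
      = emeasure M ((\<lambda>\<omega>. (?Y \<omega>, ?Z \<omega>)) -` E \<inter> space M)"
      using walk
      by (intro arg_cong[of _ _ "emeasure M"]) (auto simp: E_def space_pair_measure space_PiM walk_Suc)
  qed auto
  also have "\<dots> = (\<integral>\<^sup>+t. emeasure (distr M ?S ?Y) ((\<lambda>y. (y, t)) -` E) \<partial>distr M ?T ?Z)"
    unfolding prod[symmetric]
    by (rule P.emeasure_pair_measure_alt2) (use E in \<open>simp add: sets_pair_measure_cong[OF sets_distr sets_distr]\<close>)
  also have "\<dots> = (\<integral>\<^sup>+t. q (x - t n) \<partial>distr M ?T ?Z)"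
    unfolding q[symmetric]
    by (intro nn_integral_cong arg_cong2[where f = emeasure]) (auto simp: E_def D_def space_pair_measure)
  also have "\<dots> = (\<integral>\<^sup>+\<omega>. q (x - X n \<omega>) \<partial>M)"
  proof (subst nn_integral_distr)
    show "(\<lambda>t. q (x - t n)) \<in> borel_measurable (distr M ?T ?Z)"
      using measurable_compose[OF _ q_meas, of "\<lambda>t. x - t n" ?T] by simp
  qed auto
  also have "\<dots> = (\<integral>\<^sup>+t. q (x - t) \<partial>distr M borel (X n))"
    using measurable_compose[OF _ q_meas, of "\<lambda>t. x - t" borel] by (simp add: nn_integral_distr)
  also have "distr M borel (X n) = distr M borel (X 0)"
    using iid by (simp add: iid_def)
  also have "(\<integral>\<^sup>+t. q (x - t) \<partial>distr M borel (X 0)) = conv p q x"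
    unfolding conv_def p_def using measurable_compose[OF _ q_meas, of "\<lambda>t. x - t" borel]
    by (intro nn_integral_discrete_law) (auto intro!: prob_space_distr simp: discrete)
  finally show ?thesis unfolding q_def[abs_def] .
qed

theorem prob_walk_stay:
  assumes A: "A \<in> sets borel"
  shows "emeasure M {\<omega>\<in>space M. walk X n \<omega> = x \<and> (\<forall>i\<in>{1..n}. walk X i \<omega> \<in> A)} = stay A n x"
proof (induction n arbitrary: x)
  case 0
  have "{\<omega>\<in>space M. walk X 0 \<omega> = x} = (if x = 0 then space M else {})"
    by (auto simp: walk_0)
  then show ?case by (simp add: point_mass_def emeasure_space_1)
next
  case (Suc n)
  have "{\<omega>\<in>space M. walk X (Suc n) \<omega> = x \<and> (\<forall>i\<in>{1..Suc n}. walk X i \<omega> \<in> A)}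
      = (if x \<in> A then {\<omega>\<in>space M. walk X (Suc n) \<omega> = x \<and> (\<forall>i\<in>{1..n}. walk X i \<omega> \<in> A)} else {})"
    by (auto simp: atLeastAtMostSuc_conv)
  then show ?case
    using prob_walk_step[OF A, of n x] Suc by simp
qed

lemma prob_walk_step_stay:
  assumes A: "A \<in> sets borel"
  shows "emeasure M {\<omega>\<in>space M. walk X (Suc n) \<omega> = x \<and> (\<forall>i\<in>{1..n}. walk X i \<omega> \<in> A)} = conv p (stay A n) x"
  unfolding prob_walk_step[OF A] prob_walk_stay[OF A] ..

lemma prob_walk_eq: "emeasure M {\<omega>\<in>space M. walk X n \<omega> = x} = free n x"
  using prob_walk_stay[of UNIV n x] by simp

lemma walk_law_point: "emeasure (distr M borel (walk X n)) {x} = free n x"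
  using prob_walk_eq[of n x] by (simp add: emeasure_distr vimage_def Int_def conj_commute)

lemma nn_integral_walk:
  assumes "f \<in> borel_measurable borel"
  shows "(\<integral>\<^sup>+\<omega>. f (walk X n \<omega>) \<partial>M) = (\<integral>\<^sup>+x. free n x * f x \<partial>count_space UNIV)"
proof -
  have "(\<integral>\<^sup>+\<omega>. f (walk X n \<omega>) \<partial>M) = (\<integral>\<^sup>+x. f x \<partial>distr M borel (walk X n))"
    using assms by (simp add: nn_integral_distr)
  also have "\<dots> = (\<integral>\<^sup>+x. emeasure (distr M borel (walk X n)) {x} * f x \<partial>count_space UNIV)"
    by (rule nn_integral_discrete_law)
       (use assms in \<open>auto intro!: prob_space_distr simp: walk_law_point mass_free\<close>)
  finally show ?thesis by (simp only: walk_law_point)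
qed

lemma prob_walk_less: "emeasure M {\<omega>\<in>space M. walk X n \<omega> < u} = conv (free n) (indicator {0<..}) u"
proof -
  have "emeasure M {\<omega>\<in>space M. walk X n \<omega> < u} = (\<integral>\<^sup>+\<omega>. indicator {..<u} (walk X n \<omega>) \<partial>M)"
    by (simp flip: nn_integral_indicator) (auto intro!: nn_integral_cong simp: indicator_def)
  also have "\<dots> = conv (free n) (indicator {0<..}) u"
    unfolding conv_def by (subst nn_integral_walk) (auto intro!: nn_integral_cong simp: indicator_def)
  finally show ?thesis .
qed

lemma prob_walk_pos: "0 < n \<Longrightarrow> emeasure M {\<omega>\<in>space M. 0 < walk X n \<omega>} = mass (hits {0<..} n)"
proof -
  assume n: "0 < n"
  have "emeasure M {\<omega>\<in>space M. 0 < walk X n \<omega>} = (\<integral>\<^sup>+\<omega>. indicator {0<..} (walk X n \<omega>) \<partial>M)"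
    by (simp flip: nn_integral_indicator) (auto intro!: nn_integral_cong simp: indicator_def)
  also have "\<dots> = mass (hits {0<..} n)"
    unfolding mass_def using n
    by (subst nn_integral_walk) (auto intro!: nn_integral_cong simp: hits_def mult.commute)
  finally show ?thesis .
qed

lemma tau_minus_gt_iff: "enat n < tau_minus X \<omega> \<longleftrightarrow> (\<forall>i\<in>{1..n}. 0 < walk X i \<omega>)"
proof -
  have "enat n < tau_minus X \<omega> \<longleftrightarrow> \<not> (\<exists>i. 1 \<le> i \<and> walk X i \<omega> \<le> 0 \<and> i \<le> n)"
  proof
    assume *: "enat n < tau_minus X \<omega>"
    show "\<not> (\<exists>i. 1 \<le> i \<and> walk X i \<omega> \<le> 0 \<and> i \<le> n)"
    proof
      assume "\<exists>i. 1 \<le> i \<and> walk X i \<omega> \<le> 0 \<and> i \<le> n"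
      then obtain i where "1 \<le> i" "walk X i \<omega> \<le> 0" "i \<le> n" by blast
      then have "tau_minus X \<omega> \<le> enat i" unfolding tau_minus_def by (intro INF_lower) auto
      with * \<open>i \<le> n\<close> show False by (metis enat_ord_simps(1) leD order.trans)
    qed
  next
    assume *: "\<not> (\<exists>i. 1 \<le> i \<and> walk X i \<omega> \<le> 0 \<and> i \<le> n)"
    then have "enat (Suc n) \<le> tau_minus X \<omega>"
      unfolding tau_minus_def by (intro INF_greatest) (auto simp: not_less_eq_eq)
    then show "enat n < tau_minus X \<omega>" by (metis enat_ord_simps(2) lessI less_le_trans)
  qed
  then show ?thesis by (metis atLeastAtMost_iff not_le)
qed

theorem prob_walk_tau_minus:
  "emeasure M {\<omega>\<in>space M. walk X n \<omega> = x \<and> enat n < tau_minus X \<omega>} = pos_walk n x"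
  using prob_walk_stay[of "{0<..}" n x] by (simp add: tau_minus_gt_iff)

lemma tau_plus_eq_iff:
  "tau_plus X \<omega> = enat (Suc n) \<longleftrightarrow> 0 < walk X (Suc n) \<omega> \<and> (\<forall>i\<in>{1..n}. walk X i \<omega> \<in> {..0})"
proof
  assume eq: "tau_plus X \<omega> = enat (Suc n)"
  have "{n. 1 \<le> n \<and> walk X n \<omega> > 0} \<noteq> {}"
  proof
    assume "{n. 1 \<le> n \<and> walk X n \<omega> > 0} = {}"
    then have "tau_plus X \<omega> = Inf {}" by (simp only: tau_plus_def image_empty)
    with eq show False by (simp add: top_enat_def)
  qed
  then have "Inf (enat ` {n. 1 \<le> n \<and> walk X n \<omega> > 0}) \<in> enat ` {n. 1 \<le> n \<and> walk X n \<omega> > 0}"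
    by (metis (no_types, lifting) ex_in_conv image_eqI wellorder_InfI)
  then have "enat (Suc n) \<in> enat ` {n. 1 \<le> n \<and> walk X n \<omega> > 0}"
    using eq by (simp add: tau_plus_def)
  then have "0 < walk X (Suc n) \<omega>" by auto
  moreover have "walk X i \<omega> \<le> 0" if "i \<in> {1..n}" for i
  proof (rule ccontr)
    assume "\<not> walk X i \<omega> \<le> 0"
    then have "tau_plus X \<omega> \<le> enat i"
      unfolding tau_plus_def using that by (intro INF_lower) auto
    with eq that show False by simp
  qed
  ultimately show "0 < walk X (Suc n) \<omega> \<and> (\<forall>i\<in>{1..n}. walk X i \<omega> \<in> {..0})" by auto
next
  assume *: "0 < walk X (Suc n) \<omega> \<and> (\<forall>i\<in>{1..n}. walk X i \<omega> \<in> {..0})"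
  show "tau_plus X \<omega> = enat (Suc n)"
    unfolding tau_plus_def
  proof (intro antisym INF_greatest INF_lower)
    fix i assume i: "i \<in> {n. 1 \<le> n \<and> walk X n \<omega> > 0}"
    have "\<not> i \<le> n"
    proof
      assume "i \<le> n"
      with i * have "walk X i \<omega> \<in> {..0}" by auto
      with i show False by simp
    qed
    then show "enat (Suc n) \<le> enat i" by simp
  qed (use * in auto)
qed

lemma tau_plus_measurable [measurable]: "tau_plus X \<in> measurable M (count_space UNIV)"
proof -
  have fin: "tau_plus X -` {enat n} \<inter> space M \<in> sets M" for n
  proof (cases n)
    case 0
    have "enat 1 \<le> tau_plus X \<omega>" for \<omega>
      unfolding tau_plus_def by (intro INF_greatest) auto
    then have "tau_plus X \<omega> \<noteq> enat n" for \<omega>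
      using 0 by (metis enat_ord_simps(1) not_one_le_zero)
    then have "tau_plus X -` {enat n} \<inter> space M = {}" by auto
    then show ?thesis by simp
  next
    case (Suc m)
    have "tau_plus X -` {enat n} \<inter> space M
        = {\<omega>\<in>space M. 0 < walk X (Suc m) \<omega> \<and> (\<forall>i\<in>{1..m}. walk X i \<omega> \<le> 0)}"
      unfolding Suc using tau_plus_eq_iff[of _ m] by auto
    also have "\<dots> \<in> sets M" by measurable
    finally show ?thesis .
  qed
  have inf: "tau_plus X -` {\<infinity>} \<inter> space M = space M - (\<Union>n. tau_plus X -` {enat n} \<inter> space M)"
    by (auto simp: not_infinity_eq)
  have "tau_plus X -` {a} \<inter> space M \<in> sets M" for a
  proof (cases a)
    case (enat n) then show ?thesis using fin by simp
  next
    case infinity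
    show ?thesis unfolding infinity inf using fin by (intro sets.Diff sets.top sets.countable_UN) auto
  qed
  then show ?thesis by (simp add: measurable_count_space_eq2_countable)
qed

lemma chi_plus_measurable [measurable]: "chi_plus X \<in> borel_measurable M"
  unfolding chi_plus_def[abs_def]
  by (rule measurable_compose_countable[where f = "\<lambda>n. walk X (the_enat n)" and g = "tau_plus X"]) auto

lemma prob_tau_plus_walk:
  "emeasure M {\<omega>\<in>space M. tau_plus X \<omega> = enat (Suc n) \<and> walk X (Suc n) \<omega> = y} = exits {..0} (Suc n) y"
proof -
  have "{\<omega>\<in>space M. tau_plus X \<omega> = enat (Suc n) \<and> walk X (Suc n) \<omega> = y}
      = (if 0 < y then {\<omega>\<in>space M. walk X (Suc n) \<omega> = y \<and> (\<forall>i\<in>{1..n}. walk X i \<omega> \<in> {..0})} else {})"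
    by (auto simp: tau_plus_eq_iff)
  then show ?thesis
    using prob_walk_step_stay[of "{..0}" n y] by (simp del: atMost_iff)
qed

lemma ladder_law_le: "ladder_law y \<le> emeasure (distr M borel (chi_plus X)) {y}"
proof -
  let ?E = "\<lambda>n. {\<omega>\<in>space M. tau_plus X \<omega> = enat (Suc n) \<and> walk X (Suc n) \<omega> = y}"
  have "ladder_law y = (\<Sum>n. exits {..0} (n + 1) y) + (\<Sum>n<1. exits {..0} n y)"
    unfolding ladder_law_def by (rule suminf_offset) simp
  also have "\<dots> = (\<Sum>n. emeasure M (?E n))"
    by (simp add: prob_tau_plus_walk del: exits.simps(2))
  also have "\<dots> = emeasure M (\<Union>n. ?E n)"
    by (rule suminf_emeasure) (auto simp: disjoint_family_on_def)
  also have "\<dots> \<le> emeasure M {\<omega>\<in>space M. chi_plus X \<omega> = y}"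
    by (rule emeasure_mono) (auto simp: chi_plus_def)
  also have "\<dots> = emeasure (distr M borel (chi_plus X)) {y}"
    by (simp add: emeasure_distr vimage_def Int_def conj_commute)
  finally show ?thesis .
qed

end

lemma iid_coordinates:
  assumes "prob_space N" "sets N = sets (borel :: real measure)"
  shows "iid (PiM UNIV (\<lambda>_::nat. N)) (\<lambda>i y. y i)"
    and "distr (PiM UNIV (\<lambda>_::nat. N)) borel (\<lambda>y. y i) = N"
proof -
  interpret N: prob_space N by fact
  interpret P: product_prob_space "\<lambda>_::nat. N" UNIV by unfold_locales
  let ?P = "PiM UNIV (\<lambda>_::nat. N)"
  have comp: "distr ?P borel (\<lambda>y. y i) = N" for i
    using P.PiM_component[of i] assms(2) by (simp cong: distr_cong)
  then show "distr ?P borel (\<lambda>y. y i) = N" .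
  have PP: "prob_space ?P" by (intro prob_space_PiM N.prob_space_axioms)
  have m: "(\<lambda>y. y i) \<in> borel_measurable ?P" for i
    using measurable_component_singleton[of i UNIV "\<lambda>_. N"] assms(2) by (simp cong: measurable_cong_sets)
  have "prob_space.indep_vars ?P (\<lambda>_. borel) (\<lambda>i y. y i) UNIV"
  proof (subst prob_space.indep_vars_iff_distr_eq_PiM'[OF PP])
    have sets: "sets (PiM UNIV (\<lambda>_::nat. borel :: real measure)) = sets ?P"
      by (intro sets_PiM_cong) (simp_all add: assms)
    have "distr ?P (PiM UNIV (\<lambda>_. borel)) (\<lambda>x. \<lambda>i\<in>UNIV. x i) = distr ?P ?P (\<lambda>x. x)"
      by (intro distr_cong sets) auto
    then show "distr ?P (PiM UNIV (\<lambda>_. borel)) (\<lambda>x. \<lambda>i\<in>UNIV. x i) = PiM UNIV (\<lambda>i. distr ?P borel (\<lambda>y. y i))"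
      by (simp add: comp)
  qed (use m in auto)
  then show "iid ?P (\<lambda>i y. y i)" by (simp add: iid_def comp)
qed

context discrete_walk
begin

text \<open>
The copies of the ladder height are the steps of another discrete walk, so the probabilities in the
definition of the renewal function are again given by convolution powers, and duality applies.
\<close>
theorem renewal_eq_potential:
  assumes r: "0 < r" "\<And>n. n \<ge> k \<Longrightarrow> r \<le> prob {\<omega>\<in>space M. 0 < walk X n \<omega>}"
  shows "ennreal (renewal M X u) = pos_potential u" "pos_potential u < \<infinity>"
proof -
  have "ennreal r \<le> mass (hits {0<..} n)" if "n \<ge> max k 1" for n
    using r(2)[of n] that prob_walk_pos[of n] by (simp add: emeasure_eq_measure ennreal_leI flip: prob_walk_pos)
  then have "\<exists>n. mass (neg_walk n) < q" if "0 < q" for q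
    using mass_neg_walk_small[OF r(1) _ that, of "max k 1"] by blast
  then interpret L: ladder_step_law p
    by unfold_locales (rule mass_ladder_law)
  show "pos_potential u < \<infinity>" by (rule L.pos_potential_finite)
  let ?L = "distr M borel (chi_plus X)"
  interpret N: prob_space ?L by (rule prob_space_distr) simp
  have L_point: "emeasure ?L {y} = ladder_law y" for y
    by (rule point_masses_eqI) (use L.mass_ladder ladder_law_le N.prob_space_axioms in auto)
  have coord: "iid (chi_copies M X) (\<lambda>i y. y i)" "distr (chi_copies M X) borel (\<lambda>y. y i) = ?L" for i
    unfolding chi_copies_def by (rule iid_coordinates; simp add: N.prob_space_axioms)+
  have "prob_space (chi_copies M X)"
    unfolding chi_copies_def by (intro prob_space_PiM N.prob_space_axioms)
  then interpret C: discrete_walk "chi_copies M X" "\<lambda>i y. y i"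
    using coord L_point L.mass_ladder
    by (intro discrete_walk.intro discrete_walk_axioms.intro) (auto simp: coord)
  have p: "C.p = ladder_law"
    by (auto simp: C.p_def coord L_point fun_eq_iff)
  let ?a = "\<lambda>j. C.prob {y\<in>space (chi_copies M X). (\<Sum>i<Suc j. y i) < u}"
  have a: "ennreal (?a j) = conv (L.ladder.free (Suc j)) (indicator {0<..}) u" for j
    using C.prob_walk_less[of "Suc j" u] unfolding p by (simp add: walk_def C.emeasure_eq_measure)
  have "pos_potential u = (\<Sum>j. conv (L.ladder.free (j + 1)) (indicator {0<..}) u)
      + (\<Sum>j<1. conv (L.ladder.free j) (indicator {0<..}) u)"
    unfolding L.pos_potential_eq by (rule suminf_offset) simp
  also have "\<dots> = (\<Sum>j. ennreal (?a j)) + indicator {0<..} u"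
    by (simp only: a Suc_eq_plus1 [symmetric]) simp
  finally have eq: "pos_potential u = (\<Sum>j. ennreal (?a j)) + indicator {0<..} u" .
  then have "(\<Sum>j. ennreal (?a j)) \<noteq> top"
    using L.pos_potential_finite[of u] by auto
  then have "(\<Sum>j. ennreal (?a j)) = ennreal (\<Sum>j. ?a j)" and "summable ?a"
    by (auto intro!: suminf_ennreal summable_suminf_not_top)
  then show "ennreal (renewal M X u) = pos_potential u"
    unfolding eq renewal_def by (subst ennreal_plus) (auto simp: add.commute suminf_nonneg indicator_def)
qed

end

section \<open>Norming sequences of stable limits\<close>

text \<open>
Here \<open>lam\<close> is the modulus of the characteristic function of the steps. The limit relation is assumed
along all arguments \<open>s n\<close> with a limit, which expresses locally uniform convergence and is all that
the properties of the norming sequence depend on.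
\<close>
locale stable_norming =
  fixes lam :: "real \<Rightarrow> real" and c :: "nat \<Rightarrow> real" and \<alpha> \<kappa> b :: real
  assumes c_pos: "1 \<le> n \<Longrightarrow> 0 < c n"
    and c_mono: "1 \<le> m \<Longrightarrow> m \<le> n \<Longrightarrow> c m \<le> c n"
    and alpha: "0 < \<alpha>" and kappa: "0 < \<kappa>" and b: "0 < b"
    and lam_cont: "continuous_on UNIV lam"
    and lam_nonneg: "0 \<le> lam t" and lam_le_1: "lam t \<le> 1"
    and lam_less_1: "0 < t \<Longrightarrow> t \<le> b \<Longrightarrow> lam t < 1"
    and lam_conv: "filterlim k at_top sequentially \<Longrightarrow> s \<longlonglongrightarrow> t0 \<Longrightarrow>
      (\<lambda>n. lam (s n / c (k n)) ^ k n) \<longlonglongrightarrow> exp (- \<kappa> * \<bar>t0\<bar> powr \<alpha>)"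
begin

lemma c_at_top: "filterlim c at_top sequentially"
proof (rule ccontr)
  assume not_top: "\<not> ?thesis"
  have "\<exists>B. \<forall>n\<ge>1. c n \<le> B"
  proof (rule ccontr)
    assume *: "\<nexists>B. \<forall>n\<ge>1. c n \<le> B"
    have "eventually (\<lambda>n. Z \<le> c n) sequentially" for Z
    proof -
      obtain m where "m \<ge> 1" "c m > Z" using * by (metis not_le)
      then have "Z \<le> c n" if "n \<ge> m" for n using c_mono[of m n] that by linarith
      then show ?thesis by (rule eventually_sequentiallyI)
    qed
    then have "filterlim c at_top sequentially" by (simp add: filterlim_at_top)
    with not_top show False by simp
  qed
  then obtain B where B: "\<And>n. n \<ge> 1 \<Longrightarrow> c n \<le> B" by blast
  have B0: "0 < B" using B[of 1] c_pos[of 1] by simp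
  \<comment> \<open>a point t with \<open>t / c n\<close> in a compact subinterval of \<open>(0, b]\<close>\<close>
  define t where "t = b * c 1"
  have t: "0 < t" using b c_pos[of 1] by (simp add: t_def)
  have "compact {t / B..b}" "continuous_on {t / B..b} lam"
    using lam_cont continuous_on_subset by auto
  moreover have "t / B \<le> b"
    using B[of 1] B0 b by (simp add: t_def field_simps)
  ultimately obtain s where s: "s \<in> {t / B..b}" "\<And>u. u \<in> {t / B..b} \<Longrightarrow> lam u \<le> lam s"
    using continuous_attains_sup[of "{t / B..b}" lam] by fastforce
  have "0 < s" using s(1) t B0 by (auto intro: less_le_trans[of 0 "t / B"])
  then have ls: "lam s < 1" using s(1) lam_less_1 by auto
  have in_int: "t / c n \<in> {t / B..b}" if "n \<ge> 1" for n
    using B[OF that] c_pos[OF that] c_mono[of 1 n] that t b c_pos[of 1]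
    by (auto simp: t_def field_simps intro!: mult_right_mono)
  have "(\<lambda>n. lam s ^ n) \<longlonglongrightarrow> 0"
    using ls lam_nonneg by (intro LIMSEQ_power_zero) auto
  moreover have "eventually (\<lambda>n. lam (t / c n) ^ n \<le> lam s ^ n) sequentially"
    using eventually_ge_at_top[of 1]
    by eventually_elim (intro power_mono s in_int lam_nonneg, auto)
  ultimately have "(\<lambda>n. lam (t / c n) ^ n) \<longlonglongrightarrow> 0"
    by - (rule tendsto_sandwich[of "\<lambda>_. 0" _ _ "\<lambda>n. lam s ^ n"], auto simp: lam_nonneg)
  moreover have "(\<lambda>n. lam (t / c n) ^ n) \<longlonglongrightarrow> exp (- \<kappa> * \<bar>t\<bar> powr \<alpha>)"
    using lam_conv[of "\<lambda>n. n" "\<lambda>_. t" t] by (simp add: filterlim_ident)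
  ultimately have "exp (- \<kappa> * \<bar>t\<bar> powr \<alpha>) = 0"
    using LIMSEQ_unique by blast
  then show False by simp
qed

lemma power_as_powr: "0 < x \<Longrightarrow> 0 < k \<Longrightarrow> x ^ m = (x ^ k) powr (real m / real k)"
  by (simp add: powr_realpow[symmetric] powr_powr)

text \<open>
A convergence-of-types argument. Along a subsequence the ratio R(n) = c(m(n)) / c(n) converges in the
extended reals. If the limit \<rho> is finite, then 1 / c(n) = R(n) / c(m(n)), so the limit relation
for the index m(n) at the arguments R(n), compared with the one for n at 1, gives \<rho> powr \<alpha> = \<theta>.
If it is infinite, the relation for n at 1 / R(n) \<longlonglongrightarrow> 0 contradicts the one for m(n) at 1.
\<close>
lemma c_ratio:
  assumes m: "filterlim m at_top sequentially" and \<theta>: "0 < \<theta>"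
    and mn: "(\<lambda>n. real (m n) / real n) \<longlonglongrightarrow> \<theta>"
  shows "(\<lambda>n. c (m n) / c n) \<longlonglongrightarrow> \<theta> powr (1 / \<alpha>)"
proof (rule ccontr)
  define r where "r n = c (m n) / c n" for n
  define l where "l = \<theta> powr (1 / \<alpha>)"
  assume "\<not> (\<lambda>n. c (m n) / c n) \<longlonglongrightarrow> \<theta> powr (1 / \<alpha>)"
  then have "\<not> r \<longlonglongrightarrow> l" by (simp add: r_def[abs_def] l_def)
  then obtain e where e: "0 < e" "\<And>N. \<exists>n\<ge>N. e \<le> \<bar>r n - l\<bar>"
    unfolding LIMSEQ_def dist_real_def by (auto simp: not_less)
  then obtain \<sigma> where \<sigma>: "\<And>N. N \<le> \<sigma> N" "\<And>N. e \<le> \<bar>r (\<sigma> N) - l\<bar>" by metis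
  obtain R \<tau> where \<tau>: "strict_mono \<tau>" and R: "((\<lambda>n. ereal (r (\<sigma> n))) \<circ> \<tau>) \<longlonglongrightarrow> R"
    using compact_complete_linorder[of "\<lambda>n. ereal (r (\<sigma> n))"] by blast
  define k where "k n = \<sigma> (\<tau> n)" for n
  have \<sigma>_top: "filterlim \<sigma> at_top sequentially"
    using \<sigma>(1) by (intro filterlim_at_top_mono[OF filterlim_ident]) auto
  have k: "filterlim k at_top sequentially"
    unfolding k_def[abs_def] using filterlim_compose[OF \<sigma>_top filterlim_subseq[OF \<tau>]] .
  have mk: "filterlim (\<lambda>n. m (k n)) at_top sequentially"
    by (rule filterlim_compose[OF m k])
  have mk_k: "(\<lambda>n. real (m (k n)) / real (k n)) \<longlonglongrightarrow> \<theta>"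
    by (rule filterlim_compose[OF mn k])
  have R: "(\<lambda>n. ereal (r (k n))) \<longlonglongrightarrow> R"
    using R by (simp add: k_def comp_def)
  have ev: "eventually (\<lambda>n. 1 \<le> k n \<and> 1 \<le> m (k n)) sequentially"
    using k mk by (auto simp: filterlim_at_top eventually_conj)
  have ev_pos: "eventually (\<lambda>n. 0 < c (k n) \<and> 0 < c (m (k n)) \<and> 0 < r (k n)) sequentially"
    using ev by eventually_elim (auto simp: r_def c_pos)
  \<comment> \<open>transfer of powers: exponents k and m differ asymptotically by the factor theta\<close>
  have transfer: "(\<lambda>n. x n ^ m (k n)) \<longlonglongrightarrow> L powr \<theta>"
    if x: "(\<lambda>n. x n ^ k n) \<longlonglongrightarrow> L" "0 < L" "\<And>n. 0 \<le> x n" for x L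
  proof -
    have "(\<lambda>n. (x n ^ k n) powr (real (m (k n)) / real (k n))) \<longlonglongrightarrow> L powr \<theta>"
      using x by (intro tendsto_powr mk_k) auto
    moreover have "eventually (\<lambda>n. (x n ^ k n) powr (real (m (k n)) / real (k n)) = x n ^ m (k n)) sequentially"
      using ev order_tendstoD(1)[OF x(1,2)]
    proof eventually_elim
      case (elim n)
      then have "0 < x n" using x(3)[of n] by (cases "x n = 0") (auto simp: power_0_left)
      then show ?case using elim by (subst power_as_powr[of "x n" "k n"]) auto
    qed
    ultimately show ?thesis by (rule Lim_transform_eventually)
  qed
  have one: "(\<lambda>n. lam (1 / c (k n)) ^ k n) \<longlonglongrightarrow> exp (- \<kappa>)"
    using lam_conv[OF k tendsto_const[of 1]] by simp
  have one': "(\<lambda>n. lam (1 / c (m (k n))) ^ m (k n)) \<longlonglongrightarrow> exp (- \<kappa>)"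
    using lam_conv[OF mk tendsto_const[of 1]] by simp
  have "R \<noteq> - \<infinity>"
  proof
    assume "R = - \<infinity>"
    then have "eventually (\<lambda>n. ereal (r (k n)) < 0) sequentially"
      using order_tendstoD(2)[OF R, of 0] by simp
    with ev_pos have "eventually (\<lambda>n. False) sequentially" by eventually_elim auto
    then show False by simp
  qed
  then consider \<rho> where "R = ereal \<rho>" | "R = \<infinity>" by (cases R) auto
  then show False
  proof cases
    case 1
    then have rho: "(\<lambda>n. r (k n)) \<longlonglongrightarrow> \<rho>" using R by simp
    have "(\<lambda>n. lam (r (k n) / c (m (k n))) ^ m (k n)) \<longlonglongrightarrow> exp (- \<kappa> * \<bar>\<rho>\<bar> powr \<alpha>)"
      by (rule lam_conv[OF mk rho])
    moreover have "eventually (\<lambda>n. lam (r (k n) / c (m (k n))) ^ m (k n) = lam (1 / c (k n)) ^ m (k n)) sequentially"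
      using ev_pos by eventually_elim (simp add: r_def)
    ultimately have "(\<lambda>n. lam (1 / c (k n)) ^ m (k n)) \<longlonglongrightarrow> exp (- \<kappa> * \<bar>\<rho>\<bar> powr \<alpha>)"
      by (rule Lim_transform_eventually)
    moreover have "(\<lambda>n. lam (1 / c (k n)) ^ m (k n)) \<longlonglongrightarrow> exp (- \<kappa>) powr \<theta>"
      by (rule transfer[OF one]) (auto simp: lam_nonneg)
    ultimately have "exp (- \<kappa> * \<bar>\<rho>\<bar> powr \<alpha>) = exp (- \<kappa>) powr \<theta>"
      by (rule LIMSEQ_unique)
    then have "\<bar>\<rho>\<bar> powr \<alpha> = \<theta>" using kappa by (simp add: powr_def)
    moreover have "0 \<le> \<rho>"
      using ev_pos by (intro tendsto_lowerbound[OF rho]) (auto elim: eventually_mono)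
    ultimately have "\<rho> = l" using alpha \<theta> by (auto simp: l_def powr_powr)
    have "(\<lambda>n. \<bar>r (k n) - l\<bar>) \<longlonglongrightarrow> \<bar>\<rho> - l\<bar>"
      by (intro tendsto_intros rho)
    then have "e \<le> \<bar>\<rho> - l\<bar>"
      by (rule tendsto_lowerbound) (auto simp: k_def \<sigma>(2))
    with e \<open>\<rho> = l\<close> show False by simp
  next
    case 2
    then have "filterlim (\<lambda>n. r (k n)) at_top sequentially"
      using R by (simp add: tendsto_PInfty_eq_at_top)
    then have "(\<lambda>n. inverse (r (k n))) \<longlonglongrightarrow> 0"
      by (rule tendsto_inverse_0_at_top)
    then have "(\<lambda>n. lam (inverse (r (k n)) / c (k n)) ^ k n) \<longlonglongrightarrow> exp (- \<kappa> * \<bar>0\<bar> powr \<alpha>)"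
      by (rule lam_conv[OF k])
    moreover have "eventually (\<lambda>n. lam (inverse (r (k n)) / c (k n)) ^ k n = lam (1 / c (m (k n))) ^ k n) sequentially"
      using ev_pos by eventually_elim (simp add: r_def)
    ultimately have "(\<lambda>n. lam (1 / c (m (k n))) ^ k n) \<longlonglongrightarrow> exp (- \<kappa> * \<bar>0\<bar> powr \<alpha>)"
      by (rule Lim_transform_eventually)
    then have "(\<lambda>n. lam (1 / c (m (k n))) ^ k n) \<longlonglongrightarrow> 1" using alpha by simp
    then have "(\<lambda>n. lam (1 / c (m (k n))) ^ m (k n)) \<longlonglongrightarrow> 1 powr \<theta>"
      by (rule transfer) (auto simp: lam_nonneg)
    then have "exp (- \<kappa>) = 1 powr \<theta>" by (rule LIMSEQ_unique[OF one'])
    then show False using kappa by simp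
  qed
qed

lemma c_double: "(\<lambda>n. c (2 * n) / c n) \<longlonglongrightarrow> 2 powr (1 / \<alpha>)"
proof (rule c_ratio)
  show "filterlim (\<lambda>n::nat. 2 * n) at_top sequentially"
    by (intro filterlim_at_top_mono[OF filterlim_ident]) auto
  show "(\<lambda>n. real (2 * n) / real n) \<longlonglongrightarrow> 2" by real_asymp
qed simp

lemma c_double_le: "\<exists>p. \<forall>n\<ge>1. c (2 * n) \<le> 2 ^ p * c n"
proof -
  have "convergent (\<lambda>n. c (2 * n) / c n)" using c_double by (auto simp: convergent_def)
  then have "Bseq (\<lambda>n. c (2 * n) / c n)" by (rule convergent_imp_Bseq)
  then obtain K where K: "\<And>n. norm (c (2 * n) / c n) \<le> K" by (auto simp: Bseq_def)
  obtain p :: nat where p: "K < 2 ^ p"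
    using real_arch_pow[of 2 K] by auto
  have "c (2 * n) \<le> 2 ^ p * c n" if "n \<ge> 1" for n
  proof -
    have "c (2 * n) / c n \<le> 2 ^ p" using abs_ge_self[of "c (2 * n) / c n"] K[of n] p by (simp only: real_norm_def)
    then show ?thesis using c_pos[OF that] by (simp add: field_simps)
  qed
  then show ?thesis by blast
qed

text \<open>
An exponent p with c(2n) \<le> 2^p c(n). It yields the one-sided Potter bound \<open>c_le_power\<close>.
\<close>
definition doubling_exponent :: nat where
  "doubling_exponent = (SOME p. \<forall>n\<ge>1. c (2 * n) \<le> 2 ^ p * c n)"

lemma c_doubling: "n \<ge> 1 \<Longrightarrow> c (2 * n) \<le> 2 ^ doubling_exponent * c n"
  unfolding doubling_exponent_def using someI_ex[OF c_double_le] by blast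

lemma c_doubling_power: "n \<ge> 1 \<Longrightarrow> c (2 ^ j * n) \<le> (2 ^ j) ^ doubling_exponent * c n"
proof (induction j)
  case (Suc j)
  have "c (2 ^ Suc j * n) = c (2 * (2 ^ j * n))" by (simp add: mult.assoc)
  also have "\<dots> \<le> 2 ^ doubling_exponent * c (2 ^ j * n)"
    using Suc.prems by (intro c_doubling) (simp add: Suc_le_eq)
  also have "\<dots> \<le> 2 ^ doubling_exponent * ((2 ^ j) ^ doubling_exponent * c n)"
    using Suc by (intro mult_left_mono) auto
  finally show ?case by (simp add: power_mult_distrib mult.assoc)
qed simp

lemma c_le_power:
  assumes "1 \<le> m" "n \<le> d * m" "1 \<le> n"
  shows "c n \<le> (2 * real d) ^ doubling_exponent * c m"
proof -
  have d: "1 \<le> d" using assms by (cases d) auto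
  define j where "j = (LEAST j. d \<le> 2 ^ j)"
  have ex: "\<exists>j. d \<le> 2 ^ j" using less_exp[of d] by (intro exI[of _ d]) simp
  have j: "d \<le> 2 ^ j" unfolding j_def using ex by (rule LeastI_ex)
  have j2: "2 ^ j \<le> 2 * d"
  proof (cases j)
    case (Suc i)
    then have "\<not> d \<le> 2 ^ i" unfolding j_def by (metis lessI not_less_Least)
    then show ?thesis by (simp add: Suc)
  qed (use d in simp)
  have "n \<le> 2 ^ j * m"
    using assms(2) mult_right_mono[OF j, of m] by linarith
  then have "c n \<le> c (2 ^ j * m)" using assms by (intro c_mono) auto
  also have "\<dots> \<le> (2 ^ j) ^ doubling_exponent * c m" by (rule c_doubling_power[OF assms(1)])
  also have "\<dots> \<le> (2 * real d) ^ doubling_exponent * c m"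
  proof (intro mult_right_mono power_mono)
    show "2 ^ j \<le> 2 * real d" using j2 by (metis of_nat_le_iff of_nat_mult of_nat_numeral of_nat_power)
  qed (use c_pos[OF assms(1)] in auto)
  finally show ?thesis .
qed

lemma power_times_geometric_bounded:
  assumes "0 \<le> \<rho>" "\<rho> < (1::real)"
  shows "\<exists>D>0. \<forall>d. (real d) ^ q * \<rho> ^ d \<le> D"
proof -
  have "(\<lambda>d. real d ^ q * \<rho> ^ d) \<longlonglongrightarrow> 0"
  proof (cases "\<rho> = 0")
    case True
    show ?thesis
      by (rule tendsto_eventually, rule eventually_mono[OF eventually_gt_at_top[of 0]]) (simp add: True)
  next
    case False
    with assms have "0 < \<rho>" by simp
    with assms(2) show ?thesis by real_asymp
  qed
  then have "Bseq (\<lambda>d. real d ^ q * \<rho> ^ d)" by (intro convergent_imp_Bseq) (auto simp: convergent_def)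
  then obtain D where "0 < D" "\<And>d. norm (real d ^ q * \<rho> ^ d) \<le> D" by (auto simp: Bseq_def)
  then have "\<forall>d. real d ^ q * \<rho> ^ d \<le> D" by (metis abs_le_D1 real_norm_def)
  with \<open>0 < D\<close> show ?thesis by blast
qed

text \<open>
Uniformly for t in a compact interval away from 0, the powers converge to a limit smaller than 1;
this is extracted from the limit relation by compactness.
\<close>
lemma lam_power_bound_mid:
  assumes K: "0 < K"
  shows "\<exists>m0\<ge>1. \<exists>\<rho>. 0 < \<rho> \<and> \<rho> < 1 \<and> (\<forall>m\<ge>m0. \<forall>t\<in>{1 / K..1}. lam (t / c m) ^ m \<le> \<rho>)"
proof -
  \<comment> \<open>the limit is at most the square of this number on the interval\<close>
  define \<rho> where "\<rho> = exp (- \<kappa> * (1 / K) powr \<alpha> / 2)"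
  have \<rho>: "0 < \<rho>" "\<rho> < 1" using kappa K by (auto simp: \<rho>_def)
  have "\<exists>m0\<ge>1. \<forall>m\<ge>m0. \<forall>t\<in>{1 / K..1}. lam (t / c m) ^ m \<le> \<rho>"
  proof (rule ccontr)
    assume "\<not> ?thesis"
    then have "\<exists>m t. m \<ge> Suc N \<and> t \<in> {1 / K..1} \<and> \<rho> < lam (t / c m) ^ m" for N
      by (metis Suc_eq_plus1 le_add2 not_less)
    then obtain m t where mt: "\<And>N. Suc N \<le> m N" "\<And>N. t N \<in> {1 / K..1}" "\<And>N. \<rho> < lam (t N / c (m N)) ^ m N"
      by metis
    obtain t0 \<tau> where \<tau>: "strict_mono \<tau>" "(t \<circ> \<tau>) \<longlonglongrightarrow> t0" "t0 \<in> {1 / K..1}"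
      using mt(2) compact_imp_seq_compact[of "{1 / K..1}"] unfolding seq_compact_def
      by (metis compact_Icc)
    have "filterlim m at_top sequentially"
      using mt(1) by (intro filterlim_at_top_mono[OF filterlim_ident]) (auto intro: Suc_leD always_eventually)
    then have "filterlim (\<lambda>n. m (\<tau> n)) at_top sequentially"
      by (rule filterlim_compose[OF _ filterlim_subseq[OF \<tau>(1)]])
    then have "(\<lambda>n. lam (t (\<tau> n) / c (m (\<tau> n))) ^ m (\<tau> n)) \<longlonglongrightarrow> exp (- \<kappa> * \<bar>t0\<bar> powr \<alpha>)"
      using \<tau>(2) by (intro lam_conv) (auto simp: comp_def)
    then have "\<rho> \<le> exp (- \<kappa> * \<bar>t0\<bar> powr \<alpha>)"
      by (rule tendsto_lowerbound) (use mt(3) in \<open>auto simp: less_imp_le\<close>)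
    moreover have "(1 / K) powr \<alpha> \<le> \<bar>t0\<bar> powr \<alpha>"
      using \<tau>(3) K alpha by (intro powr_mono2) auto
    then have "exp (- \<kappa> * \<bar>t0\<bar> powr \<alpha>) \<le> exp (- \<kappa> * (1 / K) powr \<alpha>)"
      using kappa by simp
    moreover have "exp (- \<kappa> * (1 / K) powr \<alpha>) < \<rho>"
      using kappa K by (simp add: \<rho>_def)
    ultimately show False by linarith
  qed
  with \<rho> show ?thesis by blast
qed

text \<open>
The domination for the inversion integral. For t / c(n) close to 0, choose the dyadic scale m with
c(m) about c(n) / t. The m-th power is at most \<rho> < 1, so the n-th power is at most \<rho>^(n div m), and
the doubling bound shows that n div m is at least a power of t, which makes the decay faster than any
power. On the remaining compact set \<open>lam\<close> is bounded away from 1 and c grows at most like a power.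
\<close>
theorem lam_power_dominated:
  "\<exists>D>0. \<forall>n\<ge>1. \<forall>t. 1 \<le> t \<and> t \<le> b * c n \<longrightarrow> lam (t / c n) ^ n \<le> D / t\<^sup>2"
proof -
  define p where "p = doubling_exponent"
  define K :: real where "K = 2 ^ p"
  have K: "0 < K" by (simp add: K_def)
  obtain m0 \<rho> where m0: "m0 \<ge> 1" and \<rho>: "0 < \<rho>" "\<rho> < 1"
    and mid: "\<And>m t. m \<ge> m0 \<Longrightarrow> t \<in> {1 / K..1} \<Longrightarrow> lam (t / c m) ^ m \<le> \<rho>"
    using lam_power_bound_mid[OF K] by blast
  obtain D1 where D1: "0 < D1" "\<And>d. real d ^ (2 * p) * \<rho> ^ d \<le> D1"
    using power_times_geometric_bounded[of \<rho> "2 * p"] \<rho> by auto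
  have small: "lam (t / c n) ^ n \<le> (1 + 4 ^ (2 * p) * D1) / t\<^sup>2"
    if n: "n \<ge> 1" and t: "1 \<le> t" "t / c n \<le> 1 / c m0" for n t
  proof -
    define s where "s = t / c n"
    have cn: "0 < c n" by (rule c_pos[OF n])
    have s: "0 < s" using t cn by (simp add: s_def)
    have "filterlim (\<lambda>i. c (2 ^ i * m0)) at_top sequentially"
    proof (rule filterlim_compose[OF c_at_top])
      have "i \<le> 2 ^ i * m0" for i
      proof -
        have "i * 1 \<le> 2 ^ i * m0" using m0 less_exp[of i] by (intro mult_mono) auto
        then show ?thesis by simp
      qed
      then show "filterlim (\<lambda>i. 2 ^ i * m0) at_top sequentially"
        by (intro filterlim_at_top_mono[OF filterlim_ident]) auto
    qed
    then have "\<exists>i. 1 / s < c (2 ^ i * m0)"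
      using eventually_happens[of "\<lambda>i. 1 / s < c (2 ^ i * m0)" sequentially]
      by (auto simp: filterlim_at_top_dense)
    then obtain j where j: "1 / s < c (2 ^ j * m0)" "\<And>i. i < j \<Longrightarrow> \<not> 1 / s < c (2 ^ i * m0)"
      using exists_least_iff[of "\<lambda>i. 1 / s < c (2 ^ i * m0)"] by blast
    have "c m0 \<le> 1 / s" using t s cn c_pos[OF m0] by (simp add: s_def field_simps)
    with j(1) have "j \<noteq> 0" by (intro notI) auto
    then obtain i where i: "j = Suc i" by (cases j) auto
    define m where "m = 2 ^ i * m0"
    have m: "m0 \<le> m" "1 \<le> m" using m0 by (auto simp: m_def)
    have cm: "0 < c m" by (rule c_pos[OF m(2)])
    have cm_le: "c m \<le> 1 / s" using j(2)[of i] by (simp add: i m_def)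
    have "1 / s < c (2 * m)" using j(1) by (simp add: i m_def mult.assoc)
    also have "\<dots> \<le> K * c m" unfolding K_def p_def by (rule c_doubling[OF m(2)])
    finally have "1 / K \<le> s * c m" using s K by (simp add: field_simps)
    moreover have "s * c m \<le> 1" using cm_le s by (simp add: field_simps)
    ultimately have "lam ((s * c m) / c m) ^ m \<le> \<rho>" by (intro mid m(1)) auto
    then have lam_m: "lam s ^ m \<le> \<rho>" using cm by simp
    have t_le: "t \<le> c n / c m" using cm_le cn cm t by (simp add: s_def field_simps)
    show ?thesis
    proof (cases "n < m")
      case True
      then have "c n / c m \<le> 1" using c_mono[of n m] n cm by simp
      then have "t = 1" using t t_le by simp
      then show ?thesis
        using power_le_one[OF lam_nonneg lam_le_1] D1(1) by (auto intro: order.trans[of _ 1])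
    next
      case False
      define d where "d = n div m"
      have d: "1 \<le> d" using False m by (simp add: d_def div_greater_zero_iff Suc_le_eq)
      have "n \<le> (d + 1) * m"
        using dividend_less_div_times[of m n] m by (simp add: d_def)
      also have "\<dots> \<le> (2 * d) * m" using d by (intro mult_right_mono) auto
      finally have "n \<le> (2 * d) * m" .
      then have "c n \<le> (2 * real (2 * d)) ^ p * c m"
        unfolding p_def by (intro c_le_power m n)
      then have "c n \<le> (4 * real d) ^ p * c m" by simp
      moreover have "t * c m \<le> c n" using t_le cm by (simp add: field_simps)
      ultimately have "t * c m \<le> (4 * real d) ^ p * c m" by (rule order.trans[rotated])
      then have "t \<le> (4 * real d) ^ p" using cm by (simp only: mult_le_cancel_right_pos)
      then have t2: "t\<^sup>2 \<le> (4 * real d) ^ (2 * p)"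
        using t power_mono[of t "(4 * real d) ^ p" 2] unfolding power_mult[symmetric] mult.commute[of 2 p]
        by simp
      have "m * d \<le> n" by (simp add: d_def)
      then have "lam s ^ n \<le> lam s ^ (m * d)"
        using lam_nonneg lam_le_1 by (intro power_decreasing) auto
      also have "\<dots> = (lam s ^ m) ^ d" by (simp add: power_mult)
      also have "\<dots> \<le> \<rho> ^ d" using lam_m lam_nonneg by (intro power_mono) auto
      finally have "lam s ^ n * t\<^sup>2 \<le> \<rho> ^ d * (4 * real d) ^ (2 * p)"
        using t2 \<rho> lam_nonneg by (intro mult_mono) auto
      also have "\<dots> = 4 ^ (2 * p) * (real d ^ (2 * p) * \<rho> ^ d)"
        by (simp add: power_mult_distrib)
      also have "\<dots> \<le> 4 ^ (2 * p) * D1" using D1(2)[of d] by (intro mult_left_mono) auto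
      finally show ?thesis using t by (simp add: field_simps s_def)
    qed
  qed
  have "compact {min b (1 / c m0)..b}" "continuous_on {min b (1 / c m0)..b} lam" "{min b (1 / c m0)..b} \<noteq> {}"
    using lam_cont continuous_on_subset by auto
  then obtain s0 where s0: "s0 \<in> {min b (1 / c m0)..b}" "\<And>u. u \<in> {min b (1 / c m0)..b} \<Longrightarrow> lam u \<le> lam s0"
    using continuous_attains_sup[of "{min b (1 / c m0)..b}" lam] by blast
  have "0 < s0" using s0(1) b c_pos[OF m0] by (auto simp: min_le_iff_disj) (metis less_le_trans zero_less_divide_1_iff)
  then have l0: "lam s0 < 1" using s0(1) lam_less_1 by auto
  obtain D2 where D2: "0 < D2" "\<And>d. real d ^ (2 * p) * lam s0 ^ d \<le> D2"
    using power_times_geometric_bounded[of "lam s0" "2 * p"] l0 lam_nonneg by auto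
  have large: "lam (t / c n) ^ n \<le> b\<^sup>2 * 2 ^ (2 * p) * (c 1)\<^sup>2 * D2 / t\<^sup>2"
    if n: "n \<ge> 1" and t: "1 \<le> t" "t \<le> b * c n" "1 / c m0 < t / c n" for n t
  proof -
    have cn: "0 < c n" by (rule c_pos[OF n])
    have "t / c n \<in> {min b (1 / c m0)..b}" using t cn by (simp add: field_simps min_le_iff_disj)
    then have 1: "lam (t / c n) ^ n \<le> lam s0 ^ n" by (intro power_mono s0 lam_nonneg)
    have "c n \<le> (2 * real n) ^ p * c 1" unfolding p_def using n by (intro c_le_power) auto
    then have "t \<le> b * ((2 * real n) ^ p * c 1)" using t b by (meson mult_left_mono less_imp_le order.trans)
    then have "t\<^sup>2 \<le> (b * ((2 * real n) ^ p * c 1))\<^sup>2" using t by (intro power_mono) auto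
    also have "\<dots> = b\<^sup>2 * 2 ^ (2 * p) * (c 1)\<^sup>2 * real n ^ (2 * p)"
      by (simp add: power_mult_distrib power_mult[symmetric] mult.commute mult.left_commute)
    finally have "lam (t / c n) ^ n * t\<^sup>2 \<le> lam s0 ^ n * (b\<^sup>2 * 2 ^ (2 * p) * (c 1)\<^sup>2 * real n ^ (2 * p))"
      using 1 lam_nonneg by (intro mult_mono) auto
    also have "\<dots> = b\<^sup>2 * 2 ^ (2 * p) * (c 1)\<^sup>2 * (real n ^ (2 * p) * lam s0 ^ n)" by simp
    also have "\<dots> \<le> b\<^sup>2 * 2 ^ (2 * p) * (c 1)\<^sup>2 * D2" using D2(2)[of n] by (intro mult_left_mono) auto
    finally show ?thesis using t by (simp add: field_simps)
  qed
  define D where "D = (1 + 4 ^ (2 * p) * D1) + b\<^sup>2 * 2 ^ (2 * p) * (c 1)\<^sup>2 * D2"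
  have D12: "0 \<le> 1 + 4 ^ (2 * p) * D1" "0 \<le> b\<^sup>2 * 2 ^ (2 * p) * (c 1)\<^sup>2 * D2" "0 < 1 + 4 ^ (2 * p) * D1"
    using D1(1) D2(1) by (auto intro: add_pos_nonneg)
  show ?thesis
  proof (intro exI[of _ D] conjI allI impI)
    show "0 < D" using D12 by (simp add: D_def)
    fix n :: nat and t :: real assume n: "n \<ge> 1" and t: "1 \<le> t \<and> t \<le> b * c n"
    show "lam (t / c n) ^ n \<le> D / t\<^sup>2"
    proof (cases "t / c n \<le> 1 / c m0")
      case True
      show ?thesis
        by (rule order.trans[OF small[OF n _ True] divide_right_mono]) (use t D12 in \<open>auto simp: D_def\<close>)
    next
      case False
      show ?thesis
        by (rule order.trans[OF large[OF n] divide_right_mono]) (use t D12 False in \<open>auto simp: D_def\<close>)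
    qed
  qed
qed

end

context stable_norming
begin

text \<open>
As c(2m) / c(m) tends to 2 powr (1 / \<alpha>) > 1, the blocks between m, 2m, 4m, ... contribute a
geometric series.
\<close>
lemma sum_inverse_c:
  "\<exists>D m1. 1 \<le> m1 \<and> 0 < D \<and> (\<forall>m\<ge>m1. \<forall>N. (\<Sum>j\<in>{m..<N}. 1 / (real j * c j)) \<le> D / c m)"
proof -
  define q where "q = (1 + 2 powr (1 / \<alpha>)) / 2"
  have p1: "1 < 2 powr (1 / \<alpha>)" using alpha by (simp add: gr_one_powr)
  have q: "1 < q" "q < 2 powr (1 / \<alpha>)" using p1 by (auto simp: q_def)
  have "eventually (\<lambda>n. q < c (2 * n) / c n) sequentially"
    using c_double q(2) by (rule order_tendstoD)
  then obtain m0 where m0: "\<And>n. n \<ge> m0 \<Longrightarrow> q < c (2 * n) / c n" by (auto simp: eventually_sequentially)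
  define m1 where "m1 = max m0 1"
  \<comment> \<open>the sum of the geometric series with ratio 1 / q\<close>
  define D where "D = q / (q - 1)"
  have D: "0 < D" using q by (simp add: D_def)
  have D_eq: "1 + D / q = D" using q by (simp add: D_def field_simps)
  have dbl: "q * c m \<le> c (2 * m)" if "m \<ge> m1" for m
    using m0[of m] that c_pos[of m] by (simp add: m1_def field_simps)
  have "(\<Sum>j\<in>{m..<N}. 1 / (real j * c j)) \<le> D / c m" if "m \<ge> m1" for m N
    using that
  proof (induction "N - m" arbitrary: m rule: less_induct)
    case less
    have m: "1 \<le> m" using less.prems by (simp add: m1_def)
    have cm: "0 < c m" by (rule c_pos[OF m])
    have block: "(\<Sum>j\<in>{m..<2 * m}. 1 / (real j * c j)) \<le> 1 / c m"
    proof -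
      have "(\<Sum>j\<in>{m..<2 * m}. 1 / (real j * c j)) \<le> (\<Sum>j\<in>{m..<2 * m}. 1 / (real m * c m))"
        using m cm by (intro sum_mono divide_left_mono mult_mono c_mono mult_pos_pos c_pos) auto
      also have "\<dots> = 1 / c m" using m by simp
      finally show ?thesis .
    qed
    have nonneg: "0 \<le> 1 / (real j * c j)" if "j \<in> {m..<k}" for j k
      using that m c_pos[of j] by simp
    show ?case
    proof (cases "N \<le> 2 * m")
      case True
      then have "(\<Sum>j\<in>{m..<N}. 1 / (real j * c j)) \<le> (\<Sum>j\<in>{m..<2 * m}. 1 / (real j * c j))"
        using nonneg[of _ "2 * m"] by (intro sum_mono2) auto
      also have "\<dots> \<le> 1 / c m" by (rule block)
      also have "\<dots> \<le> D / c m"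
      proof (rule divide_right_mono)
        have "0 \<le> D / q" using D q by simp
        then show "1 \<le> D" using D_eq by linarith
      qed (use cm in simp)
      finally show ?thesis .
    next
      case False
      have "(\<Sum>j\<in>{m..<N}. 1 / (real j * c j)) = (\<Sum>j\<in>{m..<2 * m}. 1 / (real j * c j)) + (\<Sum>j\<in>{2 * m..<N}. 1 / (real j * c j))"
        using False by (intro sum.atLeastLessThan_concat[symmetric]) auto
      also have "\<dots> \<le> 1 / c m + D / c (2 * m)"
        using less.prems m False by (intro add_mono block less.hyps) auto
      also have "D / c (2 * m) \<le> D / (q * c m)"
        using dbl[OF less.prems] D q cm c_pos[of "2 * m"] m
        by (intro divide_left_mono) auto
      also have "1 / c m + D / (q * c m) = (1 + D / q) / c m" by (simp add: add_divide_distrib)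
      finally show ?thesis unfolding D_eq by simp
    qed
  qed
  then show ?thesis using D by (intro exI[of _ D] exI[of _ m1]) (auto simp: m1_def)
qed

text \<open>
For k / n close to 1, c(k) / c(n) is close to 1; by monotonicity it suffices to look at the smallest
admissible k.
\<close>
lemma c_flat:
  assumes \<eta>: "0 < \<eta>"
  shows "\<exists>\<epsilon>0>0. \<forall>\<epsilon>. 0 < \<epsilon> \<and> \<epsilon> \<le> \<epsilon>0 \<and> \<epsilon> < 1 \<longrightarrow>
    (\<forall>\<^sub>F n in sequentially. \<forall>k. (1 - \<epsilon>) * real n \<le> real k \<and> k \<le> n \<longrightarrow> (1 - \<eta>) * c n \<le> c k)"
proof -
  have "((\<lambda>\<epsilon>. (1 - \<epsilon>) powr (1 / \<alpha>)) \<longlongrightarrow> (1 - 0) powr (1 / \<alpha>)) (at_right 0)"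
    by (intro tendsto_intros) auto
  then have "eventually (\<lambda>\<epsilon>. 1 - \<eta> < (1 - \<epsilon>) powr (1 / \<alpha>)) (at_right 0)"
    using \<eta> by (intro order_tendstoD) auto
  then obtain \<epsilon>1 where \<epsilon>1: "0 < \<epsilon>1" "\<And>\<epsilon>. 0 < \<epsilon> \<Longrightarrow> \<epsilon> < \<epsilon>1 \<Longrightarrow> 1 - \<eta> < (1 - \<epsilon>) powr (1 / \<alpha>)"
    by (auto simp: eventually_at_right_field)
  show ?thesis
  proof (intro exI[of _ "\<epsilon>1 / 2"] conjI allI impI)
    fix \<epsilon> assume \<epsilon>: "0 < \<epsilon> \<and> \<epsilon> \<le> \<epsilon>1 / 2 \<and> \<epsilon> < 1"
    define m where "m n = nat \<lceil>(1 - \<epsilon>) * real n\<rceil>" for n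
    have pos: "0 < 1 - \<epsilon>" using \<epsilon> by simp
    have m_top: "filterlim m at_top sequentially"
      unfolding m_def[abs_def] using pos by real_asymp
    have m_ratio: "(\<lambda>n. real (m n) / real n) \<longlonglongrightarrow> 1 - \<epsilon>"
    proof -
      have "real (m n) = of_int \<lceil>(1 - \<epsilon>) * real n\<rceil>" for n
      proof -
        have "0 \<le> (1 - \<epsilon>) * real n" using pos by (intro mult_nonneg_nonneg) auto
        then have "- 1 < (1 - \<epsilon>) * real n" by linarith
        then show ?thesis unfolding m_def by (subst of_nat_nat) auto
      qed
      moreover have "(\<lambda>n. of_int \<lceil>(1 - \<epsilon>) * real n\<rceil> / real n) \<longlonglongrightarrow> 1 - \<epsilon>"
        using pos by real_asymp
      ultimately show ?thesis by simp
    qed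
    have "(\<lambda>n. c (m n) / c n) \<longlonglongrightarrow> (1 - \<epsilon>) powr (1 / \<alpha>)"
      by (rule c_ratio[OF m_top pos m_ratio])
    then have "eventually (\<lambda>n. 1 - \<eta> < c (m n) / c n) sequentially"
      using \<epsilon>1(2)[of \<epsilon>] \<epsilon> \<epsilon>1(1) by (intro order_tendstoD) auto
    moreover have "eventually (\<lambda>n. 1 \<le> m n) sequentially"
      using m_top by (simp add: filterlim_at_top)
    ultimately show "\<forall>\<^sub>F n in sequentially. \<forall>k. (1 - \<epsilon>) * real n \<le> real k \<and> k \<le> n \<longrightarrow> (1 - \<eta>) * c n \<le> c k"
      using eventually_ge_at_top[of 1]
    proof eventually_elim
      case (elim n)
      show ?case
      proof (intro allI impI)
        fix k assume k: "(1 - \<epsilon>) * real n \<le> real k \<and> k \<le> n"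
        then have "m n \<le> k" unfolding m_def by (simp add: ceiling_le_iff nat_le_iff)
        then have "c (m n) \<le> c k" using elim by (intro c_mono) auto
        moreover have "(1 - \<eta>) * c n \<le> c (m n)"
          using elim c_pos[of n] by (simp add: field_simps)
        ultimately show "(1 - \<eta>) * c n \<le> c k" by linarith
      qed
    qed
  qed (use \<epsilon>1 in simp)
qed

end

section \<open>Characteristic functions of lattice laws\<close>

text \<open>
With Skorohod's representation the variables converge pointwise, so moving arguments cause no
trouble in the dominated convergence.
\<close>
lemma char_tendsto_diagonal:
  assumes \<mu>: "\<And>n. real_distribution (\<mu> n)" and L: "real_distribution L" and conv: "weak_conv_m \<mu> L"
    and t: "t \<longlonglongrightarrow> t0"
  shows "(\<lambda>n. char (\<mu> n) (t n)) \<longlonglongrightarrow> char L t0"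
proof -
  obtain \<Omega> :: "real measure" and Y_seq Y where \<Omega>: "prob_space \<Omega>"
    and Y_seq [measurable]: "\<And>n. Y_seq n \<in> borel_measurable \<Omega>"
    and \<mu>_eq: "\<And>n. distr \<Omega> borel (Y_seq n) = \<mu> n"
    and Y: "Y \<in> measurable \<Omega> lborel" and L_eq: "distr \<Omega> borel Y = L"
    and lim: "\<And>x. x \<in> space \<Omega> \<Longrightarrow> (\<lambda>n. Y_seq n x) \<longlonglongrightarrow> Y x"
    using Skorohod[OF \<mu> L conv] by blast
  have Y [measurable]: "Y \<in> borel_measurable \<Omega>" using Y by simp
  interpret \<Omega>: prob_space \<Omega> by fact
  have "(\<lambda>n. CLINT x|\<Omega>. iexp (t n * Y_seq n x)) \<longlonglongrightarrow> (CLINT x|\<Omega>. iexp (t0 * Y x))"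
  proof (rule integral_dominated_convergence[where w = "\<lambda>_. 1"])
    show "AE x in \<Omega>. (\<lambda>n. iexp (t n * Y_seq n x)) \<longlonglongrightarrow> iexp (t0 * Y x)"
      by (intro AE_I2 tendsto_intros lim t)
  qed auto
  moreover have "(CLINT x|\<Omega>. iexp (t n * Y_seq n x)) = char (\<mu> n) (t n)" for n
    unfolding char_def \<mu>_eq[symmetric] by (subst integral_distr) auto
  moreover have "(CLINT x|\<Omega>. iexp (t0 * Y x)) = char L t0"
    unfolding char_def L_eq[symmetric] by (subst integral_distr) auto
  ultimately show ?thesis by simp
qed

lemma AE_law_support:
  assumes N: "prob_space N" "sets N = sets (borel :: real measure)"
  shows "AE x in N. x \<in> law_support N"
proof -
  obtain B :: "real set set" where B: "countable B" "topological_basis B"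
    using ex_countable_basis by blast
  define B0 where "B0 = {U \<in> B. emeasure N U = 0}"
  have B_open: "U \<in> B \<Longrightarrow> open U" for U using B(2) by (rule topological_basis_open)
  have null: "(\<Union>U\<in>B0. U) \<in> null_sets N"
  proof (rule null_sets_UN')
    show "countable B0" unfolding B0_def using B(1) by (rule countable_subset[rotated]) auto
    fix U assume "U \<in> B0"
    then show "U \<in> null_sets N" using B_open[of U] N(2) by (auto simp: B0_def)
  qed
  have "x \<in> law_support N" if "x \<notin> (\<Union>U\<in>B0. U)" for x
    unfolding law_support_def
  proof (intro CollectI allI impI, elim conjE)
    fix U :: "real set" assume "open U" "x \<in> U"
    then obtain V where V: "V \<in> B" "x \<in> V" "V \<subseteq> U"
      using B(2) by (metis topological_basisE)
    have "emeasure N V \<noteq> 0" using V that by (auto simp: B0_def)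
    moreover have "emeasure N V \<le> emeasure N U"
      using V \<open>open U\<close> N(2) by (intro emeasure_mono) auto
    ultimately show "0 < emeasure N U" by (simp add: zero_less_iff_neq_zero) (metis le_zero_eq)
  qed
  then show ?thesis using null by (auto intro!: AE_I'[of "\<Union>U\<in>B0. U"])
qed

lemma law_support_subset_closed:
  assumes N: "prob_space N" "sets N = sets (borel :: real measure)"
    and S: "closed S" and AE: "AE x in N. x \<in> S"
  shows "law_support N \<subseteq> S"
proof
  fix x assume x: "x \<in> law_support N"
  have "emeasure N (- S) = 0"
    using AE S N(2) sets_eq_imp_space_eq[OF N(2)]
    by (subst (asm) AE_iff_measurable[of "- S"]) auto
  moreover have "0 < emeasure N (- S)" if "x \<notin> S"
    using x S that unfolding law_support_def by (auto simp: open_Compl)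
  ultimately show "x \<in> S" by auto
qed

lemma closed_lattice_points:
  assumes "0 < h"
  shows "closed (lattice_points h s)"
proof -
  have "lattice_points h s = (\<lambda>x. (x - s) / h) -` \<int>"
    using assms by (auto simp: lattice_points_def field_simps elim!: Ints_cases intro!: image_eqI)
  then show ?thesis
    using assms by (auto intro!: closed_vimage closed_Ints continuous_intros)
qed

text \<open>
If the modulus is 1 at t, then after a rotation the mean of the nonnegative variable 1 - cos (t x - \<theta>)
is 0.
\<close>
lemma AE_lattice_if_char_eq_1:
  assumes "real_distribution N" and t: "0 < t" and 1: "cmod (char N t) = 1"
  shows "\<exists>s. AE x in N. x \<in> lattice_points (2 * pi / t) s"
proof -
  interpret N: real_distribution N by fact
  define \<theta> where "\<theta> = Arg (char N t)"
  have char: "char N t = cis \<theta>"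
    using cis_Arg[of "char N t"] 1 by (cases "char N t = 0") (auto simp: \<theta>_def sgn_div_norm)
  have int: "integrable N (\<lambda>x. iexp (t * x))" by (rule N.integrable_iexp) auto
  have "(CLINT x|N. cis (- \<theta>) * iexp (t * x)) = cis (- \<theta>) * char N t"
    unfolding char_def using int by simp
  also have "\<dots> = 1" by (simp add: char cis_mult)
  finally have "(LINT x|N. Re (cis (- \<theta>) * iexp (t * x))) = 1"
    using int by (subst integral_Re) auto
  moreover have "Re (cis (- \<theta>) * iexp (t * x)) = cos (t * x - \<theta>)" for x
    by (simp add: cis_conv_exp exp_add[symmetric] Re_exp algebra_simps)
  ultimately have "(LINT x|N. cos (t * x - \<theta>)) = 1" by simp
  moreover have intc: "integrable N (\<lambda>x. cos (t * x - \<theta>))"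
    by (rule N.integrable_const_bound[where B = 1]) auto
  ultimately have "(LINT x|N. 1 - cos (t * x - \<theta>)) = 0"
    using N.prob_space by simp
  then have "AE x in N. 1 - cos (t * x - \<theta>) = 0"
    using intc by (subst (asm) integral_nonneg_eq_0_iff_AE) auto
  then have "AE x in N. x \<in> lattice_points (2 * pi / t) (\<theta> / t)"
  proof eventually_elim
    case (elim x)
    then obtain k :: int where "t * x - \<theta> = of_int k * 2 * pi"
      by (auto simp: cos_one_2pi_int)
    then have "x = \<theta> / t + of_int k * (2 * pi / t)"
      using t by (simp add: field_simps)
    then show ?case by (auto simp: lattice_points_def)
  qed
  then show ?thesis by blast
qed

lemma char_less_1_if_span:
  assumes N: "real_distribution N" and lat: "lattice_law N h a" and t: "0 < t" "t < 2 * pi / h"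
  shows "cmod (char N t) < 1"
proof (rule ccontr)
  interpret N: real_distribution N by fact
  assume "\<not> ?thesis"
  then have "cmod (char N t) = 1" using N.cmod_char_le_1[of t] by simp
  then obtain s where "AE x in N. x \<in> lattice_points (2 * pi / t) s"
    using AE_lattice_if_char_eq_1[OF N t(1)] by blast
  moreover have "0 < 2 * pi / t" using t by simp
  ultimately have "law_support N \<subseteq> lattice_points (2 * pi / t) s"
    by (intro law_support_subset_closed closed_lattice_points) (auto simp: N.prob_space_axioms)
  then have "2 * pi / t \<le> h" using lat \<open>0 < 2 * pi / t\<close> unfolding lattice_law_def by blast
  moreover have "0 < h" using lat by (simp add: lattice_law_def)
  ultimately show False using t by (simp add: field_simps)
qed

lemma integral_iexp_symmetric:
  assumes T: "0 < T" and k: "T * y = pi * of_int k"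
  shows "(CLBINT t. indicator {-T..T} t *\<^sub>R iexp (t * y)) = (if y = 0 then 2 * T else 0)"
proof (cases "y = 0")
  case True
  have "(CLBINT t. indicator {-T..T} t *\<^sub>R (1::complex)) = of_real (measure lborel {-T..T})"
    by (simp add: scaleR_conv_of_real)
  then show ?thesis using True T by simp
next
  case False
  have "(CLBINT t. indicator {-T..T} t *\<^sub>R iexp (t * y))
      = iexp (T * y) / (\<i> * y) - iexp (- T * y) / (\<i> * y)"
  proof (rule integral_FTC_Icc)
    show "continuous_on {-T..T} (\<lambda>t. iexp (t * y))" by (intro continuous_intros)
    fix t assume "-T \<le> t" "t \<le> T"
    show "((\<lambda>t. iexp (t * y) / (\<i> * y)) has_vector_derivative iexp (t * y)) (at t within {-T..T})"
      unfolding has_vector_derivative_complex_iff using False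
      by (auto intro!: derivative_eq_intros simp: Re_divide Im_divide Re_exp Im_exp power2_eq_square)
  qed (use T in auto)
  also have "\<dots> = (iexp (T * y) - iexp (- T * y)) / (\<i> * y)" by (simp add: diff_divide_distrib)
  also have "iexp (T * y) - iexp (- T * y) = 2 * \<i> * complex_of_real (sin (pi * of_int k))"
    unfolding k[symmetric] by (simp add: complex_eq_iff Re_exp Im_exp)
  also have "sin (pi * of_int k) = 0" by (simp add: sin_zero_iff_int2 mult.commute)
  finally show ?thesis using False by simp
qed

text \<open>
For y in the lattice of x, the integral of exp(i t (y - x) / C) over the symmetric interval of
length 2 \<pi> C / h is 0 unless y = x. The variable is scaled by C so that the interval grows with the
norming constant and the integrand has a limit.
\<close>
lemma lattice_inversion:
  assumes \<nu>: "real_distribution \<nu>" and h: "0 < h" and lat: "AE y in \<nu>. y \<in> lattice_points h s"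
    and x: "x \<in> lattice_points h s" and C: "0 < C"
  shows "(CLBINT t. indicator {-(pi * C / h)..pi * C / h} t *\<^sub>R (iexp (- (t * x / C)) * char \<nu> (t / C)))
    = 2 * pi * C / h * measure \<nu> {x}"
proof -
  interpret \<nu>: real_distribution \<nu> by fact
  interpret P: pair_sigma_finite lborel \<nu> ..
  define T where "T = pi * C / h"
  have T: "0 < T" using h C by (simp add: T_def)
  let ?f = "\<lambda>(t, y). indicator {-T..T} t *\<^sub>R iexp (t * ((y - x) / C))"
  have inner: "(CLINT y|\<nu>. ?f (t, y)) = indicator {-T..T} t *\<^sub>R (iexp (- (t * x / C)) * char \<nu> (t / C))" for t
  proof -
    have "(CLINT y|\<nu>. ?f (t, y)) = (CLINT y|\<nu>. (indicator {-T..T} t *\<^sub>R iexp (- (t * x / C))) * iexp (t / C * y))"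
      by (intro Bochner_Integration.integral_cong refl)
         (auto simp: indicator_def exp_add[symmetric] field_simps diff_divide_distrib)
    also have "\<dots> = (indicator {-T..T} t *\<^sub>R iexp (- (t * x / C))) * char \<nu> (t / C)"
      unfolding char_def by (rule integral_mult_right_zero)
    finally show ?thesis by simp
  qed
  have outer: "AE y in \<nu>. (CLBINT t. ?f (t, y)) = 2 * T * indicator {x} y"
    using lat
  proof eventually_elim
    case (elim y)
    obtain j k :: int where "y = s + of_int j * h" "x = s + of_int k * h"
      using elim x by (auto simp: lattice_points_def)
    then have "y - x = of_int (j - k) * h" by (simp add: algebra_simps)
    then have "T * ((y - x) / C) = pi * of_int (j - k)" using h C by (simp add: T_def)
    then have "(CLBINT t. indicator {-T..T} t *\<^sub>R iexp (t * ((y - x) / C))) = (if (y - x) / C = 0 then 2 * T else 0)"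
      by (rule integral_iexp_symmetric[OF T])
    then show ?case using C by (auto simp: indicator_def)
  qed
  have "(CLBINT t. (CLINT y|\<nu>. ?f (t, y))) = (CLINT y|\<nu>. (CLBINT t. ?f (t, y)))"
  proof (intro P.Fubini_integral [symmetric] integrableI_bounded_set [where B = 1 and A = "{-T..T} \<times> space \<nu>"])
    show "emeasure (lborel \<Otimes>\<^sub>M \<nu>) ({-T..T} \<times> space \<nu>) < \<infinity>"
      using T by (subst \<nu>.emeasure_pair_measure_Times)
        (auto simp: ennreal_mult_less_top \<nu>.emeasure_eq_measure)
  qed (auto split: split_indicator split_indicator_asm)
  also have "\<dots> = (CLINT y|\<nu>. of_real (2 * T * indicator {x} y))"
    using outer by (intro integral_cong_AE) auto
  also have "\<dots> = of_real (2 * T * measure \<nu> {x})"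
    by (subst integral_complex_of_real) simp
  finally have "(CLBINT t. (CLINT y|\<nu>. ?f (t, y))) = of_real (2 * T * measure \<nu> {x})" .
  then have "(CLBINT t. indicator {-T..T} t *\<^sub>R (iexp (- (t * x / C)) * char \<nu> (t / C)))
      = of_real (2 * T * measure \<nu> {x})"
    by (simp only: inner)
  then show ?thesis by (simp add: T_def)
qed

section \<open>The local limit theorem\<close>

lemma mass_eq_1_if_AE_countable:
  assumes N: "prob_space N" "sets N = sets (borel :: real measure)" and C: "countable C" "AE x in N. x \<in> C"
  shows "mass (\<lambda>x. emeasure N {x}) = 1"
proof (rule antisym)
  interpret N: prob_space N by fact
  have C_sets: "C \<in> sets N" by (subst N(2), rule sets.countable) (auto simp: C)
  have "1 = emeasure N C" using C(2) C_sets by (simp add: N.emeasure_eq_1_AE)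
  also have "\<dots> = (\<integral>\<^sup>+x. emeasure N {x} \<partial>count_space C)"
    by (rule emeasure_countable_singleton) (auto simp: N C)
  also have "\<dots> \<le> mass (\<lambda>x. emeasure N {x})"
    unfolding mass_def
    by (subst nn_integral_count_space_indicator) (auto intro!: nn_integral_mono simp: indicator_def)
  finally show "1 \<le> mass (\<lambda>x. emeasure N {x})" .
qed (rule mass_points_le_1[OF N])

lemma integrable_inverse_1_plus_square_UNIV: "integrable lborel (\<lambda>t::real. k / (1 + t\<^sup>2))"
proof -
  have "integrable lborel (\<lambda>t::real. inverse (1 + t\<^sup>2))"
    using integrable_inverse_1_plus_square by (simp add: set_integrable_def einterval_def)
  then have "integrable lborel (\<lambda>t::real. k * inverse (1 + t\<^sup>2))" by (rule integrable_mult_right)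
  then show ?thesis by (simp add: field_simps)
qed

lemma integrable_if_bounded_by_inverse_square:
  fixes f :: "real \<Rightarrow> 'b::{banach, second_countable_topology}"
  assumes [measurable]: "f \<in> borel_measurable borel" and le: "\<And>t. norm (f t) \<le> E / (1 + t\<^sup>2)"
  shows "integrable lborel f"
proof (rule Bochner_Integration.integrable_bound[OF integrable_inverse_1_plus_square_UNIV[of E]])
  have "norm (f t) \<le> norm (E / (1 + t\<^sup>2))" for t
    using le[of t] abs_ge_self[of "E / (1 + t\<^sup>2)"] unfolding real_norm_def by (rule order.trans)
  then show "AE t in lborel. norm (f t) \<le> norm (E / (1 + t\<^sup>2))" by simp
qed simp

lemma stretched_exponential_bound:
  fixes \<alpha> \<kappa> :: real
  assumes "0 < \<alpha>" "0 < \<kappa>"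
  shows "\<exists>E>0. \<forall>t. (1 + \<bar>t\<bar>) * exp (- \<kappa> * \<bar>t\<bar> powr \<alpha>) \<le> E / (1 + t\<^sup>2)"
proof -
  have "((\<lambda>t::real. (1 + t) * (1 + t\<^sup>2) * exp (- \<kappa> * t powr \<alpha>)) \<longlongrightarrow> 0) at_top"
    using assms by real_asymp
  then have "eventually (\<lambda>t::real. (1 + t) * (1 + t\<^sup>2) * exp (- \<kappa> * t powr \<alpha>) < 1) at_top"
    by (rule order_tendstoD) simp
  then obtain T where T: "\<And>t. t \<ge> T \<Longrightarrow> (1 + t) * (1 + t\<^sup>2) * exp (- \<kappa> * t powr \<alpha>) < 1"
    by (auto simp: eventually_at_top_linorder)
  define T0 where "T0 = max T 0"
  define E where "E = 1 + (1 + T0) * (1 + T0\<^sup>2)"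
  have "(1 + u) * (1 + u\<^sup>2) * exp (- \<kappa> * u powr \<alpha>) \<le> E" if u: "0 \<le> u" for u
  proof (cases "T0 \<le> u")
    case True
    then have "(1 + u) * (1 + u\<^sup>2) * exp (- \<kappa> * u powr \<alpha>) \<le> 1" using T[of u] by (simp add: T0_def)
    then show ?thesis by (auto simp: E_def T0_def intro: order.trans)
  next
    case False
    have "(1 + u) * (1 + u\<^sup>2) * exp (- \<kappa> * u powr \<alpha>) \<le> (1 + T0) * (1 + T0\<^sup>2) * 1"
      using False u assms by (intro mult_mono add_left_mono power_mono) auto
    then show ?thesis by (simp add: E_def)
  qed
  from this[of "\<bar>t\<bar>" for t] have "(1 + \<bar>t\<bar>) * (1 + t\<^sup>2) * exp (- \<kappa> * \<bar>t\<bar> powr \<alpha>) \<le> E" for t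
    by simp
  then have "(1 + \<bar>t\<bar>) * exp (- \<kappa> * \<bar>t\<bar> powr \<alpha>) \<le> E / (1 + t\<^sup>2)" for t
    using add_pos_nonneg[of 1 "t\<^sup>2"] by (simp add: pos_le_divide_eq mult.commute mult.left_commute)
  moreover have "0 < E" by (auto simp: E_def T0_def intro!: add_pos_nonneg mult_nonneg_nonneg)
  ultimately show ?thesis by blast
qed

lemma cmod_stable_char: "cmod (stable_char \<alpha> \<beta> \<kappa> t) = exp (- \<kappa> * \<bar>t\<bar> powr \<alpha>)"
  by (simp add: stable_char_def norm_exp_eq_Re)

lemma char_minus: "real_distribution N \<Longrightarrow> char N (- t) = cnj (char N t)"
proof -
  assume "real_distribution N"
  have "cnj (iexp (t * x)) = iexp (- t * x)" for x :: real
    by (simp add: complex_eq_iff Re_exp Im_exp)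
  then have "(CLINT x|N. cnj (iexp (t * x))) = (CLINT x|N. iexp (- t * x))" by simp
  then show ?thesis unfolding char_def Bochner_Integration.integral_cnj by simp
qed

text \<open>
The hypotheses on the walk, without those on the density of the limit. The limit law enters through
its characteristic function \<open>G\<close>.
\<close>
locale stable_walk = prob_space M for M :: "'a measure" +
  fixes X :: "nat \<Rightarrow> 'a \<Rightarrow> real" and c :: "nat \<Rightarrow> real" and \<alpha> \<beta> \<kappa> h a :: real
  assumes iid: "iid M X"
    and params: "(\<alpha>, \<beta>) \<in> stable_params"
    and norming: "norming_seq (distr M borel (X 0)) c"
    and attracted: "attracted M X c \<alpha> \<beta> \<kappa>"
    and lattice: "lattice_law (distr M borel (X 0)) h a"
begin

abbreviation step :: "real measure" where
  "step \<equiv> distr M borel (X 0)"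

lemma X_rv [measurable]: "X i \<in> borel_measurable M"
  using iid by (simp add: iid_def indep_vars_def)

lemma step_dist: "real_distribution step"
  by (intro real_distribution.intro prob_space_distr real_distribution_axioms.intro) auto

lemma span_pos: "0 < h"
  using lattice by (simp add: lattice_law_def)

lemma alpha_pos: "0 < \<alpha>"
  using params by (auto simp: stable_params_def)

lemma kappa_pos: "0 < \<kappa>"
  using attracted by (simp add: attracted_def)

lemma c_pos: "1 \<le> n \<Longrightarrow> 0 < c n"
  using norming by (simp add: norming_seq_def)

lemma AE_step: "AE x in step. x \<in> lattice_points h a"
proof -
  have "AE x in step. x \<in> law_support step"
    using step_dist by (intro AE_law_support) (auto simp: real_distribution_def)
  then show ?thesis
    using lattice by (auto simp: lattice_law_def elim!: eventually_mono)
qed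

sublocale discrete_walk M X
proof
  show "mass (\<lambda>x. emeasure step {x}) = 1"
  proof (rule mass_eq_1_if_AE_countable[OF _ _ _ AE_step])
    show "countable (lattice_points h a)" by (simp add: lattice_points_def)
  qed (use step_dist in \<open>auto simp: real_distribution_def\<close>)
qed (rule iid)

lemma AE_walk: "AE \<omega> in M. walk X n \<omega> \<in> lattice_points h (a * real n)"
proof -
  have "AE \<omega> in M. X i \<omega> \<in> lattice_points h a" for i
  proof -
    have "{x \<in> space borel. x \<in> lattice_points h a} \<in> sets borel"
      using closed_lattice_points[OF span_pos, of a] by simp
    moreover have "AE x in distr M borel (X i). x \<in> lattice_points h a"
      using AE_step iid unfolding iid_def by metis
    ultimately show ?thesis by (subst (asm) AE_distr_iff) auto
  qed
  then have "AE \<omega> in M. \<forall>i. X i \<omega> \<in> lattice_points h a" by (simp add: AE_all_countable)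
  then show ?thesis
  proof eventually_elim
    case (elim \<omega>)
    show ?case
    proof (induction n)
      case 0
      have "(0::real) = a * real 0 + of_int 0 * h" by simp
      then show ?case unfolding walk_0 lattice_points_def by blast
    next
      case (Suc n)
      obtain j k :: int where "walk X n \<omega> = a * real n + of_int j * h" "X n \<omega> = a + of_int k * h"
        using Suc elim[rule_format, of n] by (auto simp: lattice_points_def)
      then have "walk X (Suc n) \<omega> = a * real (Suc n) + of_int (j + k) * h"
        by (simp add: walk_Suc algebra_simps)
      then show ?case unfolding lattice_points_def by blast
    qed
  qed
qed

lemma free_eq_0: "x \<notin> lattice_points h (a * real n) \<Longrightarrow> free n x = 0"
proof -
  assume x: "x \<notin> lattice_points h (a * real n)"
  have "AE \<omega> in M. walk X n \<omega> \<noteq> x"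
    using AE_walk[of n] x by (auto elim: eventually_mono)
  then have "emeasure M {\<omega>\<in>space M. walk X n \<omega> = x} = 0"
    by (subst (asm) AE_iff_measurable[OF _ refl]) auto
  then show ?thesis by (simp add: prob_walk_eq)
qed

lemma char_walk: "char (distr M borel (walk X n)) t = char step t ^ n"
proof -
  have "indep_vars (\<lambda>_. borel) X {..<n}"
    using iid by (auto simp: iid_def intro: indep_vars_subset)
  then have "char (distr M borel (\<lambda>\<omega>. \<Sum>i<n. X i \<omega>)) t = (\<Prod>i<n. char (distr M borel (X i)) t)"
    by (rule char_distr_sum)
  also have "\<dots> = (\<Prod>i<n. char step t)"
    using iid unfolding iid_def by (intro prod.cong refl arg_cong2[where f = char]) auto
  finally show ?thesis by (simp add: walk_def[abs_def])
qed

lemma char_scaled_walk: "char (distr M borel (\<lambda>\<omega>. walk X n \<omega> / c n)) t = char step (t / c n) ^ n"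
proof -
  have "char (distr M borel (\<lambda>\<omega>. walk X n \<omega> / c n)) t = (CLINT \<omega>|M. iexp (t / c n * walk X n \<omega>))"
    unfolding char_def by (subst integral_distr) auto
  also have "\<dots> = char (distr M borel (walk X n)) (t / c n)"
    unfolding char_def by (subst integral_distr) auto
  finally show ?thesis by (simp add: char_walk)
qed

lemma char_converges:
  assumes k: "filterlim k at_top sequentially" and t: "t \<longlonglongrightarrow> t0"
  shows "(\<lambda>n. char step (t n / c (k n)) ^ k n) \<longlonglongrightarrow> stable_char \<alpha> \<beta> \<kappa> t0"
proof -
  obtain L where L: "stable_law \<alpha> \<beta> \<kappa> L"
    and conv: "weak_conv_m (\<lambda>n. distr M borel (\<lambda>\<omega>. walk X n \<omega> / c n)) L"
    using attracted by (auto simp: attracted_def)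
  have "weak_conv_m (\<lambda>n. distr M borel (\<lambda>\<omega>. walk X (k n) \<omega> / c (k n))) L"
    unfolding weak_conv_m_def weak_conv_def
  proof (intro allI impI)
    fix x assume "isCont (cdf L) x"
    then have "(\<lambda>n. cdf (distr M borel (\<lambda>\<omega>. walk X n \<omega> / c n)) x) \<longlonglongrightarrow> cdf L x"
      using conv by (simp add: weak_conv_m_def weak_conv_def)
    then show "(\<lambda>n. cdf (distr M borel (\<lambda>\<omega>. walk X (k n) \<omega> / c (k n))) x) \<longlonglongrightarrow> cdf L x"
      by (rule filterlim_compose[OF _ k])
  qed
  moreover have "real_distribution (distr M borel (\<lambda>\<omega>. walk X n \<omega> / c n))" for n
    by (intro real_distribution.intro prob_space_distr real_distribution_axioms.intro) auto
  ultimately have "(\<lambda>n. char (distr M borel (\<lambda>\<omega>. walk X (k n) \<omega> / c (k n))) (t n)) \<longlonglongrightarrow> char L t0"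
    using L t by (intro char_tendsto_diagonal) (auto simp: stable_law_def)
  then show ?thesis using L by (simp add: char_scaled_walk stable_law_def)
qed

sublocale stable_norming "\<lambda>t. cmod (char step t)" c \<alpha> \<kappa> "pi / h"
proof
  interpret S: real_distribution step by (rule step_dist)
  show "0 < c n" if "1 \<le> n" for n by (rule c_pos[OF that])
  show "c m \<le> c n" if "1 \<le> m" "m \<le> n" for m n
    using norming that by (auto simp: norming_seq_def monotone_on_def)
  show "0 < pi / h" using span_pos by simp
  show "continuous_on UNIV (\<lambda>t. cmod (char step t))"
    by (intro continuous_on_norm) (simp add: continuous_on_eq_continuous_at S.isCont_char)
  show "cmod (char step t) \<le> 1" for t by (rule S.cmod_char_le_1)
  show "cmod (char step t) < 1" if "0 < t" "t \<le> pi / h" for t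
  proof (rule char_less_1_if_span[OF step_dist lattice that(1)])
    have "pi / h < 2 * pi / h" using span_pos by (simp add: divide_strict_right_mono)
    then show "t < 2 * pi / h" using that(2) by linarith
  qed
  show "(\<lambda>n. cmod (char step (s n / c (k n))) ^ k n) \<longlonglongrightarrow> exp (- \<kappa> * \<bar>t0\<bar> powr \<alpha>)"
    if "filterlim k at_top sequentially" "s \<longlonglongrightarrow> t0" for k s t0
    using tendsto_norm[OF char_converges[OF that]] by (simp add: norm_power cmod_stable_char)
qed (auto simp: alpha_pos kappa_pos)

abbreviation "G \<equiv> stable_char \<alpha> \<beta> \<kappa>"

lemma G_measurable [measurable]: "G \<in> borel_measurable borel"
proof -
  obtain L where "real_distribution L" "char L = G"
    using attracted by (auto simp: attracted_def stable_law_def)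
  then show ?thesis using real_distribution.char_measurable by metis
qed

lemma G_integrable: "integrable lborel G" "integrable lborel (\<lambda>t. \<bar>t\<bar> * cmod (G t))"
proof -
  obtain E where E: "\<And>t. (1 + \<bar>t\<bar>) * exp (- \<kappa> * \<bar>t\<bar> powr \<alpha>) \<le> E / (1 + t\<^sup>2)"
    using stretched_exponential_bound[OF alpha_pos kappa_pos] by blast
  have 1: "cmod (G t) \<le> E / (1 + t\<^sup>2)" and 2: "\<bar>t\<bar> * cmod (G t) \<le> E / (1 + t\<^sup>2)" for t
    using E[of t] by (auto simp: cmod_stable_char distrib_right intro: order.trans[rotated])
  show "integrable lborel G"
    by (rule integrable_if_bounded_by_inverse_square[of _ E]) (use 1 in auto)
  show "integrable lborel (\<lambda>t. \<bar>t\<bar> * cmod (G t))"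
    by (rule integrable_if_bounded_by_inverse_square[of _ E]) (use 2 in \<open>auto simp: abs_mult\<close>)
qed

text \<open>
The integrand of the inversion formula for P(S(n) = x) at the scale c(n), apart from the factor that
depends on x.
\<close>
definition scaled_char :: "nat \<Rightarrow> real \<Rightarrow> complex" where
  "scaled_char n t = indicator {-(pi * c n / h)..pi * c n / h} t *\<^sub>R (char step (t / c n) ^ n)"

lemma scaled_char_measurable [measurable]: "scaled_char n \<in> borel_measurable borel"
proof -
  interpret S: real_distribution step by (rule step_dist)
  show ?thesis unfolding scaled_char_def[abs_def] by measurable
qed

lemma scaled_char_bound: "\<exists>E. \<forall>n\<ge>1. \<forall>t. cmod (scaled_char n t) \<le> E / (1 + t\<^sup>2)"
proof -
  obtain D where D: "0 < D" "\<And>n t. n \<ge> 1 \<Longrightarrow> 1 \<le> t \<and> t \<le> pi / h * c n \<Longrightarrow> cmod (char step (t / c n)) ^ n \<le> D / t\<^sup>2"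
    using lam_power_dominated by blast
  define E where "E = 2 + 2 * D"
  have "cmod (scaled_char n t) \<le> E / (1 + t\<^sup>2)" if n: "n \<ge> 1" for n t
  proof -
    have pos: "0 < 1 + t\<^sup>2" by (simp add: add_pos_nonneg)
    have sym: "cmod (char step (\<bar>t\<bar> / c n)) = cmod (char step (t / c n))"
      using char_minus[OF step_dist, of "t / c n"] by (auto simp: abs_if)
    show ?thesis
    proof (cases "\<bar>t\<bar> < 1")
      case True
      have "cmod (scaled_char n t) \<le> 1"
        using power_le_one[OF lam_nonneg lam_le_1] by (auto simp: scaled_char_def norm_power indicator_def)
      moreover have "t\<^sup>2 \<le> 1" using True by (simp add: abs_square_le_1)
      then have "1 \<le> E / (1 + t\<^sup>2)" using pos D(1) by (simp add: E_def field_simps)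
      ultimately show ?thesis by linarith
    next
      case False
      have "cmod (scaled_char n t) \<le> D / t\<^sup>2"
      proof (cases "\<bar>t\<bar> \<le> pi / h * c n")
        case True
        then show ?thesis
          using D(2)[OF n, of "\<bar>t\<bar>"] False D(1)
          by (auto simp: scaled_char_def indicator_def norm_power sym)
      next
        case False
        then have "t \<notin> {-(pi * c n / h)..pi * c n / h}" by auto
        then show ?thesis using D(1) by (simp add: scaled_char_def)
      qed
      also have "D / t\<^sup>2 \<le> E / (1 + t\<^sup>2)"
      proof -
        have "1 \<le> t\<^sup>2" using False by (simp add: abs_square_le_1 not_less) (metis abs_1 abs_le_square_iff not_less one_power2 False)
        then have "D * (1 + t\<^sup>2) \<le> E * t\<^sup>2"
        proof -
          have "D * 1 \<le> D * t\<^sup>2" using D(1) \<open>1 \<le> t\<^sup>2\<close> by (intro mult_left_mono) auto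
          moreover have "E * t\<^sup>2 - D * (1 + t\<^sup>2) = 2 * t\<^sup>2 + (D * t\<^sup>2 - D * 1)"
            by (simp add: E_def algebra_simps)
          ultimately show ?thesis using zero_le_power2[of t] by linarith
        qed
        then have "D \<le> E * t\<^sup>2 / (1 + t\<^sup>2)" by (simp only: pos_le_divide_eq[OF pos])
        moreover have "0 < t\<^sup>2" using \<open>1 \<le> t\<^sup>2\<close> by linarith
        ultimately show ?thesis by (simp only: pos_divide_le_eq times_divide_eq_left)
      qed
      finally show ?thesis .
    qed
  qed
  then show ?thesis by blast
qed

lemma scaled_char_integrable: "n \<ge> 1 \<Longrightarrow> integrable lborel (scaled_char n)"
proof -
  assume n: "n \<ge> 1"
  obtain E where E: "\<And>t. cmod (scaled_char n t) \<le> E / (1 + t\<^sup>2)" using scaled_char_bound n by blast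
  show ?thesis
    by (rule integrable_if_bounded_by_inverse_square[of _ E]) (use E in auto)
qed

lemma scaled_char_tendsto: "(\<lambda>n. scaled_char n t) \<longlonglongrightarrow> G t"
proof -
  have "eventually (\<lambda>n. \<bar>t\<bar> * h / pi \<le> c n) sequentially"
    using c_at_top by (simp add: filterlim_at_top)
  then have "eventually (\<lambda>n. char step (t / c n) ^ n = scaled_char n t) sequentially"
  proof eventually_elim
    case (elim n)
    then have "\<bar>t\<bar> \<le> pi * c n / h" using span_pos by (simp add: field_simps)
    then show ?case by (simp add: scaled_char_def abs_le_iff)
  qed
  moreover have "(\<lambda>n. char step (t / c n) ^ n) \<longlonglongrightarrow> G t"
    using char_converges[OF filterlim_ident tendsto_const[of t]] by simp
  ultimately show ?thesis by (rule Lim_transform_eventually[rotated])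
qed

lemma scaled_char_L1: "(\<lambda>n. LBINT t. cmod (scaled_char n t - G t)) \<longlonglongrightarrow> 0"
proof -
  obtain E where E: "\<And>n t. n \<ge> 1 \<Longrightarrow> cmod (scaled_char n t) \<le> E / (1 + t\<^sup>2)" using scaled_char_bound by blast
  have "(\<lambda>n. LBINT t. cmod (scaled_char (Suc n) t - G t)) \<longlonglongrightarrow> (\<integral>t. (0::real) \<partial>(lborel :: real measure))"
  proof (rule integral_dominated_convergence[where w = "\<lambda>t. E / (1 + t\<^sup>2) + cmod (G t)"])
    show "integrable lborel (\<lambda>t. E / (1 + t\<^sup>2) + cmod (G t))"
      using G_integrable(1) integrable_inverse_1_plus_square_UNIV by (intro Bochner_Integration.integrable_add integrable_norm)
    have "(\<lambda>n. cmod (scaled_char (Suc n) t - G t)) \<longlonglongrightarrow> 0" for t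
      using LIMSEQ_Suc[OF tendsto_norm[OF tendsto_diff[OF scaled_char_tendsto[of t] tendsto_const[of "G t"]]]]
      by simp
    then show "AE t in lborel. (\<lambda>n. cmod (scaled_char (Suc n) t - G t)) \<longlonglongrightarrow> 0" by simp
    show "AE t in lborel. norm (cmod (scaled_char (Suc n) t - G t)) \<le> E / (1 + t\<^sup>2) + cmod (G t)" for n
      using E[of "Suc n"] by (intro AE_I2) (auto intro: order.trans[OF norm_triangle_ineq4])
  qed auto
  then show ?thesis by (subst (asm) filterlim_sequentially_Suc) simp
qed

text \<open>
By Fourier inversion this is the value at 0 of the limit density; see \<open>\<gamma>_eq\<close>.
\<close>
definition \<gamma> :: real where
  "\<gamma> = Re (CLBINT t. G t) / (2 * pi)"

lemma prob_walk_integral: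
  assumes n: "n \<ge> 1" and x: "x \<in> lattice_points h (a * real n)"
  shows "of_real (c n * prob {\<omega>\<in>space M. walk X n \<omega> = x})
    = h / (2 * pi) * (CLBINT t. iexp (- (t * x / c n)) * scaled_char n t)"
proof -
  let ?\<nu> = "distr M borel (walk X n)"
  have "AE y in ?\<nu>. y \<in> lattice_points h (a * real n)"
    using AE_walk[of n] closed_lattice_points[OF span_pos, of "a * real n"] by (subst AE_distr_iff) auto
  then have "(CLBINT t. indicator {-(pi * c n / h)..pi * c n / h} t *\<^sub>R (iexp (- (t * x / c n)) * char ?\<nu> (t / c n)))
    = 2 * pi * c n / h * measure ?\<nu> {x}"
    by (intro lattice_inversion[OF _ span_pos _ x c_pos[OF n]])
      (auto intro!: real_distribution.intro prob_space_distr real_distribution_axioms.intro)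
  moreover have "measure ?\<nu> {x} = prob {\<omega>\<in>space M. walk X n \<omega> = x}"
    by (simp add: measure_distr vimage_def Int_def conj_commute)
  ultimately show ?thesis
    using span_pos by (simp add: scaled_char_def char_walk field_simps)
qed

text \<open>
A form of Gnedenko's local limit theorem with an error that is explicit in x: the factor
exp(- i t x / c(n)) differs from 1 by at most |t x| / c(n), and t G(t) is integrable.
\<close>
theorem local_limit:
  "\<exists>r K. r \<longlonglongrightarrow> 0 \<and> 0 \<le> K \<and> (\<forall>n\<ge>1. \<forall>x\<in>lattice_points h (a * real n).
     \<bar>c n * prob {\<omega>\<in>space M. walk X n \<omega> = x} - h * \<gamma>\<bar> \<le> r n + K * (\<bar>x\<bar> / c n))"
proof (intro exI conjI ballI allI impI)
  let ?r = "\<lambda>n. h / (2 * pi) * (LBINT t. cmod (scaled_char n t - G t))"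
  let ?K = "h / (2 * pi) * (LBINT t. \<bar>t\<bar> * cmod (G t))"
  show "?r \<longlonglongrightarrow> 0" using tendsto_mult_right[OF scaled_char_L1, of "h / (2 * pi)"] by (simp add: mult.commute)
  show "0 \<le> ?K" using span_pos by (intro mult_nonneg_nonneg Bochner_Integration.integral_nonneg) auto
  fix n :: nat and x assume n: "n \<ge> 1" and x: "x \<in> lattice_points h (a * real n)"
  let ?e = "\<lambda>t. iexp (- (t * x / c n))"
  have cn: "0 < c n" by (rule c_pos[OF n])
  have int1: "integrable lborel (\<lambda>t. ?e t * scaled_char n t)"
    by (rule Bochner_Integration.integrable_bound[OF scaled_char_integrable[OF n]]) (auto simp: norm_mult)
  have diff_int: "integrable lborel (\<lambda>t. cmod (scaled_char n t - G t))"
    using scaled_char_integrable[OF n] G_integrable by auto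
  have "cmod (?e t * scaled_char n t - G t) \<le> cmod (scaled_char n t - G t) + \<bar>x\<bar> / c n * (\<bar>t\<bar> * cmod (G t))" for t
  proof -
    have "?e t * scaled_char n t - G t = ?e t * (scaled_char n t - G t) + (?e t - 1) * G t"
      by (simp add: algebra_simps)
    then have "cmod (?e t * scaled_char n t - G t) \<le> cmod (scaled_char n t - G t) + cmod (?e t - 1) * cmod (G t)"
      using norm_triangle_ineq[of "?e t * (scaled_char n t - G t)" "(?e t - 1) * G t"] by (simp add: norm_mult)
    also have "cmod (?e t - 1) \<le> \<bar>t * x / c n\<bar>"
      using iexp_approx1[of "- (t * x / c n)" 0] by simp
    finally show ?thesis
      using cn by (simp add: abs_mult mult.commute mult.left_commute mult_right_mono)
  qed
  then have "(LBINT t. cmod (?e t * scaled_char n t - G t))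
      \<le> (LBINT t. cmod (scaled_char n t - G t) + \<bar>x\<bar> / c n * (\<bar>t\<bar> * cmod (G t)))"
    using int1 G_integrable diff_int by (intro Bochner_Integration.integral_mono) auto
  also have "\<dots> = (LBINT t. cmod (scaled_char n t - G t)) + \<bar>x\<bar> / c n * (LBINT t. \<bar>t\<bar> * cmod (G t))"
    using G_integrable diff_int by simp
  finally have le: "(LBINT t. cmod (?e t * scaled_char n t - G t))
      \<le> (LBINT t. cmod (scaled_char n t - G t)) + \<bar>x\<bar> / c n * (LBINT t. \<bar>t\<bar> * cmod (G t))" .
  have "complex_of_real (c n * prob {\<omega>\<in>space M. walk X n \<omega> = x}) - h / (2 * pi) * (CLBINT t. G t)
      = h / (2 * pi) * (CLBINT t. ?e t * scaled_char n t - G t)"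
    unfolding prob_walk_integral[OF n x] using int1 G_integrable by (simp add: right_diff_distrib)
  from arg_cong[OF this, of Re] have "c n * prob {\<omega>\<in>space M. walk X n \<omega> = x} - h * \<gamma>
      = Re (h / (2 * pi) * (CLBINT t. ?e t * scaled_char n t - G t))"
    by (simp add: \<gamma>_def)
  then have "\<bar>c n * prob {\<omega>\<in>space M. walk X n \<omega> = x} - h * \<gamma>\<bar>
      \<le> cmod (h / (2 * pi) * (CLBINT t. ?e t * scaled_char n t - G t))"
    by (simp only: abs_Re_le_cmod)
  also have "\<dots> = h / (2 * pi) * cmod (CLBINT t. ?e t * scaled_char n t - G t)"
    using span_pos by (simp add: norm_mult norm_divide)
  also have "\<dots> \<le> h / (2 * pi) * (LBINT t. cmod (?e t * scaled_char n t - G t))"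
    using span_pos by (intro mult_left_mono integral_norm_bound) auto
  also have "\<dots> \<le> h / (2 * pi) * ((LBINT t. cmod (scaled_char n t - G t)) + \<bar>x\<bar> / c n * (LBINT t. \<bar>t\<bar> * cmod (G t)))"
    using span_pos le by (intro mult_left_mono) auto
  finally show "\<bar>c n * prob {\<omega>\<in>space M. walk X n \<omega> = x} - h * \<gamma>\<bar> \<le> ?r n + ?K * (\<bar>x\<bar> / c n)"
    by (simp add: algebra_simps)
qed

theorem concentration: "\<exists>C>0. \<forall>n\<ge>1. \<forall>x. c n * prob {\<omega>\<in>space M. walk X n \<omega> = x} \<le> C"
proof -
  obtain E where E: "\<And>n t. n \<ge> 1 \<Longrightarrow> cmod (scaled_char n t) \<le> E / (1 + t\<^sup>2)" using scaled_char_bound by blast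
  define C where "C = 1 + h / (2 * pi) * (LBINT t. E / (1 + t\<^sup>2))"
  have E0: "0 \<le> E" using order.trans[OF norm_ge_zero E[of 1 0]] by simp
  have C: "0 < C" unfolding C_def using span_pos E0
    by (intro add_pos_nonneg mult_nonneg_nonneg Bochner_Integration.integral_nonneg) auto
  have "c n * prob {\<omega>\<in>space M. walk X n \<omega> = x} \<le> C" if n: "n \<ge> 1" for n x
  proof (cases "x \<in> lattice_points h (a * real n)")
    case True
    let ?e = "\<lambda>t. iexp (- (t * x / c n))"
    have "c n * prob {\<omega>\<in>space M. walk X n \<omega> = x} = Re (of_real (c n * prob {\<omega>\<in>space M. walk X n \<omega> = x}))"
      by simp
    also have "\<dots> \<le> cmod (of_real (c n * prob {\<omega>\<in>space M. walk X n \<omega> = x}))" by (rule complex_Re_le_cmod)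
    also have "\<dots> = cmod (h / (2 * pi) * (CLBINT t. ?e t * scaled_char n t))"
      unfolding prob_walk_integral[OF n True] ..
    also have "\<dots> = h / (2 * pi) * cmod (CLBINT t. ?e t * scaled_char n t)"
      using span_pos by (simp add: norm_mult norm_divide)
    also have "\<dots> \<le> h / (2 * pi) * (LBINT t. cmod (?e t * scaled_char n t))"
      using span_pos by (intro mult_left_mono integral_norm_bound) auto
    also have "\<dots> \<le> h / (2 * pi) * (LBINT t. E / (1 + t\<^sup>2))"
      using span_pos scaled_char_integrable[OF n] integrable_inverse_1_plus_square_UNIV[of E] E[OF n]
      by (intro mult_left_mono Bochner_Integration.integral_mono) (auto simp: norm_mult)
    finally show ?thesis by (simp add: C_def)
  next
    case False
    then have "prob {\<omega>\<in>space M. walk X n \<omega> = x} = 0"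
      using prob_walk_eq[of n x] free_eq_0[OF False] by (simp add: emeasure_eq_measure)
    then show ?thesis using C by simp
  qed
  with C show ?thesis by blast
qed

end

section \<open>The stable density at the origin\<close>

context
  fixes \<alpha> :: real
  assumes alpha: "0 < \<alpha>"
begin

text \<open>
As a function of z in the right half-plane this is holomorphic, and for positive z it is a positive
multiple of z powr (- 1 / \<alpha>), by scaling. By analytic continuation the formula holds on the whole
half-plane, which determines the argument of the integral.
\<close>
definition half_line_integral :: "complex \<Rightarrow> complex" where
  "half_line_integral z = (CLBINT t. indicator {0<..} t *\<^sub>R exp (- z * of_real (\<bar>t\<bar> powr \<alpha>)))"

lemma exp_powr_integrable: "0 < r \<Longrightarrow> integrable lborel (\<lambda>t::real. exp (- r * \<bar>t\<bar> powr \<alpha>))"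
proof -
  assume r: "0 < r"
  obtain E where E: "\<And>t. (1 + \<bar>t\<bar>) * exp (- r * \<bar>t\<bar> powr \<alpha>) \<le> E / (1 + t\<^sup>2)"
    using stretched_exponential_bound[OF alpha r] by blast
  have "norm (exp (- r * \<bar>t\<bar> powr \<alpha>)) \<le> E / (1 + t\<^sup>2)" for t
  proof -
    have "1 * exp (- r * \<bar>t\<bar> powr \<alpha>) \<le> (1 + \<bar>t\<bar>) * exp (- r * \<bar>t\<bar> powr \<alpha>)"
      by (intro mult_right_mono) auto
    from order.trans[OF this E[of t]] show ?thesis by simp
  qed
  then show ?thesis by (intro integrable_if_bounded_by_inverse_square[of _ E]) auto
qed

lemma exp_complex_integrable:
  assumes "0 < Re z"
  shows "integrable lborel (\<lambda>t. indicator {0<..} t *\<^sub>R exp (- z * of_real (\<bar>t\<bar> powr \<alpha>)))"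
  by (rule Bochner_Integration.integrable_bound[OF exp_powr_integrable[OF assms]])
     (auto simp: norm_exp_eq_Re indicator_def)

lemma exp_diff_bound:
  assumes "r \<le> Re z" "r \<le> Re w" "0 \<le> u"
  shows "cmod (exp (- w * of_real u) - exp (- z * of_real u)) \<le> u * exp (- r * u) * cmod (w - z)"
proof (rule field_differentiable_bound[of "{z. r \<le> Re z}" "\<lambda>z. exp (- z * of_real u)" "\<lambda>z. - of_real u * exp (- z * of_real u)"])
  show "convex {z. r \<le> Re z}" by (rule convex_halfspace_Re_ge)
  fix z assume z: "z \<in> {z. r \<le> Re z}"
  show "((\<lambda>z. exp (- z * of_real u)) has_field_derivative - of_real u * exp (- z * of_real u)) (at z within {z. r \<le> Re z})"
    by (auto intro!: derivative_eq_intros)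
  have "exp (- (Re z * u)) \<le> exp (- (r * u))" using z assms by (simp add: mult_right_mono)
  then show "cmod (- of_real u * exp (- z * of_real u)) \<le> u * exp (- r * u)"
    using assms by (simp add: norm_mult norm_exp_eq_Re mult_left_mono)
qed (use assms in auto)

lemma half_line_integral_holomorphic: "half_line_integral holomorphic_on {z. 0 < Re z}"
proof (rule holomorphic_onI)
  fix z assume "z \<in> {z. 0 < Re z}"
  then have z: "0 < Re z" by simp
  \<comment> \<open>a margin that keeps the difference quotients in a half-plane where the integrand decays uniformly\<close>
  define r where "r = Re z / 2"
  have r: "0 < r" "r < Re z" using z by (auto simp: r_def)
  define S where "S = {w. r \<le> Re w}"
  have int_S: "z \<in> interior S"
    by (rule interiorI[of "{w. r < Re w}"]) (auto simp: S_def r open_halfspace_Re_gt)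
  let ?e = "\<lambda>w t. indicator {0<..} t *\<^sub>R exp (- w * complex_of_real (\<bar>t\<bar> powr \<alpha>))"
  let ?D = "CLBINT t. - of_real (\<bar>t\<bar> powr \<alpha>) * ?e z t"
  have "((\<lambda>w. (half_line_integral w - half_line_integral z) / (w - z)) \<longlongrightarrow> ?D) (at z within S)"
    unfolding tendsto_at_iff_sequentially comp_def
  proof (intro allI impI)
    fix W assume W: "\<forall>i. W i \<in> S - {z}" and lim: "W \<longlonglongrightarrow> z"
    have "(half_line_integral (W n) - half_line_integral z) / (W n - z)
        = (CLBINT t. (?e (W n) t - ?e z t) / (W n - z))" for n
      unfolding half_line_integral_def
      using exp_complex_integrable[of "W n"] exp_complex_integrable[OF z] W r
      by (subst Bochner_Integration.integral_diff[symmetric]) (auto simp: S_def intro: less_le_trans)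
    moreover have "(\<lambda>n. CLBINT t. (?e (W n) t - ?e z t) / (W n - z)) \<longlonglongrightarrow> ?D"
    proof (rule integral_dominated_convergence[where w = "\<lambda>t. 2 / r * exp (- (r / 2) * \<bar>t\<bar> powr \<alpha>)"])
      show "integrable lborel (\<lambda>t. 2 / r * exp (- (r / 2) * \<bar>t\<bar> powr \<alpha>))"
        using exp_powr_integrable[of "r / 2"] r by simp
      have "(\<lambda>n. (?e (W n) t - ?e z t) / (W n - z)) \<longlonglongrightarrow> - of_real (\<bar>t\<bar> powr \<alpha>) * ?e z t" for t
      proof (cases "0 < t")
        case True
        have "((\<lambda>w. exp (- w * of_real (\<bar>t\<bar> powr \<alpha>))) has_field_derivative
            - of_real (\<bar>t\<bar> powr \<alpha>) * exp (- z * of_real (\<bar>t\<bar> powr \<alpha>))) (at z within S)"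
          by (auto intro!: derivative_eq_intros)
        then have "((\<lambda>w. (exp (- w * of_real (\<bar>t\<bar> powr \<alpha>)) - exp (- z * of_real (\<bar>t\<bar> powr \<alpha>))) / (w - z))
            \<longlongrightarrow> - of_real (\<bar>t\<bar> powr \<alpha>) * exp (- z * of_real (\<bar>t\<bar> powr \<alpha>))) (at z within S)"
          by (simp add: has_field_derivative_iff)
        then show ?thesis
          using W lim True unfolding tendsto_at_iff_sequentially comp_def by simp
      qed simp
      then show "AE t in lborel. (\<lambda>n. (?e (W n) t - ?e z t) / (W n - z)) \<longlonglongrightarrow> - of_real (\<bar>t\<bar> powr \<alpha>) * ?e z t"
        by simp
      have "cmod ((?e (W n) t - ?e z t) / (W n - z)) \<le> 2 / r * exp (- (r / 2) * \<bar>t\<bar> powr \<alpha>)" for n t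
      proof (cases "0 < t")
        case True
        define u where "u = \<bar>t\<bar> powr \<alpha>"
        have "cmod (?e (W n) t - ?e z t) \<le> u * exp (- r * u) * cmod (W n - z)"
          using exp_diff_bound[of r z "W n" u] r W True by (auto simp: u_def S_def)
        then have "cmod ((?e (W n) t - ?e z t) / (W n - z)) \<le> u * exp (- r * u)"
          using W by (auto simp: norm_divide divide_le_eq)
        also have "u * exp (- r * u) = 2 / r * (r / 2 * u * exp (- (r / 2) * u)) * exp (- (r / 2) * u)"
          using r by (simp add: field_simps exp_add[symmetric])
        also have "\<dots> \<le> 2 / r * 1 * exp (- (r / 2) * u)"
        proof (intro mult_right_mono mult_left_mono)
          have "r / 2 * u \<le> exp (r / 2 * u)"
            using exp_ge_add_one_self[of "r / 2 * u"] by linarith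
          then have "r / 2 * u * exp (- (r / 2 * u)) \<le> exp (r / 2 * u) * exp (- (r / 2 * u))"
            by (intro mult_right_mono) auto
          then show "r / 2 * u * exp (- (r / 2) * u) \<le> 1" by (simp add: exp_minus)
        qed (use r in auto)
        finally show ?thesis by (simp add: u_def)
      qed (use r in auto)
      then show "AE t in lborel. cmod ((?e (W n) t - ?e z t) / (W n - z)) \<le> 2 / r * exp (- (r / 2) * \<bar>t\<bar> powr \<alpha>)" for n
        by simp
    qed auto
    ultimately show "(\<lambda>n. (half_line_integral (W n) - half_line_integral z) / (W n - z)) \<longlonglongrightarrow> ?D"
      by (simp only:)
  qed
  then have "(half_line_integral has_field_derivative ?D) (at z)"
    using at_within_interior[OF int_S] by (simp add: has_field_derivative_iff)
  then show "half_line_integral field_differentiable at z within {z. 0 < Re z}"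
    by (auto simp: field_differentiable_def intro: has_field_derivative_at_within)
qed

lemma half_line_integral_real:
  assumes x: "0 < x"
  shows "half_line_integral (of_real x) = of_real (x powr (- 1 / \<alpha>)) * half_line_integral 1"
proof -
  define k where "k = x powr (- 1 / \<alpha>)"
  have k: "0 < k" using x by (simp add: k_def)
  have "k powr \<alpha> = x powr (- 1)" unfolding k_def powr_powr using alpha by simp
  then have ka: "k powr \<alpha> * x = 1" using x by (simp add: powr_minus)
  have eq: "indicator {0<..} (k * t) *\<^sub>R exp (- of_real x * of_real (\<bar>k * t\<bar> powr \<alpha>))
      = (indicator {0<..} t *\<^sub>R exp (- 1 * of_real (\<bar>t\<bar> powr \<alpha>)) :: complex)" for t
  proof (cases "0 < t")
    case True
    have "x * \<bar>k * t\<bar> powr \<alpha> = (k powr \<alpha> * x) * \<bar>t\<bar> powr \<alpha>"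
      using k by (simp add: abs_mult powr_mult)
    then have "x * \<bar>k * t\<bar> powr \<alpha> = \<bar>t\<bar> powr \<alpha>" using ka by simp
    then have "complex_of_real x * of_real (\<bar>k * t\<bar> powr \<alpha>) = of_real (\<bar>t\<bar> powr \<alpha>)"
      by (simp flip: of_real_mult)
    then show ?thesis using True k by simp
  qed (use k in \<open>auto simp: zero_less_mult_iff\<close>)
  have "half_line_integral (of_real x)
      = \<bar>k\<bar> *\<^sub>R (CLBINT t. indicator {0<..} (0 + k * t) *\<^sub>R exp (- of_real x * of_real (\<bar>0 + k * t\<bar> powr \<alpha>)))"
    unfolding half_line_integral_def using k by (intro lborel_integral_real_affine) auto
  then show ?thesis
    using k by (simp only: add_0 eq half_line_integral_def[symmetric]) (simp add: scaleR_conv_of_real k_def)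
qed

lemma half_line_integral_eq:
  assumes z: "0 < Re z"
  shows "half_line_integral z = z powr (of_real (- 1 / \<alpha>)) * half_line_integral 1"
proof -
  let ?f = "\<lambda>z. half_line_integral z - z powr (of_real (- 1 / \<alpha>)) * half_line_integral 1"
  have "?f z = 0"
  proof (rule analytic_continuation[where f = ?f and w = z and S = "{z. 0 < Re z}" and U = "of_real ` {0<..}" and \<xi> = 1])
    show "?f holomorphic_on {z. 0 < Re z}"
      by (intro holomorphic_intros half_line_integral_holomorphic) (auto simp: complex_nonpos_Reals_iff)
    show "connected {z. 0 < Re z}" by (intro convex_connected convex_halfspace_Re_gt)
    show "(1::complex) islimpt of_real ` {0<..}"
      unfolding islimpt_approachable
    proof (intro allI impI)
      fix e :: real assume "0 < e"
      have "dist (complex_of_real (1 + e / 2)) (of_real 1) = dist (1 + e / 2) 1" by (rule dist_of_real)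
      then have "dist (complex_of_real (1 + e / 2)) 1 < e" using \<open>0 < e\<close> by (simp add: dist_real_def)
      moreover have "complex_of_real (1 + e / 2) \<in> of_real ` {0<..}" using \<open>0 < e\<close> by (intro imageI) simp
      moreover have "complex_of_real (1 + e / 2) \<noteq> 1" using \<open>0 < e\<close> by (simp only: of_real_eq_1_iff)
      ultimately show "\<exists>x'\<in>complex_of_real ` {0<..}. x' \<noteq> 1 \<and> dist x' 1 < e" by blast
    qed
    fix w assume "w \<in> complex_of_real ` {0<..}"
    then obtain x where "w = of_real x" "0 < x" by auto
    then show "?f w = 0" by (simp add: half_line_integral_real powr_of_real flip: of_real_minus of_real_divide)
  qed (use z in \<open>auto simp: open_halfspace_Re_gt\<close>)
  then show ?thesis by simp
qed

lemma half_line_integral_1: "\<exists>I>0. half_line_integral 1 = of_real I"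
proof (intro exI conjI)
  let ?I = "LBINT t. indicator {0<..} t *\<^sub>R exp (- 1 * \<bar>t\<bar> powr \<alpha>)"
  have int: "integrable lborel (\<lambda>t. indicator {0<..} t *\<^sub>R exp (- 1 * \<bar>t\<bar> powr \<alpha>))"
    by (rule Bochner_Integration.integrable_bound[OF exp_powr_integrable[of 1]]) (auto simp: indicator_def)
  have "?I \<noteq> 0"
  proof
    assume "?I = 0"
    then have "AE t in lborel. indicator {0<..} t *\<^sub>R exp (- 1 * \<bar>t\<bar> powr \<alpha>) = 0"
      using int by (subst (asm) integral_nonneg_eq_0_iff_AE) auto
    then have "AE t in lborel. t \<notin> {0<..<1::real}" by eventually_elim (auto simp: indicator_def)
    then have "emeasure lborel {0<..<1::real} = 0"
      by (subst (asm) AE_iff_measurable[of "{0<..<1}"]) auto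
    then show False by simp
  qed
  moreover have "0 \<le> ?I" by (intro Bochner_Integration.integral_nonneg) auto
  ultimately show "0 < ?I" by linarith
  have "half_line_integral 1 = (CLBINT t. of_real (indicator {0<..} t *\<^sub>R exp (- 1 * \<bar>t\<bar> powr \<alpha>)))"
    unfolding half_line_integral_def
    by (intro Bochner_Integration.integral_cong refl) (auto simp: indicator_def exp_of_real[symmetric])
  also have "\<dots> = of_real ?I" by (rule integral_complex_of_real)
  finally show "half_line_integral 1 = of_real ?I" .
qed

lemma Re_half_line_integral_pos:
  assumes z: "0 < Re z" and angle: "\<bar>Im (Ln z)\<bar> < pi * \<alpha> / 2"
  shows "0 < Re (half_line_integral z)"
proof -
  obtain I where I: "0 < I" "half_line_integral 1 = of_real I" using half_line_integral_1 by blast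
  have "z \<noteq> 0" using z by auto
  have "\<bar>Im (Ln z) / \<alpha>\<bar> < pi / 2" using angle alpha by (simp add: abs_divide field_simps)
  then have "0 < cos (Im (Ln z) / \<alpha>)" by (intro cos_gt_zero_pi) linarith+
  then have "0 < Re (z powr (of_real (- 1 / \<alpha>)))"
    using \<open>z \<noteq> 0\<close> by (simp add: powr_def Re_exp)
  then show ?thesis using I by (simp add: half_line_integral_eq[OF z])
qed

end

text \<open>
The two half-lines contribute complex conjugates, so the integral is twice the real part of
\<open>half_line_integral z\<close> with z = \<kappa> (1 - i \<beta> tan (\<pi> \<alpha> / 2)). This real part is positive if the
argument of z is smaller than \<pi> \<alpha> / 2 in modulus. For \<alpha> \<ge> 1 this holds on the whole right
half-plane, and for \<alpha> < 1 it follows from |\<beta>| < 1.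
\<close>
lemma integral_stable_char_pos:
  assumes \<alpha>: "0 < \<alpha>" and \<kappa>: "0 < \<kappa>" and \<beta>: "1 \<le> \<alpha> \<or> \<bar>\<beta>\<bar> < 1"
    and int: "integrable lborel (stable_char \<alpha> \<beta> \<kappa>)"
  shows "0 < Re (CLBINT t. stable_char \<alpha> \<beta> \<kappa> t)"
proof -
  define B where "B = \<beta> * tan (pi * \<alpha> / 2)"
  define z where "z = complex_of_real \<kappa> * (1 - \<i> * of_real B)"
  have z: "0 < Re z" using \<kappa> by (simp add: z_def)
  then have z0: "z \<noteq> 0" by auto
  have pos: "stable_char \<alpha> \<beta> \<kappa> t = exp (- z * of_real (\<bar>t\<bar> powr \<alpha>))" if "0 < t" for t
    using that by (simp add: stable_char_def z_def B_def algebra_simps)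
  have neg: "stable_char \<alpha> \<beta> \<kappa> (- t) = cnj (stable_char \<alpha> \<beta> \<kappa> t)" for t
    by (simp add: stable_char_def exp_cnj)
  let ?G = "stable_char \<alpha> \<beta> \<kappa>"
  have "(CLBINT t. ?G t) = (CLBINT t. indicator {0<..} t *\<^sub>R ?G t + indicator {..<0} t *\<^sub>R ?G t)"
    by (rule integral_cong_AE)
       (use int AE_lborel_singleton[of "0::real"] in \<open>auto elim!: eventually_mono simp: indicator_def\<close>)
  also have "\<dots> = (CLBINT t. indicator {0<..} t *\<^sub>R ?G t) + (CLBINT t. indicator {..<0} t *\<^sub>R ?G t)"
    using int by (intro Bochner_Integration.integral_add integrable_mult_indicator) auto
  also have "(CLBINT t. indicator {..<0} t *\<^sub>R ?G t) = (CLBINT t. indicator {..<0} (0 + -1 * t) *\<^sub>R ?G (0 + -1 * t))"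
    by (subst lborel_integral_real_affine[of "-1" _ 0]) auto
  also have "\<dots> = (CLBINT t. cnj (indicator {0<..} t *\<^sub>R ?G t))"
    by (intro Bochner_Integration.integral_cong refl) (auto simp: neg indicator_def)
  also have "\<dots> = cnj (CLBINT t. indicator {0<..} t *\<^sub>R ?G t)"
    by (rule Bochner_Integration.integral_cnj)
  also have "(CLBINT t. indicator {0<..} t *\<^sub>R ?G t) = half_line_integral \<alpha> z"
    unfolding half_line_integral_def[OF \<alpha>]
    by (intro Bochner_Integration.integral_cong refl) (auto simp: pos indicator_def)
  finally have eq: "Re (CLBINT t. ?G t) = 2 * Re (half_line_integral \<alpha> z)" by simp
  have half: "\<bar>Im (Ln z)\<bar> < pi / 2" using Re_Ln_pos_lt[OF z0] z by simp
  have "\<bar>Im (Ln z)\<bar> < pi * \<alpha> / 2"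
  proof (cases "1 \<le> \<alpha>")
    case True
    then have "pi / 2 \<le> pi * \<alpha> / 2" by simp
    with half show ?thesis by linarith
  next
    case False
    then have \<beta>: "\<bar>\<beta>\<bar> < 1" "\<alpha> < 1" using \<beta> by auto
    define \<theta> where "\<theta> = Im (Ln z)"
    have "exp (Ln z) = z" using z0 by simp
    then have "Re z = exp (Re (Ln z)) * cos \<theta>" "Im z = exp (Re (Ln z)) * sin \<theta>"
      by (metis Re_exp \<theta>_def, metis Im_exp \<theta>_def)
    then have "tan \<theta> = Im z / Re z" by (simp add: tan_def)
    then have tan: "tan \<theta> = - B" using \<kappa> by (simp add: z_def)
    have \<alpha>2: "0 < pi * \<alpha> / 2" "pi * \<alpha> / 2 < pi / 2" using \<alpha> \<beta> by auto
    then have tp: "0 < tan (pi * \<alpha> / 2)" by (intro tan_gt_zero) auto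
    have "tan \<bar>\<theta>\<bar> = \<bar>B\<bar>"
    proof (cases "0 \<le> \<theta>")
      case True
      then have "0 \<le> tan \<theta>" using half by (intro tan_pos_pi2_le) (auto simp: \<theta>_def)
      then show ?thesis using True tan by simp
    next
      case False
      then have "0 < tan (- \<theta>)" using half by (intro tan_gt_zero) (auto simp: \<theta>_def)
      then show ?thesis using False tan by simp
    qed
    also have "\<bar>B\<bar> = \<bar>\<beta>\<bar> * tan (pi * \<alpha> / 2)" using tp by (simp add: B_def abs_mult)
    also have "\<dots> < 1 * tan (pi * \<alpha> / 2)" using \<beta> tp by (intro mult_strict_right_mono) auto
    finally have "tan \<bar>\<theta>\<bar> < tan (pi * \<alpha> / 2)" by simp
    then show ?thesis
      using \<alpha>2 half tan_mono_lt_eq[of "\<bar>\<theta>\<bar>" "pi * \<alpha> / 2"] by (auto simp: \<theta>_def)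
  qed
  then show ?thesis unfolding eq using Re_half_line_integral_pos[OF \<alpha> z] by simp
qed

text \<open>
Divide Levy's inversion formula for the interval from 0 to \<eta> by \<eta> and let \<eta> tend to 0: one side
tends to g(0) by continuity, the other one to the integral of the characteristic function by
dominated convergence.
\<close>
lemma density_at_0_inversion:
  fixes g :: "real \<Rightarrow> real"
  assumes cont: "continuous_on UNIV g" and nonneg: "\<And>x. 0 \<le> g x"
    and D: "real_distribution (density lborel (\<lambda>x. ennreal (g x)))"
    and int: "integrable lborel (char (density lborel (\<lambda>x. ennreal (g x))))"
  shows "of_real (g 0) = 1 / (2 * pi) * (CLBINT t. char (density lborel (\<lambda>x. ennreal (g x))) t)"
proof -
  let ?D = "density lborel (\<lambda>x. ennreal (g x))"
  let ?G = "char ?D"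
  interpret D: real_distribution ?D by fact
  have g [measurable]: "g \<in> borel_measurable borel" using cont by (rule borel_measurable_continuous_onI)
  have pt: "measure ?D {x} = 0" for x
  proof -
    have "emeasure ?D {x} = (\<integral>\<^sup>+y. ennreal (g y) * indicator {x} y \<partial>lborel)"
      by (rule emeasure_density) auto
    also have "\<dots> = (\<integral>\<^sup>+(y::real). 0 \<partial>lborel)"
      by (rule nn_integral_cong_AE)
         (use AE_lborel_singleton[of x] in \<open>auto elim!: eventually_mono simp: indicator_def\<close>)
    finally show ?thesis by (simp add: measure_def)
  qed
  let ?F = "\<lambda>\<eta> t. (iexp (- (t * 0)) - iexp (- (t * \<eta>))) / (\<i> * complex_of_real t)"
  have F_bound: "cmod (?F \<eta> t) \<le> \<eta>" if "0 < \<eta>" for \<eta> t :: real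
  proof (cases "t = 0")
    case False
    then show ?thesis using Levy_Inversion_aux2[of "-\<eta>" 0 t] that by simp
  qed (use that in simp)
  have F_int: "integrable lborel (\<lambda>t. ?F \<eta> t * ?G t)" if "0 < \<eta>" for \<eta>
  proof (rule Bochner_Integration.integrable_bound[where f = "\<lambda>t. \<eta> * cmod (?G t)"])
    show "integrable lborel (\<lambda>t. \<eta> * cmod (?G t))" using int by auto
    show "AE t in lborel. norm (?F \<eta> t * ?G t) \<le> norm (\<eta> * cmod (?G t))"
    proof (rule AE_I2)
      fix t
      have "cmod (?F \<eta> t) * cmod (?G t) \<le> \<eta> * cmod (?G t)"
        by (intro mult_right_mono F_bound that) auto
      then show "norm (?F \<eta> t * ?G t) \<le> norm (\<eta> * cmod (?G t))"
        using that by (simp only: norm_mult abs_norm_cancel real_norm_def abs_of_pos)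
    qed
  qed measurable
  have inv: "of_real (measure ?D {0<..\<eta>}) = 1 / (2 * pi) * (CLBINT t. ?F \<eta> t * ?G t)" if \<eta>: "0 < \<eta>" for \<eta>
  proof -
    let ?I = "\<lambda>T::nat. CLBINT t=-T..T. ?F \<eta> t * ?G t"
    have "(\<lambda>T::nat. 1 / (2 * pi) * ?I T) \<longlonglongrightarrow> of_real (measure ?D {0<..\<eta>})"
      using D.Levy_Inversion[of 0 \<eta>] \<eta> pt by simp
    moreover have "(\<lambda>T::nat. 1 / (2 * pi) * ?I T)
        \<longlonglongrightarrow> 1 / (2 * pi) * (CLBINT t. ?F \<eta> t * ?G t)"
    proof (intro tendsto_mult tendsto_const)
      have "?I T = (CLBINT t. indicator {-real T<..<real T} t *\<^sub>R (?F \<eta> t * ?G t))" for T :: nat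
        by (simp add: interval_lebesgue_integral_def set_lebesgue_integral_def)
      moreover have "(\<lambda>T::nat. CLBINT t. indicator {-real T<..<real T} t *\<^sub>R (?F \<eta> t * ?G t))
          \<longlonglongrightarrow> (CLBINT t. ?F \<eta> t * ?G t)"
      proof (rule integral_dominated_convergence[where w = "\<lambda>t. cmod (?F \<eta> t * ?G t)"])
        have "(\<lambda>T::nat. indicator {-real T<..<real T} t *\<^sub>R (?F \<eta> t * ?G t)) \<longlonglongrightarrow> ?F \<eta> t * ?G t" for t
        proof (rule tendsto_eventually)
          show "eventually (\<lambda>T::nat. indicator {-real T<..<real T} t *\<^sub>R (?F \<eta> t * ?G t) = ?F \<eta> t * ?G t) sequentially"
            using eventually_gt_at_top[of "nat \<lceil>\<bar>t\<bar>\<rceil>"]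
          proof eventually_elim
            case (elim T)
            then have "\<bar>t\<bar> < real T" by linarith
            then have "t \<in> {-real T<..<real T}" by auto
            then show ?case by simp
          qed
        qed
        then show "AE t in lborel. (\<lambda>T::nat. indicator {-real T<..<real T} t *\<^sub>R (?F \<eta> t * ?G t)) \<longlonglongrightarrow> ?F \<eta> t * ?G t"
          by simp
        show "AE t in lborel. norm (indicator {-real T<..<real T} t *\<^sub>R (?F \<eta> t * ?G t)) \<le> cmod (?F \<eta> t * ?G t)" for T :: nat
          by (auto simp: indicator_def)
      qed (use F_int[OF \<eta>] in \<open>auto simp del: of_real_0 minus_zero mult_zero_right\<close>)
      ultimately show "?I \<longlonglongrightarrow> (CLBINT t. ?F \<eta> t * ?G t)" by simp
    qed
    ultimately show ?thesis by (rule LIMSEQ_unique)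
  qed
  define \<eta> where "\<eta> n = 1 / real (Suc n)" for n
  have \<eta>: "0 < \<eta> n" "\<eta> n \<le> 1" for n by (auto simp: \<eta>_def)
  have \<eta>0: "\<eta> \<longlonglongrightarrow> 0" unfolding \<eta>_def[abs_def] using LIMSEQ_inverse_real_of_nat by (simp add: inverse_eq_divide)
  have "(\<lambda>n. CLBINT t. ?F (\<eta> n) t * ?G t / \<eta> n) \<longlonglongrightarrow> (CLBINT t. ?G t)"
  proof (rule integral_dominated_convergence[where w = "\<lambda>t. cmod (?G t)"])
    have lim: "(\<lambda>n. ?F (\<eta> n) t * ?G t / \<eta> n) \<longlonglongrightarrow> ?G t" if t: "t \<noteq> 0" for t
    proof -
      have "((\<lambda>e. (iexp (- (e * 0)) - iexp (- (e * t))) / (\<i> * of_real e)) \<longlongrightarrow> of_real t) (at 0)"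
      proof (cases "0 \<le> t")
        case True
        then show ?thesis using Levy_Inversion_aux1[of 0 t] by simp
      next
        case False
        then show ?thesis using tendsto_minus[OF Levy_Inversion_aux1[of t 0]] by (simp add: minus_divide_left)
      qed
      then have "((\<lambda>e. (iexp (- (e * 0)) - iexp (- (e * t))) / (\<i> * of_real e) / of_real t) \<longlongrightarrow> of_real t / of_real t) (at 0)"
        using t by (intro tendsto_divide tendsto_const) auto
      moreover have "(iexp (- (e * 0)) - iexp (- (e * t))) / (\<i> * of_real e) / of_real t
          = (iexp (- (t * 0)) - iexp (- (t * e))) / (\<i> * of_real t) / of_real e" for e
        by (simp only: divide_divide_eq_left mult_zero_right mult.commute[of e t] mult.assoc mult.commute[of "of_real t"])
      ultimately have "((\<lambda>e. (iexp (- (t * 0)) - iexp (- (t * e))) / (\<i> * of_real t) / of_real e) \<longlongrightarrow> 1) (at 0)"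
        using t by simp
      moreover have "filterlim \<eta> (at 0) sequentially"
        using \<eta>0 \<eta>(1) by (auto simp: filterlim_at less_imp_neq[symmetric])
      ultimately have "(\<lambda>n. ?F (\<eta> n) t / of_real (\<eta> n)) \<longlonglongrightarrow> 1"
        by (rule filterlim_compose)
      then have "(\<lambda>n. ?F (\<eta> n) t / of_real (\<eta> n) * ?G t) \<longlonglongrightarrow> 1 * ?G t"
        by (intro tendsto_mult tendsto_const)
      then show ?thesis by (simp only: times_divide_eq_left mult_1)
    qed
    show "AE t in lborel. (\<lambda>n. ?F (\<eta> n) t * ?G t / \<eta> n) \<longlonglongrightarrow> ?G t"
      using AE_lborel_singleton[of "0::real"] by eventually_elim (rule lim)
    show "AE t in lborel. norm (?F (\<eta> n) t * ?G t / \<eta> n) \<le> cmod (?G t)" for n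
    proof (rule AE_I2)
      fix t
      have "cmod (?F (\<eta> n) t) * cmod (?G t) \<le> \<eta> n * cmod (?G t)"
        by (intro mult_right_mono F_bound \<eta>) auto
      then have "cmod (?F (\<eta> n) t) * cmod (?G t) / \<eta> n \<le> cmod (?G t)"
        by (simp only: pos_divide_le_eq[OF \<eta>(1)] mult.commute[of "\<eta> n"])
      then show "norm (?F (\<eta> n) t * ?G t / \<eta> n) \<le> cmod (?G t)"
        by (simp only: norm_mult norm_divide norm_of_real abs_of_pos[OF \<eta>(1)])
    qed
  qed (use int in auto)
  then have "(\<lambda>n. 1 / (2 * pi) * (CLBINT t. ?F (\<eta> n) t * ?G t / \<eta> n)) \<longlonglongrightarrow> 1 / (2 * pi) * (CLBINT t. ?G t)"
    by (intro tendsto_mult tendsto_const)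
  moreover have "1 / (2 * pi) * (CLBINT t. ?F (\<eta> n) t * ?G t / \<eta> n) = of_real (measure ?D {0<..\<eta> n} / \<eta> n)" for n
    unfolding of_real_divide inv[OF \<eta>(1)] by (simp only: integral_divide_zero times_divide_eq_right)
  ultimately have lim1: "(\<lambda>n. complex_of_real (measure ?D {0<..\<eta> n} / \<eta> n)) \<longlonglongrightarrow> 1 / (2 * pi) * (CLBINT t. ?G t)"
    by simp
  have meas: "measure ?D {0<..e} / e = (LBINT y. g (e * y) * indicator {0<..1} y)" if e: "0 < e" for e
  proof -
    have "measure ?D {0<..e} = (LINT x|?D. indicator {0<..e} x)" by simp
    also have "\<dots> = (LBINT x. g x * indicator {0<..e} x)"
      by (rule integral_real_density) (auto simp: nonneg)
    also have "\<dots> = \<bar>e\<bar> *\<^sub>R (LBINT y. g (0 + e * y) * indicator {0<..e} (0 + e * y))"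
      using e by (intro lborel_integral_real_affine) auto
    also have "(LBINT y. g (0 + e * y) * indicator {0<..e} (0 + e * y)) = (LBINT y. g (e * y) * indicator {0<..1} y)"
      using e by (intro Bochner_Integration.integral_cong refl) (auto simp: indicator_def zero_less_mult_iff)
    finally show ?thesis using e by simp
  qed
  have "compact (g ` {0..1})"
    by (intro compact_continuous_image continuous_on_subset[OF cont]) auto
  then have "bounded (g ` {0..1})" by (rule compact_imp_bounded)
  then obtain b where "\<forall>z\<in>g ` {0..1}. norm z \<le> b"
    unfolding bounded_iff by (elim exE)
  then have b: "norm (g y) \<le> b" if "y \<in> {0..1}" for y
    using that by simp
  have "(\<lambda>n. LBINT y. g (\<eta> n * y) * indicator {0<..1} y) \<longlonglongrightarrow> (LBINT y. g 0 * indicator {0<..1::real} y)"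
  proof (rule integral_dominated_convergence[where w = "\<lambda>y. b * indicator {0<..1} y"])
    have "(\<lambda>n. g (\<eta> n * y)) \<longlonglongrightarrow> g (0 * y)" for y
      using cont by (intro continuous_on_tendsto_compose[of UNIV g] tendsto_intros \<eta>0) auto
    then have "(\<lambda>n. g (\<eta> n * y) * indicator {0<..1} y) \<longlonglongrightarrow> g 0 * indicator {0<..1} y" for y
      by (intro tendsto_mult tendsto_const) simp
    then show "AE y in lborel. (\<lambda>n. g (\<eta> n * y) * indicator {0<..1} y) \<longlonglongrightarrow> g 0 * indicator {0<..1} y"
      by simp
    show "AE y in lborel. norm (g (\<eta> n * y) * indicator {0<..1} y) \<le> b * indicator {0<..1} y" for n
    proof (rule AE_I2)
      fix y
      show "norm (g (\<eta> n * y) * indicator {0<..1} y) \<le> b * indicator {0<..1} y"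
      proof (cases "y \<in> {0<..1}")
        case True
        then have "0 \<le> \<eta> n * y" "\<eta> n * y \<le> 1"
          using \<eta>[of n] mult_mono[of "\<eta> n" 1 y 1] by auto
        then show ?thesis using b[of "\<eta> n * y"] True by simp
      qed simp
    qed
  qed auto
  then have "(\<lambda>n. measure ?D {0<..\<eta> n} / \<eta> n) \<longlonglongrightarrow> g 0"
    by (simp add: meas[OF \<eta>(1)])
  then have "(\<lambda>n. complex_of_real (measure ?D {0<..\<eta> n} / \<eta> n)) \<longlonglongrightarrow> of_real (g 0)"
    by (rule tendsto_of_real)
  then show ?thesis using lim1 by (rule LIMSEQ_unique)
qed

section \<open>Estimates for the potential\<close>

lemma ennreal_enn2real_le_1: "f \<le> 1 \<Longrightarrow> f = ennreal (enn2real f)"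
  by (cases f) (auto simp: top_unique)

context discrete_walk
begin

text \<open>
Real-valued versions, for the estimates: \<open>stay_prob n x\<close> is P(S(n) = x, tau^- > n), \<open>below_prob n x\<close>
sums it over the points below x, and \<open>spitzer_term k j x\<close> is the contribution of the split
n = k + j to n P(S(n) = x, tau^- > n) in Spitzer's identity.
\<close>
definition stay_prob :: "nat \<Rightarrow> real \<Rightarrow> real" where
  "stay_prob n x = enn2real (pos_walk n x)"

definition below_prob :: "nat \<Rightarrow> real \<Rightarrow> real" where
  "below_prob n x = enn2real (pos_walk_below n x)"

definition walk_prob :: "nat \<Rightarrow> real \<Rightarrow> real" where
  "walk_prob n x = enn2real (free n x)"

definition spitzer_term :: "nat \<Rightarrow> nat \<Rightarrow> real \<Rightarrow> real" where
  "spitzer_term k j x = enn2real (conv (hits {0<..} k) (pos_walk j) x)"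

lemma ennreal_stay_prob: "pos_walk n x = ennreal (stay_prob n x)"
  unfolding stay_prob_def using stay_finite[of "{0<..}" n x] by (simp add: less_top)

lemma ennreal_walk_prob: "free n x = ennreal (walk_prob n x)"
  unfolding walk_prob_def using stay_finite[of UNIV n x] by (simp add: less_top)

lemma conv_le_1: "mass f \<le> 1 \<Longrightarrow> (\<And>z. g z \<le> 1) \<Longrightarrow> conv f g x \<le> 1"
  using conv_le_mass[of g 1 f x] by simp

lemma mass_hits_le_1: "mass (hits A n) \<le> 1"
proof -
  have "mass (hits A n) \<le> mass (free n)"
    by (rule mass_mono) (auto simp: hits_def indicator_def)
  then show ?thesis by (simp add: mass_free)
qed

lemma ennreal_below_prob: "pos_walk_below n x = ennreal (below_prob n x)"
proof -
  have "pos_walk_below n x \<le> 1"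
    unfolding pos_walk_below_def by (rule conv_le_1[OF mass_stay_le_1]) (simp add: indicator_def)
  then show ?thesis unfolding below_prob_def by (rule ennreal_enn2real_le_1)
qed

lemma stay_prob_le_1: "stay_prob n x \<le> 1"
proof -
  have "pos_walk n x \<le> 1" using stay_le_free[of "{0<..}" n x] free_le_1[of n x] by (rule order.trans)
  then show ?thesis by (simp add: ennreal_stay_prob)
qed

lemma ennreal_first_part: "conv (hits {0<..} k) (pos_walk j) x = ennreal (spitzer_term k j x)"
proof -
  have "conv (hits {0<..} k) (pos_walk j) x \<le> 1"
    by (rule conv_le_1[OF mass_hits_le_1])
       (rule order.trans[OF le_mass mass_stay_le_1])
  then show ?thesis unfolding spitzer_term_def by (rule ennreal_enn2real_le_1)
qed

lemma prob_nonneg: "0 \<le> stay_prob n x" "0 \<le> below_prob n x" "0 \<le> walk_prob n x" "0 \<le> spitzer_term k j x"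
  by (simp_all add: stay_prob_def below_prob_def walk_prob_def spitzer_term_def)

lemma walk_prob_eq: "walk_prob n x = prob {\<omega>\<in>space M. walk X n \<omega> = x}"
  unfolding walk_prob_def by (simp add: prob_walk_eq[symmetric] emeasure_eq_measure)

lemma stay_prob_eq: "stay_prob n x = prob {\<omega>\<in>space M. walk X n \<omega> = x \<and> enat n < tau_minus X \<omega>}"
  unfolding stay_prob_def by (simp add: prob_walk_tau_minus[symmetric] emeasure_eq_measure)

lemma stay_prob_nonpos: "1 \<le> n \<Longrightarrow> x \<le> 0 \<Longrightarrow> stay_prob n x = 0"
  by (cases n) (auto simp: stay_prob_def)

lemma stay_prob_sum: "real n * stay_prob n x = (\<Sum>j<n. spitzer_term (n - j) j x)"
proof -
  have "of_nat n * pos_walk n x = gconv (hits {0<..}) pos_walk n x"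
    using spitzer[OF splits_additively_pos, of n x] by (simp add: by_time_def)
  also have "\<dots> = (\<Sum>i\<le>n. ennreal (spitzer_term i (n - i) x))"
    by (simp add: gconv_def ennreal_first_part)
  also have "\<dots> = (\<Sum>j\<le>n. ennreal (spitzer_term (n - j) j x))"
    by (rule sum.reindex_bij_witness[of _ "\<lambda>j. n - j" "\<lambda>j. n - j"]) auto
  also have "\<dots> = (\<Sum>j<n. ennreal (spitzer_term (n - j) j x))"
  proof -
    have "spitzer_term 0 n x = 0" by (simp add: spitzer_term_def hits_def[abs_def])
    then show ?thesis by (simp add: lessThan_Suc_atMost[symmetric])
  qed
  also have "\<dots> = ennreal (\<Sum>j<n. spitzer_term (n - j) j x)"
    by (simp add: sum_ennreal prob_nonneg)
  finally have "ennreal (real n * stay_prob n x) = ennreal (\<Sum>j<n. spitzer_term (n - j) j x)"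
    by (simp add: ennreal_stay_prob ennreal_mult ennreal_of_nat_eq_real_of_nat prob_nonneg)
  then show ?thesis
    by (subst (asm) ennreal_inj) (auto intro!: mult_nonneg_nonneg sum_nonneg prob_nonneg)
qed

lemma spitzer_term_le_below:
  assumes s: "0 \<le> s" "\<And>z. 0 < z \<Longrightarrow> z \<le> x \<Longrightarrow> walk_prob k z \<le> s"
  shows "spitzer_term k j x \<le> s * below_prob j x"
proof -
  have "conv (hits {0<..} k) (pos_walk j) x \<le> (\<integral>\<^sup>+y. ennreal s * (pos_walk j y * indicator {0<..} (x - y)) \<partial>count_space UNIV)"
    unfolding conv_commute[of "hits {0<..} k"] unfolding conv_def
  proof (intro nn_integral_mono)
    fix y
    show "pos_walk j y * hits {0<..} k (x - y) \<le> ennreal s * (pos_walk j y * indicator {0<..} (x - y))"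
    proof (cases "y < 0 \<or> x - y \<le> 0 \<or> k = 0")
      case True
      then show ?thesis using pos_walk_support[of y j] by (auto simp: hits_def)
    next
      case False
      then have "free k (x - y) \<le> ennreal s"
        unfolding ennreal_walk_prob by (intro ennreal_leI s(2)) auto
      then show ?thesis
        using False by (simp add: hits_def mult.commute[of "ennreal s"] mult_left_mono)
    qed
  qed
  also have "\<dots> = ennreal (s * below_prob j x)"
    using s(1) by (simp add: nn_integral_cmult conv_def[symmetric] pos_walk_below_def[symmetric]
        ennreal_below_prob ennreal_mult prob_nonneg)
  finally show ?thesis
    using s(1) by (simp add: ennreal_first_part prob_nonneg)
qed

lemma spitzer_term_le:
  assumes s: "\<And>y. 0 \<le> y \<Longrightarrow> y < x \<Longrightarrow> stay_prob j y \<le> s" and x: "0 < x"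
  shows "spitzer_term k j x \<le> s"
proof -
  have s0: "0 \<le> s" using s[of 0] x prob_nonneg(1)[of j 0] by linarith
  have "conv (hits {0<..} k) (pos_walk j) x \<le> (\<integral>\<^sup>+z. hits {0<..} k z * ennreal s \<partial>count_space UNIV)"
    unfolding conv_def
  proof (intro nn_integral_mono)
    fix z
    show "hits {0<..} k z * pos_walk j (x - z) \<le> hits {0<..} k z * ennreal s"
    proof (cases "0 < z \<and> 0 \<le> x - z")
      case True
      then show ?thesis
        unfolding ennreal_stay_prob by (intro mult_left_mono ennreal_leI s) auto
    next
      case False
      then show ?thesis using pos_walk_support[of "x - z" j] by (auto simp: hits_def)
    qed
  qed
  also have "\<dots> = mass (hits {0<..} k) * ennreal s" by (simp add: nn_integral_multc mass_def)
  also have "\<dots> \<le> 1 * ennreal s" by (intro mult_right_mono mass_hits_le_1) auto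
  finally show ?thesis using s0 by (simp add: ennreal_first_part)
qed

end

text \<open>
The hypotheses together with the continuous density of the limit.
\<close>
locale stable_walk_density = stable_walk +
  fixes g :: "real \<Rightarrow> real"
  assumes density: "stable_density \<alpha> \<beta> \<kappa> g"
begin

abbreviation limit_law :: "real measure" where
  "limit_law \<equiv> density lborel (\<lambda>x. ennreal (g x))"

lemma limit_law_dist: "real_distribution limit_law" and char_limit_law: "char limit_law = G"
  and g_cont: "continuous_on UNIV g" and g_nonneg: "0 \<le> g x"
  using density by (auto simp: stable_density_def stable_law_def)

lemma g_measurable [measurable]: "g \<in> borel_measurable borel"
  using g_cont by (rule borel_measurable_continuous_onI)

lemma \<gamma>_eq: "\<gamma> = g 0"
proof -
  have "complex_of_real (g 0) = 1 / (2 * pi) * (CLBINT t. G t)"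
    using density_at_0_inversion[OF g_cont g_nonneg limit_law_dist] G_integrable(1)
    unfolding char_limit_law by simp
  then have "Re (complex_of_real (g 0)) = Re (1 / (2 * pi) * (CLBINT t. G t))" by (rule arg_cong)
  then show ?thesis by (simp add: \<gamma>_def Re_divide_of_real)
qed

lemma g0_pos: "0 < g 0"
proof -
  have "1 \<le> \<alpha> \<or> \<bar>\<beta>\<bar> < 1" using params by (auto simp: stable_params_def)
  then have "0 < Re (CLBINT t. G t)"
    by (intro integral_stable_char_pos alpha_pos kappa_pos G_integrable)
  then show ?thesis by (simp add: \<gamma>_eq[symmetric] \<gamma>_def)
qed

lemma limit_law_pos: "0 < measure limit_law {0<..}"
proof -
  interpret L: real_distribution limit_law by (rule limit_law_dist)
  have "isCont g 0" using g_cont by (simp add: continuous_on_eq_continuous_at)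
  then have "eventually (\<lambda>x. 0 < g x) (nhds 0)"
    using g0_pos by (intro order_tendstoD) (auto simp: isCont_def tendsto_at_iff_tendsto_nhds)
  then obtain e where e: "0 < e" "\<And>x. \<bar>x\<bar> < e \<Longrightarrow> 0 < g x"
    by (auto simp: eventually_nhds_metric dist_real_def)
  have "emeasure limit_law {0<..} \<noteq> 0"
  proof
    assume "emeasure limit_law {0<..} = 0"
    then have "(\<integral>\<^sup>+x. ennreal (g x) * indicator {0<..} x \<partial>lborel) = 0"
      by (subst (asm) emeasure_density) auto
    then have "AE x in lborel. ennreal (g x) * indicator {0<..} x = 0"
      by (subst (asm) nn_integral_0_iff_AE) auto
    then have "AE x in lborel. x \<notin> {0<..<e}"
    proof eventually_elim
      case (elim x)
      then show ?case using e(2)[of x] by (auto simp: indicator_def ennreal_eq_0_iff split: if_splits)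
    qed
    then have "emeasure lborel {0<..<e} = 0"
      by (subst (asm) AE_iff_measurable[of "{0<..<e}"]) auto
    then show False using e(1) by simp
  qed
  then show ?thesis by (simp add: L.emeasure_eq_measure zero_less_measure_iff)
qed

text \<open>
The limit law charges the positive half-line, because its density is positive at 0, and has no
atom at 0. This is what makes the walk oscillate upwards and the ladder height well defined.
\<close>
lemma prob_walk_pos_bounded_below:
  "\<exists>r>0. \<exists>k. \<forall>n\<ge>k. r \<le> prob {\<omega>\<in>space M. 0 < walk X n \<omega>}"
proof -
  interpret L: real_distribution limit_law by (rule limit_law_dist)
  obtain L' where L': "stable_law \<alpha> \<beta> \<kappa> L'"
    and conv: "weak_conv_m (\<lambda>n. distr M borel (\<lambda>\<omega>. walk X n \<omega> / c n)) L'"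
    using attracted by (auto simp: attracted_def)
  have "L' = limit_law"
    using L' limit_law_dist char_limit_law by (intro Levy_uniqueness) (auto simp: stable_law_def)
  have "measure limit_law {0} = 0"
  proof -
    have "emeasure limit_law {0} = (\<integral>\<^sup>+y. ennreal (g y) * indicator {0} y \<partial>lborel)"
      by (rule emeasure_density) auto
    also have "\<dots> = (\<integral>\<^sup>+(y::real). 0 \<partial>lborel)"
      by (rule nn_integral_cong_AE)
         (use AE_lborel_singleton[of "0::real"] in \<open>auto elim!: eventually_mono simp: indicator_def\<close>)
    finally show ?thesis by (simp add: measure_def)
  qed
  then have "isCont (cdf limit_law) 0" by (simp add: L.isCont_cdf)
  then have "(\<lambda>n. cdf (distr M borel (\<lambda>\<omega>. walk X n \<omega> / c n)) 0) \<longlonglongrightarrow> cdf limit_law 0"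
    using conv by (simp add: weak_conv_m_def weak_conv_def \<open>L' = limit_law\<close>)
  then have lim: "(\<lambda>n. 1 - cdf (distr M borel (\<lambda>\<omega>. walk X n \<omega> / c n)) 0) \<longlonglongrightarrow> 1 - cdf limit_law 0"
    by (intro tendsto_intros)
  have compl: "1 - cdf D 0 = measure D {0<..}" if D: "real_distribution D" for D
  proof -
    interpret D: real_distribution D by fact
    have "measure D (space D - {..0}) = 1 - measure D {..0}" by (rule D.prob_compl) simp
    moreover have "space D - {..0} = {0<..}" by auto
    ultimately show ?thesis by (simp add: cdf_def)
  qed
  have eq: "1 - cdf (distr M borel (\<lambda>\<omega>. walk X n \<omega> / c n)) 0 = prob {\<omega>\<in>space M. 0 < walk X n \<omega>}"
    if n: "n \<ge> 1" for n
  proof -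
    have "real_distribution (distr M borel (\<lambda>\<omega>. walk X n \<omega> / c n))"
      by (intro real_distribution.intro prob_space_distr real_distribution_axioms.intro) auto
    then have "1 - cdf (distr M borel (\<lambda>\<omega>. walk X n \<omega> / c n)) 0
        = measure (distr M borel (\<lambda>\<omega>. walk X n \<omega> / c n)) {0<..}"
      by (rule compl)
    also have "\<dots> = prob ((\<lambda>\<omega>. walk X n \<omega> / c n) -` {0<..} \<inter> space M)"
      by (rule measure_distr) auto
    also have "(\<lambda>\<omega>. walk X n \<omega> / c n) -` {0<..} \<inter> space M = {\<omega>\<in>space M. 0 < walk X n \<omega>}"
      using c_pos[OF n] by (auto simp: zero_less_divide_iff)
    finally show ?thesis .
  qed
  define r where "r = measure limit_law {0<..} / 2"
  have r: "0 < r" "r < 1 - cdf limit_law 0"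
    using limit_law_pos compl[OF limit_law_dist] by (auto simp: r_def)
  have "eventually (\<lambda>n. r < 1 - cdf (distr M borel (\<lambda>\<omega>. walk X n \<omega> / c n)) 0) sequentially"
    using lim r(2) by (rule order_tendstoD)
  then have "eventually (\<lambda>n. r \<le> prob {\<omega>\<in>space M. 0 < walk X n \<omega>}) sequentially"
    using eventually_ge_at_top[of 1] by eventually_elim (simp add: eq)
  then show ?thesis using r(1) by (auto simp: eventually_sequentially)
qed

abbreviation H :: "real \<Rightarrow> real" where
  "H \<equiv> renewal M X"

lemma H_eq: "ennreal (H x) = pos_potential x"
  using prob_walk_pos_bounded_below renewal_eq_potential(1) by metis

lemma H_ge_1: assumes x: "0 < x" shows "1 \<le> H x"
proof -
  have "(\<Sum>n\<in>{0}. pos_walk_below n x) \<le> pos_potential x"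
    unfolding pos_potential_def by (intro sum_le_suminf) auto
  moreover have "pos_walk_below 0 x = 1" using x by (simp add: pos_walk_below_def)
  ultimately have "ennreal 1 \<le> ennreal (H x)" by (simp add: H_eq)
  then show ?thesis by (simp add: ennreal_le_iff2)
qed

lemma below_prob_sums:
  assumes x: "0 < x" shows "(\<lambda>j. below_prob j x) sums H x"
proof -
  have "(\<lambda>j. ennreal (below_prob j x)) sums ennreal (H x)"
    unfolding H_eq pos_potential_def ennreal_below_prob[symmetric] by (rule summable_sums) simp
  then show ?thesis using H_ge_1[OF x] by (simp add: prob_nonneg)
qed

lemma H_mono: assumes "0 < x" "x \<le> y" shows "H x \<le> H y"
proof -
  have "pos_potential x \<le> pos_potential y"
    unfolding pos_potential_def pos_walk_below_def
    unfolding conv_def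
    using assms by (intro suminf_le nn_integral_mono mult_left_mono) (auto simp: indicator_def)
  then have "ennreal (H x) \<le> ennreal (H y)" by (simp add: H_eq)
  then show ?thesis using H_ge_1[of y] assms by (simp add: ennreal_le_iff)
qed

text \<open>
The three-part decomposition of \<open>pos_walk_le_potential\<close> with m = n div 3 and the concentration bound
P(S(m) = z) \<le> C / c(m). For n \<le> 2 the trivial bounds 1 and H \<ge> 1 suffice.
\<close>
theorem stay_prob_bound:
  "\<exists>C>0. \<forall>n\<ge>1. \<forall>x>0. real n * c n * stay_prob n x \<le> C * H x"
proof -
  obtain C where C: "0 < C" "\<And>n x. n \<ge> 1 \<Longrightarrow> c n * walk_prob n x \<le> C"
    using concentration unfolding walk_prob_eq by blast
  define p where "p = doubling_exponent"
  \<comment> \<open>the first summand is for n \<ge> 3, where \<open>n \<le> 3 (m + 1)\<close> and \<open>n \<le> 5 m\<close>; the second one is for n \<le> 2\<close>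
  define C1 where "C1 = 3 * 10 ^ p * C + 2 * c 2"
  have c2: "0 < c 2" by (rule c_pos) simp
  have "real n * c n * stay_prob n x \<le> C1 * H x" if n: "n \<ge> 1" and x: "0 < x" for n x
  proof (cases "n \<ge> 3")
    case True
    define m where "m = n div 3"
    define l where "l = n - 2 * m"
    have m: "1 \<le> m" "m \<le> l" "n = 2 * m + l" "n \<le> 3 * (m + 1)"
      using True by (auto simp: m_def l_def)
    have m5: "n \<le> 5 * m" using True unfolding m_def by presburger
    have cm: "0 < c m" by (rule c_pos[OF m(1)])
    have "free m z \<le> ennreal (C / c m)" for z
      unfolding ennreal_walk_prob using C(2)[OF m(1), of z] cm by (intro ennreal_leI) (simp add: field_simps)
    then have "of_nat (m + 1) * pos_walk (2 * m + l) x \<le> ennreal (C / c m) * pos_potential x"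
      using m by (intro pos_walk_le_potential) auto
    moreover have "of_nat (m + 1) * pos_walk (2 * m + l) x = ennreal (real (m + 1) * stay_prob n x)"
      unfolding ennreal_stay_prob m(3)[symmetric] ennreal_of_nat_eq_real_of_nat
      by (rule ennreal_mult[symmetric]) (auto simp: prob_nonneg)
    moreover have "ennreal (C / c m) * pos_potential x = ennreal (C / c m * H x)"
      unfolding H_eq[symmetric] using C(1) cm H_ge_1[OF x] by (intro ennreal_mult[symmetric]) auto
    ultimately have "ennreal (real (m + 1) * stay_prob n x) \<le> ennreal (C / c m * H x)" by simp
    then have 1: "real (m + 1) * stay_prob n x \<le> C / c m * H x"
      using C(1) cm H_ge_1[OF x] by (subst (asm) ennreal_le_iff) auto
    have cn: "c n \<le> 10 ^ p * c m"
      using c_le_power[OF m(1) m5 n] by (simp add: p_def)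
    have "real n * c n * stay_prob n x \<le> (3 * real (m + 1)) * (10 ^ p * c m) * stay_prob n x"
    proof (intro mult_right_mono mult_mono)
      show "real n \<le> 3 * real (m + 1)" using m(4) by linarith
    qed (use cn c_pos[OF n] prob_nonneg in auto)
    also have "\<dots> = 3 * 10 ^ p * c m * (real (m + 1) * stay_prob n x)" by simp
    also have "\<dots> \<le> 3 * 10 ^ p * c m * (C / c m * H x)"
      using cm by (intro mult_left_mono 1) auto
    also have "\<dots> = 3 * 10 ^ p * C * H x" using cm by simp
    also have "\<dots> \<le> C1 * H x" using c2 H_ge_1[OF x] by (simp add: C1_def algebra_simps)
    finally show ?thesis .
  next
    case False
    then have "n \<le> 2" by simp
    then have "real n * c n * stay_prob n x \<le> 2 * c 2 * 1"
      using n c_mono[of n 2] c_pos[OF n] c2 stay_prob_le_1 prob_nonneg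
      by (intro mult_mono mult_nonneg_nonneg) auto
    also have "\<dots> \<le> C1 * H x"
      using c2 C(1) H_ge_1[OF x] by (intro mult_mono) (auto simp: C1_def)
    finally show ?thesis .
  qed
  moreover have "0 < C1" using C(1) c2 by (simp add: C1_def add_pos_pos)
  ultimately show ?thesis by blast
qed

lemma stay_prob_le_below:
  assumes C: "0 < C" "\<And>n x. n \<ge> 1 \<Longrightarrow> 0 < x \<Longrightarrow> real n * c n * stay_prob n x \<le> C * H x"
    and j: "1 \<le> j" and x: "0 < x" and y: "y \<le> x"
  shows "stay_prob j y \<le> C * H x / (real j * c j)"
proof (cases "0 < y")
  case True
  have "real j * c j * stay_prob j y \<le> C * H x"
    using C(2)[OF j True] mult_left_mono[OF H_mono[OF True y], of C] C(1) by linarith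
  then show ?thesis using j c_pos[OF j] by (simp add: field_simps)
next
  case False
  then show ?thesis
    using stay_prob_nonpos[OF j, of y] C(1) H_ge_1[OF x] c_pos[OF j] by simp
qed

lemma lattice_points_card:
  assumes x: "0 \<le> x"
  shows "finite (lattice_points h s \<inter> {0..<x})" "real (card (lattice_points h s \<inter> {0..<x})) \<le> x / h + 1"
proof -
  define A where "A = {k::int. 0 \<le> s + of_int k * h \<and> s + of_int k * h < x}"
  have eq: "lattice_points h s \<inter> {0..<x} = (\<lambda>k. s + of_int k * h) ` A"
    by (auto simp: lattice_points_def A_def)
  have "A = {\<lceil>- s / h\<rceil>..<\<lceil>(x - s) / h\<rceil>}"
    using span_pos by (auto simp: A_def ceiling_le_iff less_ceiling_iff field_simps)
  moreover have "real (nat (\<lceil>(x - s) / h\<rceil> - \<lceil>- s / h\<rceil>)) \<le> x / h + 1"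
  proof -
    have "(x - s) / h = x / h + - s / h" by (simp add: diff_divide_distrib)
    then have "of_int (\<lceil>(x - s) / h\<rceil> - \<lceil>- s / h\<rceil>) \<le> x / h + 1" by linarith
    then show ?thesis using x span_pos by (cases "0 \<le> \<lceil>(x - s) / h\<rceil> - \<lceil>- s / h\<rceil>") auto
  qed
  ultimately show "finite (lattice_points h s \<inter> {0..<x})" "real (card (lattice_points h s \<inter> {0..<x})) \<le> x / h + 1"
    unfolding eq by (auto intro!: order.trans[OF of_nat_mono[OF card_image_le]])
qed

lemma below_prob_le:
  assumes x: "0 < x" and s: "\<And>y. 0 \<le> y \<Longrightarrow> y < x \<Longrightarrow> stay_prob j y \<le> s"
  shows "below_prob j x \<le> s * (x / h + 1)"
proof -
  let ?A = "lattice_points h (a * real j) \<inter> {0..<x}"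
  have s0: "0 \<le> s" using s[of 0] x prob_nonneg(1)[of j 0] by linarith
  note A = lattice_points_card[OF less_imp_le[OF x], of "a * real j"]
  have "pos_walk_below j x \<le> (\<integral>\<^sup>+y. ennreal s * indicator ?A y \<partial>count_space UNIV)"
    unfolding pos_walk_below_def conv_def
  proof (intro nn_integral_mono)
    fix y
    have "pos_walk j y = 0" if "y \<notin> lattice_points h (a * real j)"
      using stay_le_free[of "{0<..}" j y] free_eq_0[OF that] by simp
    then show "pos_walk j y * indicator {0<..} (x - y) \<le> ennreal s * indicator ?A y"
      using pos_walk_support[of y j] s[of y]
      by (cases "y \<in> ?A") (auto simp: indicator_def ennreal_stay_prob not_le intro: ennreal_leI)
  qed
  also have "\<dots> = ennreal s * of_nat (card ?A)"
    using A(1) by (simp add: nn_integral_cmult)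
  also have "\<dots> = ennreal (s * real (card ?A))"
    using s0 by (simp add: ennreal_mult ennreal_of_nat_eq_real_of_nat)
  finally have "below_prob j x \<le> s * real (card ?A)"
    using s0 by (simp add: ennreal_below_prob)
  also have "\<dots> \<le> s * (x / h + 1)" using A(2) s0 by (intro mult_left_mono)
  finally show ?thesis .
qed

lemma spitzer_term_ge_below:
  assumes x: "x \<in> lattice_points h (a * real (k + j))" and k: "1 \<le> k"
    and s: "0 \<le> s" "\<And>z. 0 < z \<Longrightarrow> z \<le> x \<Longrightarrow> z \<in> lattice_points h (a * real k) \<Longrightarrow> s \<le> walk_prob k z"
  shows "s * below_prob j x \<le> spitzer_term k j x"
proof -
  have "(\<integral>\<^sup>+y. ennreal s * (pos_walk j y * indicator {0<..} (x - y)) \<partial>count_space UNIV)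
      \<le> conv (hits {0<..} k) (pos_walk j) x"
    unfolding conv_commute[of "hits {0<..} k"] unfolding conv_def
  proof (intro nn_integral_mono)
    fix y
    show "ennreal s * (pos_walk j y * indicator {0<..} (x - y)) \<le> pos_walk j y * hits {0<..} k (x - y)"
    proof (cases "y < 0 \<or> x - y \<le> 0 \<or> y \<notin> lattice_points h (a * real j)")
      case True
      then have "pos_walk j y = 0 \<or> x - y \<le> 0"
        using pos_walk_support[of y j] stay_le_free[of "{0<..}" j y] free_eq_0[of y j] by auto
      then show ?thesis by auto
    next
      case False
      obtain i l :: int where "x = a * real (k + j) + of_int i * h" "y = a * real j + of_int l * h"
        using x False by (auto simp: lattice_points_def)
      then have "x - y = a * real k + of_int (i - l) * h" by (simp add: algebra_simps)
      then have "x - y \<in> lattice_points h (a * real k)" unfolding lattice_points_def by blast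
      then have "ennreal s \<le> free k (x - y)"
        unfolding ennreal_walk_prob using False by (intro ennreal_leI s(2)) auto
      then show ?thesis
        using False k by (simp add: hits_def mult.commute[of "ennreal s"] mult_left_mono)
    qed
  qed
  moreover have "(\<integral>\<^sup>+y. ennreal s * (pos_walk j y * indicator {0<..} (x - y)) \<partial>count_space UNIV)
      = ennreal (s * below_prob j x)"
    using s(1) by (simp add: nn_integral_cmult conv_def[symmetric] pos_walk_below_def[symmetric]
        ennreal_below_prob ennreal_mult prob_nonneg)
  ultimately show ?thesis
    by (simp add: ennreal_first_part prob_nonneg)
qed

text \<open>
At time j there are at most x / h + 1 lattice points below x, and each carries at most
C H(x) / (j c(j)) by the a priori bound; the sum over j converges by \<open>sum_inverse_c\<close>.
\<close>
theorem below_prob_tail: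
  "\<exists>D m1. 1 \<le> m1 \<and> 0 < D \<and> (\<forall>m\<ge>m1. \<forall>N. \<forall>x>0. (\<Sum>j\<in>{m..<N}. below_prob j x) \<le> D * H x * (x / h + 1) / c m)"
proof -
  obtain C where C: "0 < C" "\<And>n x. n \<ge> 1 \<Longrightarrow> 0 < x \<Longrightarrow> real n * c n * stay_prob n x \<le> C * H x"
    using stay_prob_bound by blast
  obtain D m1 where D: "1 \<le> m1" "0 < D" "\<And>m N. m \<ge> m1 \<Longrightarrow> (\<Sum>j\<in>{m..<N}. 1 / (real j * c j)) \<le> D / c m"
    using sum_inverse_c by blast
  have "(\<Sum>j\<in>{m..<N}. below_prob j x) \<le> (C * D) * H x * (x / h + 1) / c m" if m: "m \<ge> m1" and x: "0 < x" for m N x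
  proof -
    have xh: "0 \<le> x / h + 1" using x span_pos by simp
    have "(\<Sum>j\<in>{m..<N}. below_prob j x) \<le> (\<Sum>j\<in>{m..<N}. C * H x * (x / h + 1) * (1 / (real j * c j)))"
    proof (rule sum_mono)
      fix j assume "j \<in> {m..<N}"
      then have j: "1 \<le> j" using m D(1) by simp
      have "below_prob j x \<le> C * H x / (real j * c j) * (x / h + 1)"
        using x by (intro below_prob_le stay_prob_le_below[OF C] j) auto
      then show "below_prob j x \<le> C * H x * (x / h + 1) * (1 / (real j * c j))" by simp
    qed
    also have "\<dots> = C * H x * (x / h + 1) * (\<Sum>j\<in>{m..<N}. 1 / (real j * c j))"
      by (simp only: sum_distrib_left)
    also have "\<dots> \<le> C * H x * (x / h + 1) * (D / c m)"
      using C(1) H_ge_1[OF x] xh by (intro mult_left_mono D(3) m mult_nonneg_nonneg) auto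
    finally show ?thesis by (simp add: mult.commute mult.left_commute)
  qed
  then show ?thesis using C(1) D by (intro exI[of _ "C * D"] exI[of _ m1]) auto
qed

end

section \<open>Asymptotics of the local probabilities\<close>

text \<open>
Here A stands for h g(0). The two bounds collect the errors of the final estimate: \<eta> is the error of
the local limit theorem, the relative error of c(k) / c(n), the tail of the potential, and the
contribution of each of the two remaining groups of terms.
\<close>
lemma exists_small_parameter:
  fixes A :: real
  assumes "0 < A" "0 < e"
  shows "\<exists>\<eta>. 0 < \<eta> \<and> \<eta> < 1 / 2 \<and> \<eta> < A \<and> (A + \<eta>) / (1 - \<eta>) + 2 * \<eta> \<le> A + e \<and> A - e \<le> (A - \<eta>) * (1 - \<eta>)"
proof -
  have "((\<lambda>\<eta>. (A + \<eta>) / (1 - \<eta>) + 2 * \<eta>) \<longlongrightarrow> (A + 0) / (1 - 0) + 2 * 0) (at_right 0)"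
    by (intro tendsto_intros) auto
  then have "eventually (\<lambda>\<eta>. (A + \<eta>) / (1 - \<eta>) + 2 * \<eta> < A + e) (at_right 0)"
    using assms by (intro order_tendstoD) auto
  moreover have "((\<lambda>\<eta>. (A - \<eta>) * (1 - \<eta>)) \<longlongrightarrow> (A - 0) * (1 - 0)) (at_right 0)"
    by (intro tendsto_intros)
  then have "eventually (\<lambda>\<eta>. A - e < (A - \<eta>) * (1 - \<eta>)) (at_right 0)"
    using assms by (intro order_tendstoD) auto
  moreover have "eventually (\<lambda>\<eta>. \<eta> \<in> {0<..<min A (1 / 2)}) (at_right (0::real))"
    using assms by (intro eventually_at_right_real) auto
  ultimately have "eventually (\<lambda>\<eta>. 0 < \<eta> \<and> \<eta> < 1 / 2 \<and> \<eta> < A \<and> (A + \<eta>) / (1 - \<eta>) + 2 * \<eta> \<le> A + e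
      \<and> A - e \<le> (A - \<eta>) * (1 - \<eta>)) (at_right 0)"
    by eventually_elim auto
  then show ?thesis by (rule eventually_happens'[rotated]) simp
qed

context stable_walk_density
begin

text \<open>
In n b(n, x) = sum over j < n of \<open>spitzer_term (n - j) j x\<close>, three groups of j are treated
differently, with m about \<epsilon> n. For j < m the local limit theorem applies to the other n - j steps and
the terms add up to about h g(0) H(x) / c(n). For j between m and n - m, the concentration bound for
n - j \<ge> m steps leaves a tail of the potential. For the m largest j, the a priori bound at time j
gives C H(x) / (n c(n)) for each term, hence \<epsilon> C H(x) / c(n) together.
\<close>
theorem stay_prob_asymptotics:
  assumes \<delta>: "\<delta> \<longlonglongrightarrow> 0" and e: "0 < e"
  shows "\<forall>\<^sub>F n in sequentially. \<forall>x. 0 < x \<and> x \<le> \<delta> n * c n \<and> x \<in> lattice_points h (a * real n) \<longrightarrow>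
    \<bar>real n * c n * stay_prob n x - h * g 0 * H x\<bar> \<le> e * H x"
proof -
  define A where "A = h * g 0"
  have A: "0 < A" using span_pos g0_pos by (simp add: A_def)
  obtain \<eta> where \<eta>: "0 < \<eta>" "\<eta> < 1 / 2" "\<eta> < A"
    and \<eta>_up: "(A + \<eta>) / (1 - \<eta>) + 2 * \<eta> \<le> A + e" and \<eta>_low: "A - e \<le> (A - \<eta>) * (1 - \<eta>)"
    using exists_small_parameter[OF A e] by blast
  obtain r K where r: "r \<longlonglongrightarrow> 0" and K: "0 \<le> K"
    and llt: "\<And>n x. n \<ge> 1 \<Longrightarrow> x \<in> lattice_points h (a * real n) \<Longrightarrow>
      \<bar>c n * walk_prob n x - A\<bar> \<le> r n + K * (\<bar>x\<bar> / c n)"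
    using local_limit unfolding \<gamma>_eq A_def walk_prob_eq by blast
  obtain C where C: "0 < C" "\<And>n x. n \<ge> 1 \<Longrightarrow> c n * walk_prob n x \<le> C"
    using concentration unfolding walk_prob_eq by blast
  obtain C1 where C1: "0 < C1" "\<And>n x. n \<ge> 1 \<Longrightarrow> 0 < x \<Longrightarrow> real n * c n * stay_prob n x \<le> C1 * H x"
    using stay_prob_bound by blast
  obtain D m1 where D: "1 \<le> m1" "0 < D"
    and tail: "\<And>m N x. m \<ge> m1 \<Longrightarrow> 0 < x \<Longrightarrow> (\<Sum>j\<in>{m..<N}. below_prob j x) \<le> D * H x * (x / h + 1) / c m"
    using below_prob_tail by blast
  obtain \<epsilon>0 where \<epsilon>0: "0 < \<epsilon>0" and flat: "\<And>\<epsilon>. 0 < \<epsilon> \<Longrightarrow> \<epsilon> \<le> \<epsilon>0 \<Longrightarrow> \<epsilon> < 1 \<Longrightarrow>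
      \<forall>\<^sub>F n in sequentially. \<forall>k. (1 - \<epsilon>) * real n \<le> real k \<and> k \<le> n \<longrightarrow> (1 - \<eta>) * c n \<le> c k"
    using c_flat[OF \<eta>(1)] by blast
  define p where "p = doubling_exponent"
  \<comment> \<open>the last bound makes the m largest j contribute at most \<open>\<eta> H(x) / c(n)\<close>\<close>
  define \<epsilon> where "\<epsilon> = min (min (\<epsilon>0 / 2) (1 / 8)) (\<eta> / (4 * 4 ^ p * C1))"
  have \<epsilon>: "0 < \<epsilon>" "2 * \<epsilon> \<le> \<epsilon>0" "\<epsilon> \<le> 1 / 8" "\<epsilon> \<le> \<eta> / (4 * 4 ^ p * C1)"
    using \<epsilon>0 \<eta>(1) C1(1) by (auto simp: \<epsilon>_def)
  \<comment> \<open>\<open>n \<le> d k\<close> for all \<open>k \<ge> m n\<close>, so that \<open>c(n) \<le> B c(k)\<close> with the constant B below\<close>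
  define d where "d = nat \<lceil>1 / \<epsilon>\<rceil>"
  have d: "1 / \<epsilon> \<le> real d" unfolding d_def by linarith
  define m where "m n = nat \<lceil>\<epsilon> * real n\<rceil>" for n
  have m_ge: "\<epsilon> * real n \<le> real (m n)" for n unfolding m_def by linarith
  define B where "B = (2 * real d) ^ p"
  have B: "0 \<le> B" by (simp add: B_def)
  define t where "t n = D * B * (\<bar>\<delta> n\<bar> / h + 1 / c n)" for n
  have t: "t \<longlonglongrightarrow> 0"
  proof -
    have "(\<lambda>n. 1 / c n) \<longlonglongrightarrow> 0"
      using tendsto_inverse_0_at_top[OF c_at_top] by (simp add: inverse_eq_divide)
    then have "t \<longlonglongrightarrow> D * B * (\<bar>0\<bar> / h + 0)"
      unfolding t_def[abs_def] using span_pos by (intro tendsto_intros \<delta>) auto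
    then show ?thesis by simp
  qed
  have ev_flat: "\<forall>\<^sub>F n in sequentially. \<forall>k. (1 - 2 * \<epsilon>) * real n \<le> real k \<and> k \<le> n \<longrightarrow> (1 - \<eta>) * c n \<le> c k"
    using \<epsilon> by (intro flat) auto
  have ev_r: "\<forall>\<^sub>F n in sequentially. \<forall>k. n \<le> 2 * k \<longrightarrow> r k \<le> \<eta> / 2"
  proof -
    have "eventually (\<lambda>k. r k < \<eta> / 2) sequentially"
      using r \<eta>(1) by (intro order_tendstoD) auto
    then obtain N where N: "\<And>k. k \<ge> N \<Longrightarrow> r k < \<eta> / 2" by (auto simp: eventually_sequentially)
    show ?thesis
    proof (rule eventually_sequentiallyI[of "2 * N"], intro allI impI)
      fix n k :: nat assume "2 * N \<le> n" "n \<le> 2 * k"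
      then have "N \<le> k" by simp
      then show "r k \<le> \<eta> / 2" using N[of k] by simp
    qed
  qed
  have ev_\<delta>: "\<forall>\<^sub>F n in sequentially. K * (2 * \<bar>\<delta> n\<bar>) \<le> \<eta> / 2"
  proof -
    have "(\<lambda>n. K * (2 * \<bar>\<delta> n\<bar>)) \<longlonglongrightarrow> K * (2 * \<bar>0\<bar>)" by (intro tendsto_intros \<delta>)
    then have "\<forall>\<^sub>F n in sequentially. K * (2 * \<bar>\<delta> n\<bar>) < \<eta> / 2" using \<eta>(1) by (intro order_tendstoD) auto
    then show ?thesis by eventually_elim simp
  qed
  have ev_t: "\<forall>\<^sub>F n in sequentially. t n \<le> \<eta>" and ev_Ct: "\<forall>\<^sub>F n in sequentially. C * B * t n \<le> \<eta>"
  proof -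
    have "\<forall>\<^sub>F n in sequentially. t n < \<eta>" using t \<eta>(1) by (intro order_tendstoD) auto
    then show "\<forall>\<^sub>F n in sequentially. t n \<le> \<eta>" by eventually_elim simp
    have "(\<lambda>n. C * B * t n) \<longlonglongrightarrow> C * B * 0" by (intro tendsto_intros t)
    then have "\<forall>\<^sub>F n in sequentially. C * B * t n < \<eta>" using \<eta>(1) by (intro order_tendstoD) auto
    then show "\<forall>\<^sub>F n in sequentially. C * B * t n \<le> \<eta>" by eventually_elim simp
  qed
  have ev_n: "\<forall>\<^sub>F n in sequentially. max 1 (real m1) \<le> \<epsilon> * real n"
    using \<epsilon>(1) by real_asymp
  show ?thesis
    using ev_flat ev_r ev_\<delta> ev_t ev_Ct ev_n
  proof eventually_elim
    case (elim n)
    note flat = elim(1)[rule_format] and r_le = elim(2)[rule_format] and \<delta>_le = elim(3)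
      and t_le = elim(4) and Ct_le = elim(5)
    have \<epsilon>n: "1 \<le> \<epsilon> * real n" "real m1 \<le> \<epsilon> * real n" using elim(6) by auto
    have n: "1 \<le> n" using \<epsilon>n(1) by (cases n) auto
    have cn: "0 < c n" by (rule c_pos[OF n])
    have m_le: "real (m n) \<le> 2 * \<epsilon> * real n"
      using \<epsilon>n(1) unfolding m_def by linarith
    have m1_le: "m1 \<le> m n" using m_ge[of n] \<epsilon>n(2) by linarith
    have m1: "1 \<le> m n" using m1_le D(1) by linarith
    have "2 * \<epsilon> * real n \<le> 2 * (1 / 8) * real n" using \<epsilon>(3) by (intro mult_right_mono mult_left_mono) auto
    then have m4: "4 * m n \<le> n" using m_le by linarith
    have d_mult: "n \<le> d * k" if "m n \<le> k" for k
    proof -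
      have "real n = 1 / \<epsilon> * (\<epsilon> * real n)" using \<epsilon>(1) by simp
      also have "\<dots> \<le> real d * real k"
        using d m_ge[of n] that \<epsilon>(1) by (intro mult_mono) auto
      finally show ?thesis by (metis of_nat_le_iff of_nat_mult)
    qed
    have cB: "c n \<le> B * c k" if "m n \<le> k" for k
      unfolding B_def p_def using that m1 by (intro c_le_power d_mult n) auto
    show ?case
    proof (intro allI impI, elim conjE)
      fix x assume x: "0 < x" "x \<le> \<delta> n * c n" "x \<in> lattice_points h (a * real n)"
      have Hx: "1 \<le> H x" by (rule H_ge_1[OF x(1)])
      have \<delta>_pos: "0 < \<delta> n" using x(1,2) cn by (metis less_le_trans zero_less_mult_pos2)
      have tail_le: "(\<Sum>j\<in>{m n..<N}. below_prob j x) \<le> t n * H x" for N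
      proof -
        have cm: "0 < c (m n)" by (rule c_pos[OF m1])
        have "(\<Sum>j\<in>{m n..<N}. below_prob j x) \<le> D * H x * (x / h + 1) / c (m n)"
          by (rule tail[OF m1_le x(1)])
        also have "\<dots> \<le> D * H x * (\<delta> n * c n / h + 1) / (c n / B)"
        proof (intro frac_le mult_left_mono add_right_mono divide_right_mono x(2))
          have "B \<noteq> 0" using cB[of "m n"] cn by auto
          then show "0 < c n / B" using cn B by simp
          then show "c n / B \<le> c (m n)" using cB[of "m n"] B \<open>B \<noteq> 0\<close> by (simp add: field_simps)
        qed (use D(2) Hx span_pos \<delta>_pos cn in \<open>auto intro!: mult_nonneg_nonneg add_nonneg_nonneg\<close>)
        also have "\<dots> = t n * H x"
          using cn \<delta>_pos span_pos by (simp add: t_def field_simps)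
        finally show ?thesis .
      qed
      have partial: "(\<Sum>j<m n. below_prob j x) \<le> H x"
      proof -
        have "(\<Sum>j<m n. below_prob j x) \<le> (\<Sum>j. below_prob j x)"
          using sums_summable[OF below_prob_sums[OF x(1)]] prob_nonneg(2) by (intro sum_le_suminf) auto
        then show ?thesis using sums_unique[OF below_prob_sums[OF x(1)]] by simp
      qed
      have partial_ge: "(1 - \<eta>) * H x \<le> (\<Sum>j<m n. below_prob j x)"
      proof -
        have "H x \<le> (\<Sum>j<m n. below_prob j x) + t n * H x"
        proof (rule LIMSEQ_le_const2)
          show "(\<lambda>N. \<Sum>j<N. below_prob j x) \<longlonglongrightarrow> H x"
            using below_prob_sums[OF x(1)] by (simp add: sums_def)
          have "(\<Sum>j<N. below_prob j x) \<le> (\<Sum>j<m n. below_prob j x) + t n * H x" if "N \<ge> m n" for N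
          proof -
            have "(\<Sum>j<N. below_prob j x) = (\<Sum>j<m n. below_prob j x) + (\<Sum>j\<in>{m n..<N}. below_prob j x)"
              using sum.atLeastLessThan_concat[of 0 "m n" N "\<lambda>j. below_prob j x"] that
              by (simp add: atLeast0LessThan)
            then show ?thesis using tail_le[of N] by simp
          qed
          then show "\<exists>N0. \<forall>N\<ge>N0. (\<Sum>j<N. below_prob j x) \<le> (\<Sum>j<m n. below_prob j x) + t n * H x" by blast
        qed
        moreover have "t n * H x \<le> \<eta> * H x" using t_le Hx by (intro mult_right_mono) auto
        ultimately show ?thesis by (simp add: algebra_simps)
      qed
      let ?T = "\<lambda>j. spitzer_term (n - j) j x"
      \<comment> \<open>times j below \<open>m n\<close>: the local limit theorem applies to the remaining n - j steps\<close>
      have near: "(A - \<eta>) / c n \<le> walk_prob k z" "walk_prob k z \<le> (A + \<eta>) / ((1 - \<eta>) * c n)"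
        if k: "n - m n < k" "k \<le> n" and z: "0 < z" "z \<le> x" "z \<in> lattice_points h (a * real k)" for k z
      proof -
        have "real n - 2 * \<epsilon> * real n \<le> real k" using k(1) m_le by linarith
        then have flat_k: "(1 - \<eta>) * c n \<le> c k" using k(2) by (intro flat) (simp add: algebra_simps)
        have k1: "1 \<le> k" using k(1) by simp
        have ck: "0 < c k" "c k \<le> c n" using k1 k(2) by (auto intro: c_pos c_mono)
        have "c n \<le> 2 * c k"
        proof -
          have "1 / 2 * c n \<le> (1 - \<eta>) * c n" using \<eta>(2) cn by (intro mult_right_mono) auto
          then show ?thesis using flat_k by linarith
        qed
        then have "\<delta> n * c n \<le> \<delta> n * (2 * c k)" using \<delta>_pos by (intro mult_left_mono) auto
        then have "z \<le> 2 * \<bar>\<delta> n\<bar> * c k" using z x(2) \<delta>_pos by linarith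
        then have "\<bar>z\<bar> / c k \<le> 2 * \<bar>\<delta> n\<bar>" using z ck by (simp add: pos_divide_le_eq)
        then have "K * (\<bar>z\<bar> / c k) \<le> \<eta> / 2" using mult_left_mono[of "\<bar>z\<bar> / c k" "2 * \<bar>\<delta> n\<bar>" K] K \<delta>_le by linarith
        moreover have "r k \<le> \<eta> / 2" using k m4 by (intro r_le) linarith
        ultimately have near: "\<bar>c k * walk_prob k z - A\<bar> \<le> \<eta>" using llt[OF k1 z(3)] by linarith
        have "A - \<eta> \<le> c k * walk_prob k z" using near by linarith
        also have "\<dots> \<le> c n * walk_prob k z" using ck prob_nonneg by (intro mult_right_mono) auto
        finally show "(A - \<eta>) / c n \<le> walk_prob k z" using cn by (simp add: pos_divide_le_eq mult.commute)
        have "(1 - \<eta>) * c n * walk_prob k z \<le> c k * walk_prob k z"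
          using flat_k prob_nonneg by (intro mult_right_mono) auto
        also have "\<dots> \<le> A + \<eta>" using near by linarith
        finally show "walk_prob k z \<le> (A + \<eta>) / ((1 - \<eta>) * c n)"
          using cn \<eta>(2) by (simp add: pos_le_divide_eq mult.commute)
      qed
      have early_up: "(\<Sum>j<m n. ?T j) \<le> (A + \<eta>) / (1 - \<eta>) * H x / c n"
      proof -
        define s where "s = (A + \<eta>) / ((1 - \<eta>) * c n)"
        have s: "0 \<le> s" using A \<eta> cn by (simp add: s_def)
        have "(\<Sum>j<m n. ?T j) \<le> (\<Sum>j<m n. s * below_prob j x)"
        proof (intro sum_mono spitzer_term_le_below s)
          fix j z assume j: "j \<in> {..<m n}" and z: "0 < z" "z \<le> x"
          show "walk_prob (n - j) z \<le> s"
          proof (cases "z \<in> lattice_points h (a * real (n - j))")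
            case True
            show ?thesis unfolding s_def by (rule near(2)[OF _ _ z True]) (use j m4 in auto)
          next
            case False
            then show ?thesis using free_eq_0[OF False] s by (simp add: walk_prob_def)
          qed
        qed
        also have "\<dots> = s * (\<Sum>j<m n. below_prob j x)" by (simp add: sum_distrib_left)
        also have "\<dots> \<le> s * H x" using s partial by (intro mult_left_mono)
        finally show ?thesis by (simp add: s_def)
      qed
      have early_low: "(A - \<eta>) * (1 - \<eta>) * H x / c n \<le> (\<Sum>j<m n. ?T j)"
      proof -
        define s where "s = (A - \<eta>) / c n"
        have s: "0 \<le> s" using \<eta>(3) cn by (simp add: s_def)
        have "(A - \<eta>) * (1 - \<eta>) * H x / c n = s * ((1 - \<eta>) * H x)" by (simp add: s_def)
        also have "\<dots> \<le> s * (\<Sum>j<m n. below_prob j x)" using s partial_ge by (intro mult_left_mono)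
        also have "\<dots> = (\<Sum>j<m n. s * below_prob j x)" by (simp add: sum_distrib_left)
        also have "\<dots> \<le> (\<Sum>j<m n. ?T j)"
        proof (intro sum_mono spitzer_term_ge_below s)
          fix j assume j: "j \<in> {..<m n}"
          then have "n - j + j = n" using m4 by simp
          then show "x \<in> lattice_points h (a * real (n - j + j))" using x(3) by simp
          show "1 \<le> n - j" using j m4 by simp
          show "s \<le> walk_prob (n - j) z" if z: "0 < z" "z \<le> x" "z \<in> lattice_points h (a * real (n - j))" for z
            unfolding s_def by (rule near(1)[OF _ _ z]) (use j m4 in auto)
        qed
        finally show ?thesis .
      qed
      have middle: "(\<Sum>j\<in>{m n..<n - m n}. ?T j) \<le> \<eta> * H x / c n"
      proof -
        define s where "s = C * B / c n"
        have s: "0 \<le> s" using C(1) B cn by (simp add: s_def)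
        have "(\<Sum>j\<in>{m n..<n - m n}. ?T j) \<le> (\<Sum>j\<in>{m n..<n - m n}. s * below_prob j x)"
        proof (intro sum_mono spitzer_term_le_below s)
          fix j z assume j: "j \<in> {m n..<n - m n}"
          then have k: "m n \<le> n - j" "1 \<le> n - j" using m1 by auto
          have "c n * walk_prob (n - j) z \<le> B * c (n - j) * walk_prob (n - j) z"
            using cB[OF k(1)] prob_nonneg by (intro mult_right_mono) auto
          also have "\<dots> \<le> B * C"
            using mult_left_mono[OF C(2)[OF k(2), of z] B] by (simp add: mult.assoc)
          finally show "walk_prob (n - j) z \<le> s" using cn by (simp add: s_def pos_le_divide_eq mult.commute)
        qed
        also have "\<dots> = s * (\<Sum>j\<in>{m n..<n - m n}. below_prob j x)" by (simp add: sum_distrib_left)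
        also have "\<dots> \<le> s * (t n * H x)" using s by (intro mult_left_mono tail_le)
        also have "\<dots> = (C * B * t n) * (H x / c n)" by (simp add: s_def)
        also have "\<dots> \<le> \<eta> * (H x / c n)" using Ct_le Hx cn by (intro mult_right_mono) auto
        finally show ?thesis by simp
      qed
      have late: "(\<Sum>j\<in>{n - m n..<n}. ?T j) \<le> \<eta> * H x / c n"
      proof -
        define s where "s = 2 * 4 ^ p * C1 * H x / (real n * c n)"
        have s: "0 \<le> s" using C1(1) Hx cn by (simp add: s_def)
        have "(\<Sum>j\<in>{n - m n..<n}. ?T j) \<le> (\<Sum>j\<in>{n - m n..<n}. s)"
        proof (intro sum_mono spitzer_term_le x(1))
          fix j y assume "j \<in> {n - m n..<n}" and y: "0 \<le> y" "y < x"
          then have j: "n \<le> 2 * j" "1 \<le> j" using m4 n by auto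
          have cj: "0 < c j" by (rule c_pos[OF j(2)])
          have "c n \<le> 4 ^ p * c j" using c_le_power[OF j(2,1) n] by (simp add: p_def)
          moreover have "real n \<le> 2 * real j" using j(1) by linarith
          ultimately have "real n * c n \<le> (2 * real j) * (4 ^ p * c j)"
            using cn by (intro mult_mono) auto
          then have "C1 * H x * (real n * c n) \<le> C1 * H x * ((2 * real j) * (4 ^ p * c j))"
            using C1(1) Hx by (intro mult_left_mono) auto
          then have "C1 * H x / (real j * c j) \<le> s"
            using n j cn cj by (simp add: s_def divide_le_eq pos_le_divide_eq mult_ac)
          moreover have "stay_prob j y \<le> C1 * H x / (real j * c j)"
            using y by (intro stay_prob_le_below[OF C1 j(2) x(1)]) auto
          ultimately show "stay_prob j y \<le> s" by linarith
        qed
        also have "\<dots> = real (m n) * s" using m4 by simp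
        also have "\<dots> \<le> 2 * \<epsilon> * real n * s" using m_le s by (intro mult_right_mono)
        also have "\<dots> = (4 * 4 ^ p * C1 * \<epsilon>) * (H x / c n)" using n by (simp add: s_def)
        also have "\<dots> \<le> \<eta> * (H x / c n)"
          using \<epsilon>(4) C1(1) Hx cn by (intro mult_right_mono) (auto simp: field_simps)
        finally show ?thesis by simp
      qed
      have split: "real n * stay_prob n x = (\<Sum>j<m n. ?T j) + (\<Sum>j\<in>{m n..<n - m n}. ?T j) + (\<Sum>j\<in>{n - m n..<n}. ?T j)"
        using sum.atLeastLessThan_concat[of 0 "m n" "n - m n" ?T]
          sum.atLeastLessThan_concat[of 0 "n - m n" n ?T] m4
        by (simp add: stay_prob_sum atLeast0LessThan)
      have "real n * stay_prob n x \<le> (A + \<eta>) / (1 - \<eta>) * H x / c n + \<eta> * H x / c n + \<eta> * H x / c n"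
        unfolding split using early_up middle late by (intro add_mono)
      also have "\<dots> = ((A + \<eta>) / (1 - \<eta>) + 2 * \<eta>) * (H x / c n)"
        by (simp add: algebra_simps)
      also have "\<dots> \<le> (A + e) * (H x / c n)" using \<eta>_up Hx cn by (intro mult_right_mono) auto
      finally have up: "real n * c n * stay_prob n x \<le> (A + e) * H x"
        using cn by (simp add: pos_le_divide_eq mult_ac)
      have "(A - e) * (H x / c n) \<le> (A - \<eta>) * (1 - \<eta>) * (H x / c n)"
        using \<eta>_low Hx cn by (intro mult_right_mono) auto
      also have "\<dots> \<le> (\<Sum>j<m n. ?T j)" using early_low by simp
      also have "\<dots> \<le> real n * stay_prob n x"
        unfolding split using prob_nonneg(4) by (simp add: sum_nonneg)
      finally have low: "(A - e) * H x \<le> real n * c n * stay_prob n x"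
        using cn by (simp add: pos_divide_le_eq mult_ac)
      show "\<bar>real n * c n * stay_prob n x - h * g 0 * H x\<bar> \<le> e * H x"
        using up low by (simp add: A_def[symmetric] abs_le_iff algebra_simps)
    qed
  qed
qed

end

lemma tendsto_0_ennrealI:
  fixes f :: "nat \<Rightarrow> ennreal"
  assumes "\<And>e. 0 < e \<Longrightarrow> \<forall>\<^sub>F n in sequentially. f n \<le> ennreal e"
  shows "f \<longlonglongrightarrow> 0"
proof (rule order_tendstoI)
  fix b :: ennreal assume "0 < b"
  then obtain b' where "0 < b'" "b' < b" using dense by blast
  then obtain e where e: "b' = ennreal e" "0 \<le> e" by (cases b') (auto simp: top.extremum_strict)
  then have "\<forall>\<^sub>F n in sequentially. f n \<le> ennreal e" using \<open>0 < b'\<close> by (intro assms) (auto simp: less_le)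
  then show "\<forall>\<^sub>F n in sequentially. f n < b"
    using e \<open>b' < b\<close> by (auto elim!: eventually_mono)
qed auto

text \<open>
The conditional probability divided by the right-hand side is n c(n) b(n, x) / (h g(0) H(x)), where
P(tau^- > n) has cancelled. This probability is positive for large n because b(n, x) is.
\<close>
theorem theorem5:
  fixes M :: "'a measure" and X :: "nat \<Rightarrow> 'a \<Rightarrow> real" and c \<delta> :: "nat \<Rightarrow> real"
    and \<alpha> \<beta> \<kappa> h a :: real and g :: "real \<Rightarrow> real"
  assumes "prob_space M"
    and "iid M X"
    and "(\<alpha>, \<beta>) \<in> stable_params"
    and "norming_seq (distr M borel (X 0)) c"
    and "attracted M X c \<alpha> \<beta> \<kappa>"
    and "stable_density \<alpha> \<beta> \<kappa> g"
    and "lattice_law (distr M borel (X 0)) h a"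
    and "\<forall>n\<ge>1. 0 < \<delta> n"
    and "\<delta> \<longlonglongrightarrow> 0"
  shows "(\<lambda>n. SUP x \<in> {- a * real n <.. - a * real n + \<delta> n * c n} \<inter> lattice_points h 0.
            ennreal \<bar>c n * \<P>(\<omega> in M. walk X n \<omega> = a * real n + x \<bar> tau_minus X \<omega> > enat n)
              / (h * g 0 * (renewal M X (a * real n + x)
                   / (real n * \<P>(\<omega> in M. tau_minus X \<omega> > enat n)))) - 1\<bar>)
         \<longlonglongrightarrow> 0"
proof -
  interpret stable_walk_density M X c \<alpha> \<beta> \<kappa> h a g
    using assms by (intro stable_walk_density.intro stable_walk.intro stable_walk_axioms.intro
        stable_walk_density_axioms.intro)
  define A where "A = h * g 0"
  have A: "0 < A" using span_pos g0_pos by (simp add: A_def)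
  show ?thesis
  proof (rule tendsto_0_ennrealI)
    fix e :: real assume e: "0 < e"
    \<comment> \<open>the bound \<open>e' < A\<close> makes \<open>stay_prob\<close> positive\<close>
    define e' where "e' = min (e * A) (A / 2)"
    have e': "0 < e'" "e' \<le> e * A" "e' < A" using e A by (auto simp: e'_def)
    show "\<forall>\<^sub>F n in sequentially. (SUP x \<in> {- a * real n <.. - a * real n + \<delta> n * c n} \<inter> lattice_points h 0.
            ennreal \<bar>c n * \<P>(\<omega> in M. walk X n \<omega> = a * real n + x \<bar> tau_minus X \<omega> > enat n)
              / (h * g 0 * (renewal M X (a * real n + x)
                   / (real n * \<P>(\<omega> in M. tau_minus X \<omega> > enat n)))) - 1\<bar>) \<le> ennreal e"
      using stay_prob_asymptotics[OF assms(9) e'(1)] eventually_ge_at_top[of 1]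
    proof eventually_elim
      case (elim n)
      show ?case
      proof (intro SUP_least ennreal_leI)
        fix x assume x: "x \<in> {- a * real n <.. - a * real n + \<delta> n * c n} \<inter> lattice_points h 0"
        define u where "u = a * real n + x"
        obtain k :: int where "x = of_int k * h" using x by (auto simp: lattice_points_def)
        then have "u \<in> lattice_points h (a * real n)" by (auto simp: u_def lattice_points_def)
        moreover have u: "0 < u" "u \<le> \<delta> n * c n" using x by (auto simp: u_def)
        ultimately have near: "\<bar>real n * c n * stay_prob n u - A * H u\<bar> \<le> e' * H u"
          using elim(1) by (simp add: A_def)
        have Hu: "1 \<le> H u" by (rule H_ge_1[OF u(1)])
        let ?q = "\<P>(\<omega> in M. tau_minus X \<omega> > enat n)"
        have n: "1 \<le> n" using elim(2) .
        have "e' * H u < A * H u" using e' Hu by (intro mult_strict_right_mono) auto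
        then have "0 < real n * c n * stay_prob n u" using near by linarith
        then have b: "0 < stay_prob n u" using n c_pos[OF n] prob_nonneg(1)[of n u] by (simp add: zero_less_mult_iff)
        have "stay_prob n u \<le> ?q"
          unfolding stay_prob_eq tau_minus_gt_iff by (intro finite_measure_mono) auto
        then have q: "0 < ?q" using b by linarith
        have cond: "\<P>(\<omega> in M. walk X n \<omega> = u \<bar> tau_minus X \<omega> > enat n) = stay_prob n u / ?q"
          by (simp add: cond_prob_def stay_prob_eq)
        have "c n * (stay_prob n u / ?q) / (A * (H u / (real n * ?q))) - 1
            = (real n * c n * stay_prob n u - A * H u) / (A * H u)"
          using q A Hu n by (simp add: field_simps)
        also have "\<bar>\<dots>\<bar> = \<bar>real n * c n * stay_prob n u - A * H u\<bar> / (A * H u)"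
          using A Hu by (simp add: abs_divide abs_mult)
        also have "\<dots> \<le> e' * H u / (A * H u)"
          using A Hu by (intro divide_right_mono near) auto
        also have "\<dots> = e' / A" using Hu by simp
        also have "\<dots> \<le> e" using e'(2) A by (simp add: divide_le_eq)
        finally show "\<bar>c n * \<P>(\<omega> in M. walk X n \<omega> = a * real n + x \<bar> tau_minus X \<omega> > enat n)
              / (h * g 0 * (renewal M X (a * real n + x) / (real n * ?q))) - 1\<bar> \<le> e"
          unfolding u_def[symmetric] A_def[symmetric] cond .
      qed
    qed
  qed
qed

end
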